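(* Let $m\ge 1$, let $f$ be a non-constant meromorphic function on $\mathbb{C}$, and let $\lambda_1,\ldots,\lambda_m$ be meromorphic functions on $\mathbb{C}$ such that there exists a real number $\varrho<1$ with $$T_{\lambda_i}(r)\leq\frac{\varrho}{m+\widetilde{m}}\,T_f(r)+S_f(r)\qquad (i=1,\ldots,m),$$ where $\widetilde{m}$ is the number of indices $i$ for which $\lambda_i$ is not entire. Fix an $m$-tuple of integers $(r_1,\ldots,r_m)$ and an $m$-tuple of (complex) roots of unity $(\epsilon_1,\ldots,\epsilon_m)$, and for $n\in\mathbb{Z}$ let $$B(n):=\lambda_1(z)\,(\epsilon_1 f^{r_1}(z))^n+\cdots+\lambda_m(z)\,(\epsilon_m f^{r_m}(z))^n .$$ Let $N=\max\{r_1,\ldots,r_m\}-\min\{r_1,\ldots,r_m\}$. Fix an integer $e>\frac{2}{1-\varrho}$ such that $\epsilon_i^e=1$ for all $i=1,\ldots,m$. Let $a$ be a positive integer such that $$p^{\,1+\operatorname{ord}_p a-\operatorname{ord}_p e}>N+\frac{2}{1-\varrho}$$ for every prime divisor $p$ of $e$. Assume that there exists an integer $k$ such that $B(k)$ vanishes at every zero of $f^a-1$. Then: (i) If $e$ divides $k$, then $\lambda_1+\cdots+\lambda_m\equiv 0$, i.e. $B(0)$ vanishes identically. (ii) If $e$ does not divide $k$, then $\sum_{i=1}^m\lambda_i\epsilon_i^k X^{r_i}\in\mathcal{M}[X,X^{-1}]$ is the zero polynomial; in particular $B(k)$ vanishes identically.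
   Context: $\mathcal{M}$ denotes the field of meromorphic functions on $\mathbb{C}$. Here $f^{r}$ is the $r$-th power of $f$ in $\mathcal M$ (not an iterate). For a prime $p$, $\operatorname{ord}_p$ is the $p$-adic valuation on integers. Nevanlinna notation: for meromorphic $f$ and $z\in\mathbb{C}$ put $\operatorname{ord}_z^-(f)=-\min\{0,\operatorname{ord}_z(f)\}$. The counting function is $$N_f(r,\infty)=\sum_{0<|z|\le r}\operatorname{ord}_z^-(f)\log\left|\tfrac{r}{z}\right|+\operatorname{ord}_0^-(f)\log r,$$ the proximity function is $m_f(r,\infty)=\int_0^{2\pi}\log^+|f(re^{i\theta})|\frac{d\theta}{2\pi}$ with $\log^+x=\max\{0,\log x\}$, and the characteristic function is $T_f(r)=m_f(r,\infty)+N_f(r,\infty)$. The symbol $S_f(r)$ stands for any real function $h(r)$ with $h(r)/T_f(r)\to 0$ as $r\to\infty$, $r\notin E$, where $E$ is an exceptional set of finite Lebesgue measure. *)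

theory Defs
  imports "HOL-Complex_Analysis.Complex_Analysis" "HOL-Library.Poly_Mapping"
begin

section \<open>The field of meromorphic functions on the complex plane\<close>

text \<open>
  Every meromorphic function on the plane is represented by its unique normal form: removable
  singularities are removed, and the (meaningless) value at a pole is 0.
\<close>

typedef mero = "{f :: complex \<Rightarrow> complex. f nicely_meromorphic_on UNIV}"
  morphisms mero_eval Abs_mero
  by (rule exI[of _ "\<lambda>_. 0"]) auto

definition to_mero :: "(complex \<Rightarrow> complex) \<Rightarrow> mero" where
  "to_mero g = Abs_mero (remove_sings g)"

lemma nicely_meromorphic_mero_eval [simp, intro]: "mero_eval f nicely_meromorphic_on UNIV"
  using mero_eval[of f] by simp

lemma meromorphic_mero_eval [simp, meromorphic_intros]: "mero_eval f meromorphic_on A"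
  using nicely_meromorphic_mero_eval[of f] meromorphic_on_subset[of _ UNIV A]
  by (auto simp: nicely_meromorphic_on_def)

lemma mero_eval_to_mero:
  assumes "g meromorphic_on UNIV"
  shows   "mero_eval (to_mero g) = remove_sings g"
  using remove_sings_nicely_meromorphic[OF assms] by (simp add: to_mero_def Abs_mero_inverse)

lemma mero_eval_to_mero_ae:
  assumes "g meromorphic_on UNIV"
  shows   "\<forall>\<^sub>\<approx>z. mero_eval (to_mero g) z = g z"
  using eventually_remove_sings_eq[OF assms] by (simp add: mero_eval_to_mero[OF assms])

lemma remove_sings_mero_eval [simp]: "remove_sings (mero_eval f) = mero_eval f"
proof
  fix z
  have "(is_pole (mero_eval f) z \<and> mero_eval f z = 0) \<or> mero_eval f \<midarrow>z\<rightarrow> mero_eval f z"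
    using nicely_meromorphic_mero_eval[of f] by (auto simp: nicely_meromorphic_on_def)
  thus "remove_sings (mero_eval f) z = mero_eval f z"
    by auto
qed

lemma mero_eqI:
  assumes "\<forall>\<^sub>\<approx>z. mero_eval f z = mero_eval g z"
  shows   "f = g"
proof -
  have "remove_sings (mero_eval f) z = remove_sings (mero_eval g) z" for z
    using assms by (intro remove_sings_cong) (auto simp: eventually_cosparse_open_eq)
  thus ?thesis
    by (simp add: mero_eval_inject fun_eq_iff flip: mero_eval_inject)
qed

lemma mero_cases_ae: "(\<forall>z. mero_eval f z = c) \<or> (\<forall>\<^sub>\<approx>z. mero_eval f z \<noteq> c)"
  using nicely_meromorphic_imp_constant_or_avoid[of "mero_eval f" UNIV c] by auto

definition mero_const :: "complex \<Rightarrow> mero" where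
  "mero_const c = to_mero (\<lambda>_. c)"

instantiation mero :: field
begin

definition "0 = mero_const 0"
definition "1 = mero_const 1"
definition "f + g = to_mero (\<lambda>z. mero_eval f z + mero_eval g z)"
definition "f - g = to_mero (\<lambda>z. mero_eval f z - mero_eval g z)"
definition "- f = to_mero (\<lambda>z. - mero_eval f z)"
definition "f * g = to_mero (\<lambda>z. mero_eval f z * mero_eval g z)"
definition "inverse f = to_mero (\<lambda>z. inverse (mero_eval f z))"
definition "(f :: mero) div g = f * inverse g"

lemma mero_eval_const [simp]: "mero_eval (mero_const c) z = c"
  by (simp add: mero_const_def mero_eval_to_mero meromorphic_on_const)

lemma mero_eval_0 [simp]: "mero_eval 0 z = 0"
  and mero_eval_1 [simp]: "mero_eval 1 z = 1"
  by (simp_all add: zero_mero_def one_mero_def)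

lemma mero_eval_add_ae: "\<forall>\<^sub>\<approx>z. mero_eval (f + g) z = mero_eval f z + mero_eval g z"
  and mero_eval_diff_ae: "\<forall>\<^sub>\<approx>z. mero_eval (f - g) z = mero_eval f z - mero_eval g z"
  and mero_eval_uminus_ae: "\<forall>\<^sub>\<approx>z. mero_eval (- f) z = - mero_eval f z"
  and mero_eval_mult_ae: "\<forall>\<^sub>\<approx>z. mero_eval (f * g) z = mero_eval f z * mero_eval g z"
  and mero_eval_inverse_ae: "\<forall>\<^sub>\<approx>z. mero_eval (inverse f) z = inverse (mero_eval f z)"
  unfolding plus_mero_def minus_mero_def uminus_mero_def times_mero_def inverse_mero_def
  by (rule mero_eval_to_mero_ae, intro meromorphic_intros meromorphic_mero_eval)+

instance
proof
  fix f g h :: mero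
  show "f + g + h = f + (g + h)"
  proof (rule mero_eqI)
    show "\<forall>\<^sub>\<approx>z. mero_eval (f + g + h) z = mero_eval (f + (g + h)) z"
      using mero_eval_add_ae[of "f + g" h] mero_eval_add_ae[of f g]
            mero_eval_add_ae[of f "g + h"] mero_eval_add_ae[of g h]
      by eventually_elim simp
  qed
  show "f + g = g + f"
    by (simp add: plus_mero_def add.commute)
  show "0 + f = f"
    by (rule mero_eqI, rule eventually_mono[OF mero_eval_add_ae[of 0 f]]) simp
  show "- f + f = 0"
  proof (rule mero_eqI)
    show "\<forall>\<^sub>\<approx>z. mero_eval (- f + f) z = mero_eval 0 z"
      using mero_eval_add_ae[of "- f" f] mero_eval_uminus_ae[of f]
      by eventually_elim simp
  qed
  show "f - g = f + - g"
  proof (rule mero_eqI)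
    show "\<forall>\<^sub>\<approx>z. mero_eval (f - g) z = mero_eval (f + - g) z"
      using mero_eval_diff_ae[of f g] mero_eval_add_ae[of f "- g"] mero_eval_uminus_ae[of g]
      by eventually_elim simp
  qed
  show "f * g * h = f * (g * h)"
  proof (rule mero_eqI)
    show "\<forall>\<^sub>\<approx>z. mero_eval (f * g * h) z = mero_eval (f * (g * h)) z"
      using mero_eval_mult_ae[of "f * g" h] mero_eval_mult_ae[of f g]
            mero_eval_mult_ae[of f "g * h"] mero_eval_mult_ae[of g h]
      by eventually_elim simp
  qed
  show "f * g = g * f"
    by (simp add: times_mero_def mult.commute)
  show "1 * f = f"
    by (rule mero_eqI, rule eventually_mono[OF mero_eval_mult_ae[of 1 f]]) simp
  show "(f + g) * h = f * h + g * h"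
  proof (rule mero_eqI)
    show "\<forall>\<^sub>\<approx>z. mero_eval ((f + g) * h) z = mero_eval (f * h + g * h) z"
      using mero_eval_mult_ae[of "f + g" h] mero_eval_add_ae[of f g]
            mero_eval_add_ae[of "f * h" "g * h"] mero_eval_mult_ae[of f h] mero_eval_mult_ae[of g h]
      by eventually_elim (simp add: ring_distribs)
  qed
  have "mero_eval 0 0 \<noteq> mero_eval 1 0"
    by simp
  thus "(0 :: mero) \<noteq> 1"
    by metis
  show "inverse f * f = 1" if "f \<noteq> 0"
  proof (rule mero_eqI)
    have "\<not>(\<forall>z. mero_eval f z = 0)"
    proof
      assume "\<forall>z. mero_eval f z = 0"
      hence "f = 0"
        by (intro mero_eqI) simp
      with that show False by contradiction
    qed
    hence "\<forall>\<^sub>\<approx>z. mero_eval f z \<noteq> 0"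
      using mero_cases_ae[of f 0] by blast
    thus "\<forall>\<^sub>\<approx>z. mero_eval (inverse f * f) z = mero_eval 1 z"
      using mero_eval_mult_ae[of "inverse f" f] mero_eval_inverse_ae[of f]
      by eventually_elim simp
  qed
  show "f div g = f * inverse g"
    by (simp add: divide_mero_def)
  have "inverse (0 :: mero) = mero_const 0"
    by (simp add: inverse_mero_def mero_const_def)
  thus "inverse (0 :: mero) = 0"
    by (simp add: zero_mero_def)
qed

end

definition is_entire :: "mero \<Rightarrow> bool" where
  "is_entire f \<longleftrightarrow> mero_eval f holomorphic_on UNIV"

text \<open>The value 0 at a pole is only a convention, so poles have to be excluded here.\<close>

definition vanishes_at :: "mero \<Rightarrow> complex \<Rightarrow> bool" where
  "vanishes_at f z \<longleftrightarrow> \<not>is_pole (mero_eval f) z \<and> mero_eval f z = 0"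


section \<open>Nevanlinna functions\<close>

text \<open>
  The zero function has order \<open>\<infinity>\<close> at every point, hence no polar part; the value of
  \<^const>\<open>zorder\<close> on it is unspecified.
\<close>

definition ord_minus :: "mero \<Rightarrow> complex \<Rightarrow> int" where
  "ord_minus f z = (if f = 0 then 0 else - min 0 (zorder (mero_eval f) z))"

text \<open>
  The sum is restricted to the support of the summand, which is finite, because a \<^const>\<open>sum\<close>
  over an infinite set is 0 by convention.
\<close>

definition counting_fun :: "mero \<Rightarrow> real \<Rightarrow> real" where
  "counting_fun f r =
     (\<Sum>z | 0 < norm z \<and> norm z \<le> r \<and> ord_minus f z \<noteq> 0.
        of_int (ord_minus f z) * ln (norm (of_real r / z)))
     + of_int (ord_minus f 0) * ln r"

lemma ord_minus_nonzero_imp_pole: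
  assumes "ord_minus f z \<noteq> 0"
  shows   "is_pole (mero_eval f) z"
proof (rule zorder_neg_imp_is_pole)
  from assms have "f \<noteq> 0" and "zorder (mero_eval f) z < 0"
    by (auto simp: ord_minus_def split: if_splits)
  show "mero_eval f meromorphic_on {z}"
    by simp
  show "zorder (mero_eval f) z < 0" by fact
  have "f = 0" if "\<forall>z. mero_eval f z = 0"
    using that by (intro mero_eqI) simp
  hence "\<forall>\<^sub>\<approx>z. mero_eval f z \<noteq> 0"
    using mero_cases_ae[of f 0] \<open>f \<noteq> 0\<close> by blast
  thus "\<forall>\<^sub>F w in at z. mero_eval f w \<noteq> 0"
    by (auto simp: eventually_cosparse_open_eq)
qed

lemma finite_ord_minus_support: "finite {z. 0 < norm z \<and> norm z \<le> r \<and> ord_minus f z \<noteq> 0}"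
proof -
  have "\<forall>\<^sub>\<approx>z. \<not>is_pole (mero_eval f) z"
    by (rule meromorphic_on_imp_not_pole_cosparse) simp
  hence "{z. is_pole (mero_eval f) z} sparse_in UNIV"
    by (simp add: eventually_cosparse)
  hence "finite (cball 0 r \<inter> {z. is_pole (mero_eval f) z})"
    by (intro sparse_in_compact_finite) (auto intro: sparse_in_subset)
  thus ?thesis
    by (rule rev_finite_subset) (auto dest: ord_minus_nonzero_imp_pole)
qed

definition log_plus :: "real \<Rightarrow> real" where
  "log_plus x = max 0 (ln x)"

definition proximity_fun :: "mero \<Rightarrow> real \<Rightarrow> real" where
  "proximity_fun f r =
     integral {0..2 * pi} (\<lambda>\<theta>. log_plus (norm (mero_eval f (of_real r * cis \<theta>)))) / (2 * pi)"

definition nevanlinna_char :: "mero \<Rightarrow> real \<Rightarrow> real" where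
  "nevanlinna_char f r = proximity_fun f r + counting_fun f r"

definition is_small_error :: "mero \<Rightarrow> (real \<Rightarrow> real) \<Rightarrow> bool" where
  "is_small_error f h \<longleftrightarrow>
     (\<exists>E. E \<in> lmeasurable \<and>
          ((\<lambda>r. h r / nevanlinna_char f r) \<longlongrightarrow> 0) (inf at_top (principal (- E))))"


section \<open>Exponential polynomials in a meromorphic function\<close>

definition exp_poly ::
  "nat \<Rightarrow> (nat \<Rightarrow> mero) \<Rightarrow> (nat \<Rightarrow> complex) \<Rightarrow> (nat \<Rightarrow> int) \<Rightarrow> mero \<Rightarrow> int \<Rightarrow> mero" where
  "exp_poly m lam eps R f n = (\<Sum>i = 1..m. lam i * (mero_const (eps i) * f powi R i) powi n)"

text \<open>
  Laurent polynomials over a ring are finitely supported functions on the integers; the monomial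
  \<open>c X\<^sup>j\<close> is \<open>Poly_Mapping.single j c\<close>.
\<close>

definition laurent_poly ::
  "nat \<Rightarrow> (nat \<Rightarrow> mero) \<Rightarrow> (nat \<Rightarrow> complex) \<Rightarrow> (nat \<Rightarrow> int) \<Rightarrow> int \<Rightarrow> (int \<Rightarrow>\<^sub>0 mero)" where
  "laurent_poly m lam eps R k =
     (\<Sum>i = 1..m. Poly_Mapping.single (R i) (lam i * mero_const (eps i) powi k))"

end

theory Submission
  imports Defs
begin

text \<open>
  Suppose the conclusion fails. At a point with \<open>f z = \<zeta>\<close>, \<open>\<zeta>\<^sup>a = 1\<close>, where no \<open>lam i\<close> has a pole,
  \<open>exp_poly m lam eps R f k\<close> takes the value \<open>P\<^sub>\<zeta>(z)\<close> with
  \<open>P\<^sub>\<zeta> = \<Sum>\<^sub>i lam i \<cdot> (eps i \<cdot> \<zeta> powi R i) powi k\<close>, so \<open>P\<^sub>\<zeta>\<close> is a meromorphic function that has a zero there.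
  If \<open>e\<close> divides \<open>k\<close>, then \<open>P\<^sub>\<zeta> = \<Sum>\<^sub>i lam i\<close> for each of the \<open>e\<close> roots \<open>\<zeta>\<close> of order dividing \<open>e\<close>; otherwise a
  prime \<open>p\<close> with \<open>ord\<^sub>p k < ord\<^sub>p e\<close> yields \<open>p powi (1 + ord\<^sub>p a - ord\<^sub>p e)\<close> roots of unity with distinct
  values of \<open>\<zeta> powi k\<close>, at most \<open>N\<close> of which are roots of the Laurent polynomial. Either way more than
  \<open>2 / (1 - \<rho>)\<close> values \<open>\<zeta>\<close> have \<open>P\<^sub>\<zeta> \<noteq> 0\<close>, while each is taken on a set counted by at most
  \<open>\<rho> \<cdot> T\<^sub>f + o(T\<^sub>f)\<close>. This contradicts the second main theorem with reduced counting functions.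

  The second main theorem is proved by convexity. Write \<open>f = f1 / f2\<close> with entire \<open>f1\<close>, \<open>f2\<close> without
  common zeros. In \<open>s = log r\<close> the circle mean of \<open>log (|f1 - a f2|\<^sup>2 + \<eta> |f2|\<^sup>2)\<close> is smooth and convex, is at
  most \<open>2 T\<^sub>f + O(1)\<close> uniformly in \<open>\<eta> \<in> (0, 1]\<close>, and its second derivative is \<open>4 r\<^sup>2\<close> times the mean of
  \<open>\<eta> |f'|\<^sup>2 / (|f - a|\<^sup>2 + \<eta>)\<^sup>2\<close>. Borel's growth lemma, applied for all \<open>\<eta> = 2\<^sup>-\<^sup>k\<close> at once, bounds these means
  outside a set of finite measure in \<open>s\<close>. Summing over \<open>k\<close> with weights \<open>2\<^sup>-\<^sup>\<delta>\<^sup>k\<close> bounds the mean of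
  \<open>|f'|\<^sup>2 / |f - a|\<^sup>2\<^sup>-\<^sup>2\<^sup>\<delta>\<close> near \<open>a\<close>, and Jensen's formula for \<open>f' / \<Prod>\<^sub>a (f - a)\<close> does the rest. Working with
  \<open>ds = dr / r\<close> leaves an error of size \<open>\<epsilon> T\<^sub>f + O(1)\<close> without any \<open>log r\<close> term, so rational \<open>f\<close> need
  no separate treatment.
\<close>

section \<open>Orders of meromorphic functions\<close>

text \<open>On the zero function \<open>zorder\<close> is unspecified, so the rules computing
  \<open>mord\<close> assume \<open>f \<noteq> 0\<close>.\<close>

abbreviation mord :: "mero \<Rightarrow> complex \<Rightarrow> int" where
  "mord f z \<equiv> zorder (mero_eval f) z"

abbreviation mpole :: "mero \<Rightarrow> complex \<Rightarrow> bool" where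
  "mpole f z \<equiv> is_pole (mero_eval f) z"

lemma eventually_at_mero:
  assumes "\<forall>\<^sub>\<approx>z. P z" shows "eventually P (at (z :: complex))"
  using assms by (auto simp: eventually_cosparse_open_eq)

lemma mero_nonzero_ae:
  assumes "f \<noteq> 0" shows "\<forall>\<^sub>\<approx>z. mero_eval f z \<noteq> 0"
proof -
  have "\<not> (\<forall>z. mero_eval f z = 0)"
    using assms mero_eqI[of f 0] by (auto intro!: always_eventually)
  thus ?thesis using mero_cases_ae[of f 0] by blast
qed

lemma mero_nonzero_at: "f \<noteq> 0 \<Longrightarrow> eventually (\<lambda>w. mero_eval f w \<noteq> 0) (at z)"
  by (rule eventually_at_mero[OF mero_nonzero_ae])

lemma mero_nonzero_freq: "f \<noteq> 0 \<Longrightarrow> frequently (\<lambda>w. mero_eval f w \<noteq> 0) (at z)"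
  using mero_nonzero_at by (simp add: eventually_frequently)

lemma mord_mult:
  assumes "f \<noteq> 0" "g \<noteq> 0"
  shows "mord (f * g) z = mord f z + mord g z"
proof -
  have "mord (f * g) z = zorder (\<lambda>w. mero_eval f w * mero_eval g w) z"
    by (rule zorder_cong[OF eventually_at_mero[OF mero_eval_mult_ae]]) auto
  also have "\<dots> = mord f z + mord g z"
    by (intro zorder_mult meromorphic_mero_eval mero_nonzero_freq assms)
  finally show ?thesis .
qed

lemma mord_inverse:
  assumes "f \<noteq> 0"
  shows "mord (inverse f) z = - mord f z"
proof -
  have "mord (inverse f * f) z = mord (inverse f) z + mord f z"
    using assms by (intro mord_mult) auto
  also have "inverse f * f = 1" using assms by simp
  also have "mord 1 z = 0"
    using zorder_eq_0_iff[of "mero_eval 1" z] by (simp add: mero_eval_1[abs_def])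
  finally show ?thesis by simp
qed

lemma mord_add_ge:
  assumes "f \<noteq> 0" "g \<noteq> 0" "f + g \<noteq> 0" "mord f z \<ge> c" "mord g z \<ge> c"
  shows "mord (f + g) z \<ge> c"
proof -
  have ev: "\<forall>\<^sub>F w in at z. mero_eval (f + g) w = mero_eval f w + mero_eval g w"
    by (rule eventually_at_mero[OF mero_eval_add_ae])
  have "mord (f + g) z = zorder (\<lambda>w. mero_eval f w + mero_eval g w) z"
    by (rule zorder_cong[OF ev]) auto
  also have "\<dots> \<ge> c"
  proof (intro zorder_add_ge meromorphic_mero_eval mero_nonzero_freq assms)
    have "eventually (\<lambda>w. mero_eval f w + mero_eval g w \<noteq> 0) (at z)"
      using ev mero_nonzero_at[OF assms(3)] by eventually_elim auto
    thus "frequently (\<lambda>w. mero_eval f w + mero_eval g w \<noteq> 0) (at z)"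
      by (simp add: eventually_frequently)
  qed
  finally show ?thesis .
qed

lemma mpole_iff: "mpole f z \<longleftrightarrow> f \<noteq> 0 \<and> mord f z < 0"
proof
  assume p: "mpole f z"
  show "f \<noteq> 0 \<and> mord f z < 0"
  proof
    show "f \<noteq> 0"
      using p by (auto simp: mero_eval_0[abs_def])
    have "isolated_singularity_at (mero_eval f) z"
      using meromorphic_mero_eval[of f "{z}"] by (simp add: meromorphic_at_iff)
    thus "mord f z < 0"
      using p isolated_pole_imp_neg_zorder by blast
  qed
next
  assume "f \<noteq> 0 \<and> mord f z < 0"
  thus "mpole f z"
    using zorder_neg_imp_is_pole[OF meromorphic_mero_eval mero_nonzero_at] by blast
qed

lemma mero_eval_analytic: "\<not> mpole f z \<Longrightarrow> mero_eval f analytic_on {z}"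
  by (rule nicely_meromorphic_on_imp_analytic_at[OF nicely_meromorphic_mero_eval]) auto

lemma mpole_imp_zero: "mpole f z \<Longrightarrow> mero_eval f z = 0"
  by (rule is_pole_zero_at_nicely_mero[OF nicely_meromorphic_mero_eval]) auto

lemma mero_zero_iff:
  assumes "\<not> mpole f z"
  shows "mero_eval f z = 0 \<longleftrightarrow> f = 0 \<or> mord f z > 0"
proof (cases "f = 0")
  case False
  thus ?thesis
    using zorder_pos_iff'[OF mero_eval_analytic[OF assms] mero_nonzero_freq[OF False]] by simp
qed simp

text \<open>The normal form takes the value 0 at poles as well as at zeros, so one condition on the
  value excludes both signs of the order.\<close>

lemma mord_eq_0_iff:
  assumes "f \<noteq> 0"
  shows "mord f z = 0 \<longleftrightarrow> mero_eval f z \<noteq> 0"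
  using mero_zero_iff[of f z] mpole_iff[of f z] mpole_imp_zero[of f z] assms by fastforce

section \<open>Pointwise evaluation of the field operations away from poles\<close>

lemma to_mero_eval_analytic:
  assumes "g meromorphic_on UNIV" "g analytic_on {z}"
  shows "\<not> mpole (to_mero g) z" "mero_eval (to_mero g) z = g z"
proof -
  show "mero_eval (to_mero g) z = g z"
    using assms by (simp add: mero_eval_to_mero remove_sings_at_analytic)
  have "mpole (to_mero g) z \<longleftrightarrow> is_pole g z"
    by (rule is_pole_cong[OF eventually_at_mero[OF mero_eval_to_mero_ae[OF assms(1)]]]) auto
  thus "\<not> mpole (to_mero g) z"
    using assms(2) analytic_at_imp_no_pole by blast
qed

lemma mero_eval_add:
  assumes "\<not> mpole f z" "\<not> mpole g z"
  shows "\<not> mpole (f + g) z" "mero_eval (f + g) z = mero_eval f z + mero_eval g z"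
  unfolding plus_mero_def using assms
  by (intro to_mero_eval_analytic meromorphic_intros meromorphic_mero_eval analytic_intros
      mero_eval_analytic; simp)+

lemma mero_eval_diff:
  assumes "\<not> mpole f z" "\<not> mpole g z"
  shows "\<not> mpole (f - g) z" "mero_eval (f - g) z = mero_eval f z - mero_eval g z"
  unfolding minus_mero_def using assms
  by (intro to_mero_eval_analytic meromorphic_intros meromorphic_mero_eval analytic_intros
      mero_eval_analytic; simp)+

lemma mero_eval_mult:
  assumes "\<not> mpole f z" "\<not> mpole g z"
  shows "\<not> mpole (f * g) z" "mero_eval (f * g) z = mero_eval f z * mero_eval g z"
  unfolding times_mero_def using assms
  by (intro to_mero_eval_analytic meromorphic_intros meromorphic_mero_eval analytic_intros
      mero_eval_analytic; simp)+

lemma mero_eval_inverse: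
  assumes "\<not> mpole f z" "mero_eval f z \<noteq> 0"
  shows "\<not> mpole (inverse f) z" "mero_eval (inverse f) z = inverse (mero_eval f z)"
  unfolding inverse_mero_def using assms
  by (intro to_mero_eval_analytic meromorphic_intros meromorphic_mero_eval analytic_on_inverse
      mero_eval_analytic; simp)+

lemma mero_const_not_pole [simp]: "\<not> mpole (mero_const c) z"
  by (simp add: mero_eval_const[abs_def])

lemma mero_eval_power:
  assumes "\<not> mpole f z"
  shows "\<not> mpole (f ^ n) z" "mero_eval (f ^ n) z = mero_eval f z ^ n"
proof (induction n)
  case 0
  { case 1 show ?case using mero_const_not_pole[of 1 z] by (simp add: one_mero_def)
  next case 2 show ?case by simp }
next
  case (Suc n)
  { case 1 show ?case using mero_eval_mult(1)[OF assms Suc(1)] by simp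
  next case 2 show ?case using mero_eval_mult(2)[OF assms Suc(1)] Suc(2) by simp }
qed

lemma mero_eval_powi:
  assumes "\<not> mpole f z" "mero_eval f z \<noteq> 0"
  shows "\<not> mpole (f powi n) z" "mero_eval (f powi n) z = mero_eval f z powi n"
  using mero_eval_power[OF assms(1), of "nat n"] mero_eval_power[OF mero_eval_inverse(1)[OF assms], of "nat (-n)"]
    mero_eval_inverse(2)[OF assms]
  by (auto simp: power_int_def)

lemma mero_eval_sum:
  assumes "finite A" "\<And>i. i \<in> A \<Longrightarrow> \<not> mpole (F i) z"
  shows "\<not> mpole (sum F A) z \<and> mero_eval (sum F A) z = (\<Sum>i\<in>A. mero_eval (F i) z)"
  using assms
proof (induction A rule: finite_induct)
  case empty
  show ?case using mero_const_not_pole[of 0 z] by (simp add: zero_mero_def)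
next
  case (insert i A)
  thus ?case using mero_eval_add[of "F i" z "sum F A"] by simp
qed

lemma mero_const_add: "mero_const (a + b) = mero_const a + mero_const b"
  by (rule mero_eqI) (use mero_eval_add(2)[of "mero_const a" _ "mero_const b"] in simp)

lemma mero_const_mult: "mero_const (a * b) = mero_const a * mero_const b"
  by (rule mero_eqI) (use mero_eval_mult(2)[of "mero_const a" _ "mero_const b"] in simp)

lemma mero_const_eq_iff [simp]: "mero_const a = mero_const b \<longleftrightarrow> a = b"
  by (metis mero_eval_const)

lemma mero_const_0 [simp]: "mero_const 0 = 0" and mero_const_1 [simp]: "mero_const 1 = 1"
  by (simp_all add: zero_mero_def one_mero_def)

lemma mero_const_power: "mero_const (a ^ n) = mero_const a ^ n"
  by (induction n) (simp_all add: mero_const_mult)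

lemma mero_const_eq_0_iff [simp]: "mero_const a = 0 \<longleftrightarrow> a = 0"
  by (metis mero_const_0 mero_const_eq_iff)

lemma mero_const_inverse: "mero_const (inverse a) = inverse (mero_const a)"
proof (cases "a = 0")
  case False
  hence "mero_const (inverse a) * mero_const a = 1"
    by (simp flip: mero_const_mult)
  thus ?thesis by (metis inverse_unique mult.commute)
qed simp

lemma mero_const_powi: "mero_const (a powi n) = mero_const a powi n"
  by (simp add: power_int_def mero_const_power mero_const_inverse)

lemma mord_const [simp]: "c \<noteq> 0 \<Longrightarrow> mord (mero_const c) z = 0"
  by (simp add: mord_eq_0_iff)

lemma mord_powi:
  assumes "f \<noteq> 0" shows "mord (f powi n) z = n * mord f z"
proof -
  have *: "mord (g ^ k) z = int k * mord g z" if "g \<noteq> 0" for g k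
    by (induction k) (use that mord_const[of 1 z] in \<open>auto simp: mord_mult algebra_simps\<close>)
  show ?thesis using assms by (simp add: power_int_def * mord_inverse)
qed

lemma mord_prod:
  assumes "finite A" "\<And>i. i \<in> A \<Longrightarrow> F i \<noteq> 0"
  shows "mord (prod F A) z = (\<Sum>i\<in>A. mord (F i) z)"
  using assms
proof (induction A rule: finite_induct)
  case empty
  show ?case using mord_const[of 1 z] by simp
next
  case (insert i A)
  thus ?case by (simp add: mord_mult)
qed

text \<open>Linear factors, by which zeros and poles are divided out in the proof of Jensen's
  formula.\<close>

definition mero_lin :: "complex \<Rightarrow> mero" where
  "mero_lin a = to_mero (\<lambda>z. z - a)"

lemma mero_eval_lin [simp]: "mero_eval (mero_lin a) z = z - a"
  unfolding mero_lin_def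
  by (rule to_mero_eval_analytic) (auto intro!: meromorphic_intros analytic_intros)

lemma mero_lin_not_pole [simp]: "\<not> mpole (mero_lin a) z"
  unfolding mero_lin_def
  by (rule to_mero_eval_analytic) (auto intro!: meromorphic_intros analytic_intros)

lemma mero_lin_nonzero [simp]: "mero_lin a \<noteq> 0"
  by (metis add_diff_cancel_left' mero_eval_0 mero_eval_lin zero_neq_one)

lemma mord_lin: "mord (mero_lin a) z = (if z = a then 1 else 0)"
proof (cases "z = a")
  case True
  have "zorder (mero_eval (mero_lin a)) a = 1"
    by (rule zorder_eqI[of UNIV _ "\<lambda>_. 1"]) auto
  with True show ?thesis by simp
qed (simp add: mord_eq_0_iff)

section \<open>Derivatives\<close>

definition mero_deriv :: "mero \<Rightarrow> mero" where
  "mero_deriv f = to_mero (deriv (mero_eval f))"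

lemma mero_deriv_eval:
  assumes "\<not> mpole f z"
  shows "\<not> mpole (mero_deriv f) z" "mero_eval (mero_deriv f) z = deriv (mero_eval f) z"
  unfolding mero_deriv_def using mero_eval_analytic[OF assms]
  by (intro to_mero_eval_analytic meromorphic_intros meromorphic_mero_eval analytic_intros; simp)+

lemma mord_deriv:
  assumes "f \<noteq> 0" "mord f z \<noteq> 0"
  shows "mord (mero_deriv f) z = mord f z - 1"
proof -
  have "mord (mero_deriv f) z = zorder (deriv (mero_eval f)) z"
    unfolding mero_deriv_def
    by (rule zorder_cong[OF eventually_at_mero[OF mero_eval_to_mero_ae]])
       (auto intro!: meromorphic_intros meromorphic_mero_eval)
  also have "\<dots> = mord f z - 1"
    using meromorphic_mero_eval[of f "{z}"] assms
    by (intro zorder_deriv_minus_1 mero_nonzero_freq) (auto simp: meromorphic_at_iff)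
  finally show ?thesis .
qed

lemma mero_not_pole_ae: "\<forall>\<^sub>\<approx>z. \<not> mpole f z"
  by (rule meromorphic_on_imp_not_pole_cosparse) simp

lemma mero_deriv_diff_const: "mero_deriv (f - mero_const a) = mero_deriv f"
proof (rule mero_eqI)
  have "\<forall>\<^sub>\<approx>z. \<not> mpole f z" by (rule mero_not_pole_ae)
  thus "\<forall>\<^sub>\<approx>z. mero_eval (mero_deriv (f - mero_const a)) z = mero_eval (mero_deriv f) z"
  proof eventually_elim
    case (elim z)
    have "mero_eval (f - mero_const a) analytic_on {z}"
      by (rule mero_eval_analytic) (use elim mero_eval_diff in auto)
    have "eventually (\<lambda>w. \<not> mpole f w) (nhds z)"
      using mero_eval_analytic[OF elim]
      by (smt (verit, best) analytic_at analytic_at_imp_no_pole analytic_on_holomorphic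
          eventually_nhds holomorphic_on_subset mem_Collect_eq subsetI analytic_at_two analytic_on_open)
    hence "eventually (\<lambda>w. mero_eval (f - mero_const a) w = mero_eval f w - a) (nhds z)"
      by eventually_elim (simp add: mero_eval_diff)
    hence "deriv (mero_eval (f - mero_const a)) z = deriv (\<lambda>w. mero_eval f w - a) z"
      by (intro deriv_cong_ev) auto
    also have "\<dots> = deriv (mero_eval f) z"
      using mero_eval_analytic[OF elim]
      by (subst deriv_diff) (auto simp: analytic_on_imp_differentiable_at)
    finally show ?case
      using elim mero_eval_diff(1)[of f z "mero_const a"] by (simp add: mero_deriv_eval)
  qed
qed

text \<open>Subtracting the value at a non-pole \<open>z0\<close> gives a nonzero \<open>g\<close>
  with a zero at \<open>z0\<close>. A vanishing derivative would make \<open>g\<close> constant,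
  hence zero, near \<open>z0\<close>, against the isolation of zeros.\<close>

lemma mero_deriv_nonzero:
  assumes "f \<notin> range mero_const"
  shows "mero_deriv f \<noteq> 0"
proof
  assume *: "mero_deriv f = 0"
  obtain z0 where z0: "\<not> mpole f z0"
    using mero_not_pole_ae[of f] eventually_at_mero[of "\<lambda>z. \<not> mpole f z" 0]
    by (metis eventually_frequently frequently_ex trivial_limit_at)
  define g where "g = f - mero_const (mero_eval f z0)"
  have "g \<noteq> 0" using assms by (auto simp: g_def)
  have np: "\<not> mpole g z0" and "mero_eval g z0 = 0"
    using z0 by (auto simp: g_def mero_eval_diff)
  hence "mord g z0 > 0" using \<open>g \<noteq> 0\<close> mero_zero_iff by blast
  have dg0: "mero_deriv g = 0"
    using * by (simp add: g_def mero_deriv_diff_const)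
  have "eventually (\<lambda>w. deriv (mero_eval g) w = 0) (at z0)"
  proof -
    have "eventually (\<lambda>w. mero_eval (mero_deriv g) w = deriv (mero_eval g) w) (at z0)"
      unfolding mero_deriv_def
      by (rule eventually_at_mero[OF mero_eval_to_mero_ae])
         (auto intro!: meromorphic_intros meromorphic_mero_eval)
    thus ?thesis by eventually_elim (simp add: dg0)
  qed
  moreover obtain A where A: "open A" "z0 \<in> A" "mero_eval g holomorphic_on A"
    using mero_eval_analytic[OF np] by (metis analytic_at)
  moreover obtain r1 where "r1 > 0" "ball z0 r1 \<subseteq> A"
    using A open_contains_ball by blast
  moreover obtain r2 where "r2 > 0" "\<And>w. w \<in> ball z0 r2 \<Longrightarrow> w \<noteq> z0 \<Longrightarrow> deriv (mero_eval g) w = 0"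
    using \<open>eventually (\<lambda>w. deriv (mero_eval g) w = 0) (at z0)\<close>
    by (auto simp: eventually_at dist_commute)
  moreover define r where "r = min r1 r2"
  ultimately have r: "r > 0" "ball z0 r \<subseteq> A"
      "\<And>w. w \<in> ball z0 r \<Longrightarrow> w \<noteq> z0 \<Longrightarrow> deriv (mero_eval g) w = 0"
    by auto
  \<comment> \<open>The comparison of \<open>mero_deriv g\<close> with \<open>deriv\<close> was made
    almost everywhere, so the derivative is controlled only off \<open>z0\<close>; continuity covers
    this one exceptional point.\<close>
  have "mero_eval g constant_on ball z0 r"
  proof (rule DERIV_zero_connected_constant_on[where K = "{z0}"])
    show "connected (ball z0 r)" "open (ball z0 r)" "finite {z0}" by auto
    show "continuous_on (ball z0 r) (mero_eval g)"
      using A r holomorphic_on_imp_continuous_on holomorphic_on_subset by blast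
    show "\<forall>x\<in>ball z0 r - {z0}. (mero_eval g has_field_derivative 0) (at x)"
      using A r by (metis DiffD1 DiffD2 holomorphic_derivI singletonI subsetD)
  qed
  hence "\<And>w. w \<in> ball z0 r \<Longrightarrow> mero_eval g w = 0"
    using \<open>mero_eval g z0 = 0\<close> r(1) by (auto simp: constant_on_def)
  hence "eventually (\<lambda>w. mero_eval g w = 0) (at z0)"
    using r(1) by (auto simp: eventually_at dist_commute intro!: exI[of _ r])
  with mero_nonzero_at[OF \<open>g \<noteq> 0\<close>, of z0] have "eventually (\<lambda>w. False) (at z0)"
    by eventually_elim auto
  thus False by simp
qed

section \<open>Discreteness of zeros and poles\<close>

lemma countable_zeros_poles:
  assumes "f \<noteq> 0"
  shows "countable {z. mord f z \<noteq> 0}"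
proof -
  have "{z. mero_eval f z = 0} sparse_in UNIV"
    using mero_nonzero_ae[OF assms] by (simp add: eventually_cosparse)
  hence "countable {z. mero_eval f z = 0}"
    using sparse_imp_countable[of UNIV "{z. mero_eval f z = 0}"] by simp
  thus ?thesis using assms by (simp add: mord_eq_0_iff)
qed

lemma finite_zeros_poles:
  assumes "f \<noteq> 0"
  shows "finite {z. norm z \<le> r \<and> mord f z \<noteq> 0}"
proof -
  have "{z. mero_eval f z = 0} sparse_in UNIV"
    using mero_nonzero_ae[OF assms] by (simp add: eventually_cosparse)
  hence "finite (cball 0 r \<inter> {z. mero_eval f z = 0})"
    by (intro sparse_in_compact_finite) (auto intro: sparse_in_subset)
  thus ?thesis
    by (rule rev_finite_subset) (use assms in \<open>auto simp: mord_eq_0_iff\<close>)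
qed

section \<open>Circle means and Jensen's formula\<close>

text \<open>\<open>integral\<close> is 0 on non-integrable functions, so additivity and monotonicity
  below are stated for integrands continuous on the circle.\<close>

definition circ_mean :: "(complex \<Rightarrow> real) \<Rightarrow> real \<Rightarrow> real" where
  "circ_mean g r = integral {0..2 * pi} (\<lambda>\<theta>. g (of_real r * cis \<theta>)) / (2 * pi)"

lemma circ_mean_integrable:
  fixes g :: "complex \<Rightarrow> real"
  assumes "continuous_on (sphere 0 r) g" "r \<ge> 0"
  shows "(\<lambda>\<theta>. g (of_real r * cis \<theta>)) integrable_on {0..2 * pi}"
proof (rule integrable_continuous_interval)
  show "continuous_on {0..2 * pi} (\<lambda>\<theta>. g (of_real r * cis \<theta>))"
    by (rule continuous_on_compose2[OF assms(1)])
       (use assms(2) in \<open>auto intro!: continuous_intros simp: norm_mult\<close>)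
qed

lemma circ_mean_cong:
  assumes "\<And>z. norm z = r \<Longrightarrow> g z = h z" "r \<ge> 0"
  shows "circ_mean g r = circ_mean h r"
  unfolding circ_mean_def using assms by (intro arg_cong2[where f = "(/)"] integral_cong) (auto simp: norm_mult)

lemma circ_mean_add:
  assumes "continuous_on (sphere 0 r) g" "continuous_on (sphere 0 r) h" "r \<ge> 0"
  shows "circ_mean (\<lambda>z. g z + h z) r = circ_mean g r + circ_mean h r"
  unfolding circ_mean_def
  by (subst integral_add) (auto intro!: circ_mean_integrable assms simp: add_divide_distrib)

lemma circ_mean_cmult: "circ_mean (\<lambda>z. c * g z) r = c * circ_mean g r"
  unfolding circ_mean_def by simp

lemma circ_mean_const [simp]: "circ_mean (\<lambda>z. c) r = c"
  unfolding circ_mean_def by simp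

lemma circ_mean_sum:
  assumes "finite A" "\<And>i. i \<in> A \<Longrightarrow> continuous_on (sphere 0 r) (G i)" "r \<ge> 0"
  shows "circ_mean (\<lambda>z. \<Sum>i\<in>A. G i z) r = (\<Sum>i\<in>A. circ_mean (G i) r)"
  unfolding circ_mean_def
  by (subst integral_sum) (auto intro!: circ_mean_integrable assms simp: sum_divide_distrib)

lemma circ_mean_mono:
  assumes "continuous_on (sphere 0 r) g" "continuous_on (sphere 0 r) h" "r \<ge> 0"
    and "\<And>z. norm z = r \<Longrightarrow> g z \<le> h z"
  shows "circ_mean g r \<le> circ_mean h r"
  unfolding circ_mean_def
  by (intro divide_right_mono integral_le circ_mean_integrable assms) (use assms in \<open>auto simp: norm_mult\<close>)

lemma circ_mean_nonneg:
  assumes "\<And>z. g z \<ge> 0"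
  shows "circ_mean g r \<ge> 0"
proof -
  have "integral {0..2 * pi} (\<lambda>\<theta>. g (of_real r * cis \<theta>)) \<ge> 0"
    using assms
    by (cases "(\<lambda>\<theta>. g (of_real r * cis \<theta>)) integrable_on {0..2 * pi}")
       (auto simp: integral_nonneg not_integrable_integral)
  thus ?thesis by (simp add: circ_mean_def)
qed

text \<open>A zero-free function on a disc has a holomorphic logarithm \<open>L\<close>, and
  \<open>ln (norm (u z))\<close> is its real part; Cauchy's integral formula at the centre gives the
  mean value.\<close>

lemma circ_mean_log_nonvanishing:
  assumes hol: "u holomorphic_on ball 0 R" and nz: "\<And>z. norm z < R \<Longrightarrow> u z \<noteq> 0"
    and r: "0 < r" "r < R"
  shows "circ_mean (\<lambda>z. ln (norm (u z))) r = ln (norm (u 0))"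
proof -
  obtain L where L: "L holomorphic_on ball 0 R" "\<And>z. z \<in> ball 0 R \<Longrightarrow> u z = exp (L z)"
    using contractible_imp_holomorphic_log[OF hol] nz
    by (metis convex_ball convex_imp_contractible dist_0_norm mem_ball)
  have lnu: "ln (norm (u z)) = Re (L z)" if "norm z < R" for z
    using L(2)[of z] that by simp
  have "((\<lambda>w. L w / (w - 0)) has_contour_integral (2 * of_real pi * \<i> * L 0)) (circlepath 0 r)"
    by (rule Cauchy_integral_circlepath_simple)
       (use r in \<open>auto intro!: holomorphic_on_subset[OF L(1)]\<close>)
  hence "((\<lambda>t. L (of_real r * cis t) / (of_real r * cis t) * of_real r * \<i> * cis t) has_integral
           2 * of_real pi * \<i> * L 0) {0..2 * pi}"
    by (simp add: circlepath_def has_contour_integral_part_circlepath_iff)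
  also have "(\<lambda>t. L (of_real r * cis t) / (of_real r * cis t) * of_real r * \<i> * cis t) =
      (\<lambda>t. \<i> * L (of_real r * cis t))"
    using r by (auto simp: field_simps)
  finally have "((\<lambda>t. -\<i> * (\<i> * L (of_real r * cis t))) has_integral -\<i> * (2 * of_real pi * \<i> * L 0)) {0..2 * pi}"
    by (rule has_integral_mult_right)
  hence "((\<lambda>t. Re (L (of_real r * cis t))) has_integral Re (2 * of_real pi * L 0)) {0..2 * pi}"
    by (intro has_integral_Re) (simp add: algebra_simps)
  hence "((\<lambda>t. ln (norm (u (of_real r * cis t)))) has_integral 2 * pi * Re (L 0)) {0..2 * pi}"
    using r by (simp add: lnu norm_mult)
  thus ?thesis
    unfolding circ_mean_def using lnu[of 0] r by (simp add: integral_unique)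
qed

text \<open>For \<open>norm a < r\<close>, reflecting \<open>a\<close> in the circle gives a
  function with the same modulus on \<open>norm z = r\<close> and without zeros in the closed disc;
  for \<open>norm a > r\<close>, already \<open>z - a\<close> is zero-free there. Only
  \<open>norm a = r\<close>, where the integrand is singular, is left out.\<close>

lemma circ_mean_log_lin:
  assumes "0 < r" "norm a \<noteq> r"
  shows "circ_mean (\<lambda>z. ln (norm (z - a))) r = ln (max r (norm a))"
proof (cases "norm a < r")
  case True
  have "norm (z - a) = norm (of_real r - cnj a * z / of_real r)" if z: "norm z = r" for z
  proof -
    have "z * cnj z = of_real (r ^ 2)"
      using z by (simp add: complex_norm_square[symmetric])
    have "of_real r - cnj a * z / of_real r = (of_real (r^2) - cnj a * z) / of_real r"
      using assms by (simp add: field_simps power2_eq_square)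
    hence "norm (of_real r - cnj a * z / of_real r) = norm (of_real (r^2) - cnj a * z) / r"
      using assms by (simp add: norm_divide)
    also have "of_real (r^2) - cnj a * z = z * cnj (z - a)"
      using \<open>z * cnj z = _\<close> by (simp add: algebra_simps)
    also have "norm (z * cnj (z - a)) = r * norm (z - a)"
      using z by (simp only: norm_mult complex_mod_cnj)
    finally show ?thesis using assms by simp
  qed
  hence "circ_mean (\<lambda>z. ln (norm (z - a))) r = circ_mean (\<lambda>z. ln (norm (of_real r - cnj a * z / of_real r))) r"
    using assms by (intro circ_mean_cong) auto
  also have "\<dots> = ln (norm (of_real r - cnj a * 0 / of_real r :: complex))"
  \<comment> \<open>\<open>r * (r / norm a)\<close> is the modulus of the reflected point, the zero
    of the new function; for \<open>a = 0\<close> that function is constant and any radius above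
    \<open>r\<close> serves.\<close>
  proof (rule circ_mean_log_nonvanishing[where R = "if a = 0 then 2 * r else r * (r / norm a)"])
    show "r < (if a = 0 then 2 * r else r * (r / norm a))"
      using True assms by (auto simp: field_simps)
    show "of_real r - cnj a * z / of_real r \<noteq> 0" if "norm z < (if a = 0 then 2 * r else r * (r / norm a))" for z
    proof
      assume "of_real r - cnj a * z / of_real r = 0"
      hence "of_real (r * r) = cnj a * z"
        using assms by (simp add: field_simps)
      hence "r * r = norm a * norm z"
        using assms by (metis abs_of_pos complex_mod_cnj mult_pos_pos norm_mult norm_of_real)
      thus False using that assms by (auto simp: field_simps split: if_splits)
    qed
  qed (use assms in \<open>auto intro!: holomorphic_intros\<close>)
  finally show ?thesis using True assms by simp
next
  case False
  have "circ_mean (\<lambda>z. ln (norm (z - a))) r = ln (norm (0 - a))"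
    by (rule circ_mean_log_nonvanishing[where R = "norm a"])
       (use False assms in \<open>auto intro!: holomorphic_intros\<close>)
  thus ?thesis using False assms by simp
qed

text \<open>On such circles \<open>ln (norm (mero_eval f z))\<close> is continuous, so circle means
  obey their rules. For \<open>f \<noteq> 0\<close> the excluded radii form a countable set and can
  be avoided when a radius is finally chosen.\<close>

definition regular_radius :: "mero \<Rightarrow> real \<Rightarrow> bool" where
  "regular_radius f r \<longleftrightarrow> (\<forall>z. norm z = r \<longrightarrow> mord f z = 0)"

lemma regular_radiusD:
  assumes "regular_radius f r" "f \<noteq> 0" "norm z = r"
  shows "\<not> mpole f z" "mero_eval f z \<noteq> 0"
  using assms by (auto simp: regular_radius_def mpole_iff simp flip: mord_eq_0_iff)

lemma regular_radius_continuous: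
  assumes "regular_radius f r" "f \<noteq> 0"
  shows "continuous_on (sphere 0 r) (mero_eval f)"
  by (intro analytic_imp_holomorphic holomorphic_on_imp_continuous_on)
     (use regular_radiusD[OF assms] mero_eval_analytic in \<open>subst analytic_on_analytic_at; auto\<close>)

lemma regular_radius_continuous_log:
  assumes "regular_radius f r" "f \<noteq> 0"
  shows "continuous_on (sphere 0 r) (\<lambda>z. ln (norm (mero_eval f z)))"
  by (intro continuous_intros regular_radius_continuous assms) (use regular_radiusD[OF assms] in auto)

text \<open>Zeros count positively and poles negatively: this is the difference of the counting
  functions of \<open>1 / f\<close> and \<open>f\<close>, with the same treatment of the origin as
  in \<open>counting_fun\<close>.\<close>

definition log_sum :: "mero \<Rightarrow> real \<Rightarrow> real" where
  "log_sum f r = (\<Sum>z | 0 < norm z \<and> norm z \<le> r \<and> mord f z \<noteq> 0. mord f z * ln (r / norm z)) + mord f 0 * ln r"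

lemma finite_zeros_poles': "f \<noteq> 0 \<Longrightarrow> finite {z. 0 < norm z \<and> norm z \<le> r \<and> mord f z \<noteq> 0}"
  by (rule finite_subset[OF _ finite_zeros_poles[of f r]]) auto

lemma ln_powi: "x > 0 \<Longrightarrow> ln (x powi n) = of_int n * ln (x :: real)"
  by (auto simp: power_int_def ln_realpow ln_inverse)

text \<open>Dividing \<open>f\<close> by its power of \<open>z\<close> and by the linear factors of
  its zeros and poles in the disc leaves a zero-free \<open>u\<close>, for which the mean of
  \<open>ln (norm u)\<close> is its value at 0; the factors contribute the other terms. The constant
  is \<open>ln\<close> of the modulus of the leading Laurent coefficient at 0, hence independent of
  \<open>r\<close>.\<close>

theorem jensen_log_sum:
  assumes "f \<noteq> 0"
  shows "\<exists>c. \<forall>r>0. regular_radius f r \<longrightarrow>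
    circ_mean (\<lambda>z. ln (norm (mero_eval f z))) r = log_sum f r + c"
proof -
  define k where "k = mord f 0"
  define p where "p = f * mero_lin 0 powi (-k)"
  have p0: "p \<noteq> 0" using assms by (simp add: p_def)
  have "mord p 0 = 0" using assms by (simp add: p_def mord_mult mord_powi mord_lin k_def)
  hence evp0: "mero_eval p 0 \<noteq> 0" using mord_eq_0_iff[OF p0] by simp
  show ?thesis
  proof (intro exI[of _ "ln (norm (mero_eval p 0))"] allI impI)
    fix r :: real assume r: "r > 0" and reg: "regular_radius f r"
    define Z where "Z = {z. 0 < norm z \<and> norm z \<le> r \<and> mord f z \<noteq> 0}"
    have Zfin: "finite Z" unfolding Z_def by (rule finite_zeros_poles'[OF assms])
    have Z: "0 < norm a" "norm a < r" "a \<noteq> 0" if "a \<in> Z" for a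
      using that reg by (force simp: Z_def regular_radius_def)+
    define q where "q = (\<Prod>a\<in>Z. mero_lin a powi mord f a)"
    have q0: "q \<noteq> 0" using Zfin by (simp add: q_def)
    have mq: "mord q z = (if z \<in> Z then mord f z else 0)" for z
    proof -
      have "mord q z = (\<Sum>a\<in>Z. mord f a * (if z = a then 1 else 0))"
        unfolding q_def using Zfin by (subst mord_prod) (auto simp: mord_powi mord_lin)
      also have "\<dots> = (\<Sum>a\<in>Z. if z = a then mord f a else 0)"
        by (intro sum.cong) auto
      finally have "mord q z = \<dots>" .
      thus ?thesis using Zfin by simp
    qed
    have evq: "mero_eval q z = (\<Prod>a\<in>Z. (z - a) powi mord f a)" "\<not> mpole q z" if "z \<notin> Z" for z
    proof -
      have "\<not> mpole (\<Prod>a\<in>A. mero_lin a powi mord f a) z \<and>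
            mero_eval (\<Prod>a\<in>A. mero_lin a powi mord f a) z = (\<Prod>a\<in>A. (z - a) powi mord f a)"
        if "finite A" "A \<subseteq> Z" for A
        using that
      proof (induction A rule: finite_induct)
        case empty
        thus ?case using mero_const_not_pole[of 1 z] by simp
      next
        case (insert a A)
        have "\<not> mpole (mero_lin a powi mord f a) z" "mero_eval (mero_lin a powi mord f a) z = (z - a) powi mord f a"
          using mero_eval_powi[of "mero_lin a" z "mord f a"] insert.prems \<open>z \<notin> Z\<close> by auto
        thus ?case using insert mero_eval_mult by simp
      qed
      from this[OF Zfin order_refl] show "mero_eval q z = (\<Prod>a\<in>Z. (z - a) powi mord f a)" "\<not> mpole q z"
        by (simp_all add: q_def)
    qed
    define u where "u = p * inverse q"
    have u0: "u \<noteq> 0" using p0 q0 by (simp add: u_def)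
    have mu: "mord u z = 0" if "norm z \<le> r" for z
    proof -
      have "mord u z = mord f z - k * (if z = 0 then 1 else 0) - (if z \<in> Z then mord f z else 0)"
        unfolding u_def p_def using assms q0 by (simp add: mord_mult mord_inverse mord_powi mord_lin mq)
      also have "\<dots> = 0" using that by (auto simp: Z_def k_def)
      finally show ?thesis .
    qed
    \<comment> \<open>The mean value lemma needs a disc strictly larger than the circle. Up to
      radius \<open>r + 1\<close> there are finitely many zeros and poles of \<open>u\<close>, none
      of them up to \<open>r\<close>.\<close>
    obtain R where R: "R > r" "\<And>z. norm z < R \<Longrightarrow> mord u z = 0"
    proof -
      define B where "B = {z. norm z \<le> r + 1 \<and> mord u z \<noteq> 0}"
      have B: "finite B" unfolding B_def by (rule finite_zeros_poles[OF u0])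
      define R where "R = Min (insert (r + 1) (norm ` B))"
      have "R > r" unfolding R_def using B mu by (subst Min_gr_iff) (force simp: B_def)+
      moreover have "mord u z = 0" if "norm z < R" for z
      proof (rule ccontr)
        assume "mord u z \<noteq> 0"
        moreover have "R \<le> r + 1" unfolding R_def using B by (intro Min_le) auto
        ultimately have "z \<in> B" using that by (auto simp: B_def)
        hence "R \<le> norm z" unfolding R_def using B by (intro Min_le) auto
        thus False using that by simp
      qed
      ultimately show ?thesis using that by blast
    qed
    have unp: "\<not> mpole u z" "mero_eval u z \<noteq> 0" if "norm z < R" for z
      using R(2)[OF that] u0 by (auto simp: mpole_iff simp flip: mord_eq_0_iff)
    have mean_u: "circ_mean (\<lambda>z. ln (norm (mero_eval u z))) r = ln (norm (mero_eval u 0))"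
    proof (rule circ_mean_log_nonvanishing[where R = R])
      show "mero_eval u holomorphic_on ball 0 R"
        using mero_eval_analytic[OF unp(1)]
        by (intro analytic_imp_holomorphic) (subst analytic_on_analytic_at, auto)
    qed (use unp r R in auto)
    have regu: "regular_radius u r" using mu by (auto simp: regular_radius_def)
    have feq: "f = u * (q * mero_lin 0 powi k)"
    proof -
      have "mero_lin 0 powi k \<noteq> 0" by simp
      thus ?thesis using q0 by (simp add: u_def p_def power_int_minus field_simps)
    qed
    have key: "ln (norm (mero_eval f z)) = ln (norm (mero_eval u z)) + ((\<Sum>a\<in>Z. mord f a * ln (norm (z - a))) + k * ln (norm (z - 0)))"
      if z: "norm z = r" for z
    proof -
      have zZ: "z \<notin> Z" using Z z by auto
      have z0: "z \<noteq> 0" using z r by auto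
      note l = mero_eval_powi[of "mero_lin 0" z k]
      have "mero_eval f z = mero_eval (u * (q * mero_lin 0 powi k)) z"
        by (rule arg_cong[OF feq])
      also have "\<dots> = mero_eval u z * ((\<Prod>a\<in>Z. (z - a) powi mord f a) * z powi k)"
        using mero_eval_mult unp(1)[of z] evq[OF zZ] l z R(1) z0 by simp
      finally have "norm (mero_eval f z) = norm (mero_eval u z) * ((\<Prod>a\<in>Z. norm (z - a) powi mord f a) * norm z powi k)"
        by (simp add: norm_mult norm_power_int prod_norm[symmetric])
      moreover have "norm (mero_eval u z) > 0" using unp(2)[of z] z R(1) by simp
      moreover have "(\<Prod>a\<in>Z. norm (z - a) powi mord f a) > 0"
        using zZ by (intro prod_pos ballI zero_less_power_int) auto
      moreover have "norm z powi k > 0" using z0 by (intro zero_less_power_int) simp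
      ultimately have "ln (norm (mero_eval f z)) = ln (norm (mero_eval u z)) + (ln (\<Prod>a\<in>Z. norm (z - a) powi mord f a) + ln (norm z powi k))"
        using z0 by (simp add: ln_mult)
      also have "ln (\<Prod>a\<in>Z. norm (z - a) powi mord f a) = (\<Sum>a\<in>Z. ln (norm (z - a) powi mord f a))"
        using zZ by (intro ln_prod Zfin) auto
      also have "\<dots> = (\<Sum>a\<in>Z. mord f a * ln (norm (z - a)))"
        using zZ by (intro sum.cong refl ln_powi) auto
      finally show ?thesis using z0 by (simp add: ln_powi)
    qed
    have cont_lin: "continuous_on (sphere 0 r) (\<lambda>z. real_of_int m * ln (norm (z - a)))" if "norm a \<noteq> r" for a m
      using that by (auto intro!: continuous_intros)
    have "circ_mean (\<lambda>z. ln (norm (mero_eval f z))) r =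
       circ_mean (\<lambda>z. ln (norm (mero_eval u z)) + ((\<Sum>a\<in>Z. mord f a * ln (norm (z - a))) + k * ln (norm (z - 0)))) r"
      by (rule circ_mean_cong) (use key r in auto)
    also have "\<dots> = ln (norm (mero_eval u 0)) + ((\<Sum>a\<in>Z. mord f a * ln r) + k * ln r)"
    proof -
      have "continuous_on (sphere 0 r) (\<lambda>z. (\<Sum>a\<in>Z. mord f a * ln (norm (z - a))))"
        using Z by (intro continuous_on_sum cont_lin) auto
      moreover have "continuous_on (sphere 0 r) (\<lambda>z :: complex. k * ln (norm (z - 0)))"
        using r by (intro cont_lin) auto
      moreover have "circ_mean (\<lambda>z. k * ln (norm (z - 0))) r = k * ln r"
        using r by (simp only: circ_mean_cmult) (subst circ_mean_log_lin, auto)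
      moreover have "circ_mean (\<lambda>z. (\<Sum>a\<in>Z. mord f a * ln (norm (z - a)))) r = (\<Sum>a\<in>Z. mord f a * ln r)"
      proof (subst circ_mean_sum[OF Zfin])
        show "\<And>a. a \<in> Z \<Longrightarrow> continuous_on (sphere 0 r) (\<lambda>z. mord f a * ln (norm (z - a)))"
          using Z by (intro cont_lin) auto
        have "circ_mean (\<lambda>z. ln (norm (z - a))) r = ln r" if "a \<in> Z" for a
          using circ_mean_log_lin[OF r, of a] Z[OF that] by simp
        thus "(\<Sum>a\<in>Z. circ_mean (\<lambda>z. mord f a * ln (norm (z - a))) r) = (\<Sum>a\<in>Z. mord f a * ln r)"
          by (intro sum.cong) (auto simp: circ_mean_cmult)
      qed (use r in auto)
      ultimately show ?thesis
        using r regular_radius_continuous_log[OF regu u0] mean_u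
        by (simp add: circ_mean_add continuous_on_add)
    qed
    \<comment> \<open>Evaluating \<open>q\<close> at 0 produces the terms \<open>ln (norm a)\<close>
      that turn \<open>ln r\<close> into \<open>ln (r / norm a)\<close>.\<close>
    also have "ln (norm (mero_eval u 0)) = ln (norm (mero_eval p 0)) - (\<Sum>a\<in>Z. mord f a * ln (norm a))"
    proof -
      have "0 \<notin> Z" using Z(3) by auto
      have "mero_eval u 0 * mero_eval q 0 = mero_eval (u * q) 0"
        using mero_eval_mult(2)[of u 0 q] unp(1)[of 0] R r evq(2)[OF \<open>0 \<notin> Z\<close>] by simp
      also have "u * q = p" using q0 by (simp add: u_def)
      finally have eq: "mero_eval p 0 = mero_eval u 0 * mero_eval q 0" ..
      have "norm (mero_eval q 0) = (\<Prod>a\<in>Z. norm a powi mord f a)"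
        by (subst evq(1)[OF \<open>0 \<notin> Z\<close>]) (simp add: prod_norm[symmetric] norm_power_int)
      hence "ln (norm (mero_eval q 0)) = (\<Sum>a\<in>Z. ln (norm a powi mord f a))"
        using Z Zfin by (simp add: ln_prod)
      also have "\<dots> = (\<Sum>a\<in>Z. mord f a * ln (norm a))"
        using Z(1) by (intro sum.cong refl ln_powi) auto
      finally show ?thesis using eq evp0 by (simp add: norm_mult ln_mult)
    qed
    also have "ln (norm (mero_eval p 0)) - (\<Sum>a\<in>Z. mord f a * ln (norm a)) + ((\<Sum>a\<in>Z. mord f a * ln r) + k * ln r)
       = log_sum f r + ln (norm (mero_eval p 0))"
    proof -
      have "(\<Sum>a\<in>Z. mord f a * ln (r / norm a)) = (\<Sum>a\<in>Z. mord f a * ln r) - (\<Sum>a\<in>Z. mord f a * ln (norm a))"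
        unfolding sum_subtractf[symmetric]
        using r Z by (intro sum.cong) (auto simp: ln_div algebra_simps)
      thus ?thesis by (simp add: log_sum_def Z_def k_def)
    qed
    finally show "circ_mean (\<lambda>z. ln (norm (mero_eval f z))) r = log_sum f r + ln (norm (mero_eval p 0))" .
  qed
qed

section \<open>Convexity of logarithmic means\<close>

text \<open>The \<open>s\<close>-derivative of \<open>ln n\<close> is \<open>2 * Re (P / N)\<close>.
  In turn \<open>Cs + \<i> * Ct\<close>, twice the antiholomorphic derivative of
  \<open>P / N\<close>, is a nonnegative expression in the Wronskian \<open>W\<close>, and the
  \<open>t\<close>-derivative \<open>Ct\<close> integrates to 0 over a period. The functions
  \<open>F1\<close>, \<open>F2\<close> will be entire functions composed with
  \<open>exp\<close>.\<close>

lemma integral_log_norm_second_derivative: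
  fixes F1 F2 D1 D2 E1 E2 :: "complex \<Rightarrow> complex"
  assumes F: "\<And>z. (F1 has_field_derivative D1 z) (at z)" "\<And>z. (F2 has_field_derivative D2 z) (at z)"
    and D: "\<And>z. (D1 has_field_derivative E1 z) (at z)" "\<And>z. (D2 has_field_derivative E2 z) (at z)"
    and E: "continuous_on UNIV E1" "continuous_on UNIV E2"
    and nz: "\<And>z. F1 z \<noteq> 0 \<or> F2 z \<noteq> 0"
    and per: "\<And>z. F1 (z + 2 * of_real pi * \<i>) = F1 z" "\<And>z. F2 (z + 2 * of_real pi * \<i>) = F2 z"
             "\<And>z. D1 (z + 2 * of_real pi * \<i>) = D1 z" "\<And>z. D2 (z + 2 * of_real pi * \<i>) = D2 z"
  defines "J \<equiv> \<lambda>s. integral {0..2*pi} (\<lambda>t. ln (norm (F1 (Complex s t)) ^ 2 + norm (F2 (Complex s t)) ^ 2))"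
    and "J2 \<equiv> \<lambda>s. integral {0..2*pi} (\<lambda>t. 4 * norm (D1 (Complex s t) * F2 (Complex s t) - F1 (Complex s t) * D2 (Complex s t)) ^ 2
                 / (norm (F1 (Complex s t)) ^ 2 + norm (F2 (Complex s t)) ^ 2) ^ 2)"
  shows "\<exists>J1. (\<forall>s. (J has_real_derivative J1 s) (at s)) \<and> (\<forall>s. (J1 has_real_derivative J2 s) (at s))
           \<and> continuous_on UNIV J2"
proof -
  define N where "N = (\<lambda>z. F1 z * cnj (F1 z) + F2 z * cnj (F2 z))"
  define P where "P = (\<lambda>z. D1 z * cnj (F1 z) + D2 z * cnj (F2 z))"
  define Q where "Q = (\<lambda>z. E1 z * cnj (F1 z) + E2 z * cnj (F2 z))"
  define M where "M = (\<lambda>z. D1 z * cnj (D1 z) + D2 z * cnj (D2 z))"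
  \<comment> \<open>Candidates for the partial derivatives of \<open>P / N\<close> in
    \<open>s\<close> and in \<open>t\<close>.\<close>
  define Cs where "Cs = (\<lambda>z. (Q z + M z) / N z - P z * (P z + cnj (P z)) / N z ^ 2)"
  define Ct where "Ct = (\<lambda>z. \<i> * (Q z - M z) / N z - P z * (\<i> * (P z - cnj (P z))) / N z ^ 2)"
  define n where "n = (\<lambda>z. norm (F1 z) ^ 2 + norm (F2 z) ^ 2)"
  define W where "W = (\<lambda>z. D1 z * F2 z - F1 z * D2 z)"
  have n_pos: "n z > 0" for z
    using nz[of z] by (auto simp: n_def intro: add_pos_nonneg add_nonneg_pos)
  have N_n: "N z = of_real (n z)" for z
    by (simp add: N_def n_def complex_norm_square[symmetric])
  have N_nz: "N z \<noteq> 0" for z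
    using n_pos[of z] by (simp add: N_n)
  have cont: "continuous_on UNIV F1" "continuous_on UNIV F2" "continuous_on UNIV D1" "continuous_on UNIV D2"
    using F D by (meson DERIV_continuous_on has_field_derivative_at_within)+
  note [continuous_intros] = cont[THEN continuous_on_compose2, OF _ subset_UNIV] E[THEN continuous_on_compose2, OF _ subset_UNIV]
  have cCs: "continuous_on A (\<lambda>x. Cs (g x))" and cP: "continuous_on A (\<lambda>x. P (g x) / N (g x))"
    and cN: "continuous_on A (\<lambda>x. n (g x))" and cW: "continuous_on A (\<lambda>x. W (g x))"
    if "continuous_on A g" for A and g :: "'b :: topological_space \<Rightarrow> complex"
    unfolding Cs_def P_def Q_def M_def n_def W_def using N_nz that
    by (auto simp: N_def intro!: continuous_intros)
  have chain_s: "((\<lambda>s. H (Complex s t)) has_vector_derivative H') (at s)"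
    if "(H has_field_derivative H') (at (Complex s t))" for H H' s t
  proof -
    have "((\<lambda>s. of_real s + \<i> * of_real t) has_vector_derivative 1) (at s)"
      by (auto intro!: derivative_eq_intros)
    moreover have "(H has_field_derivative H') (at (of_real s + \<i> * of_real t))"
      using that by (simp add: Complex_eq)
    ultimately show ?thesis
      using field_vector_diff_chain_at by (fastforce simp: o_def Complex_eq)
  qed
  have chain_t: "((\<lambda>t. H (Complex s t)) has_vector_derivative \<i> * H') (at t)"
    if "(H has_field_derivative H') (at (Complex s t))" for H H' s t
  proof -
    have "((\<lambda>t. of_real s + \<i> * of_real t) has_vector_derivative \<i>) (at t)"
      by (auto intro!: derivative_eq_intros)
    moreover have "(H has_field_derivative H') (at (of_real s + \<i> * of_real t))"
      using that by (simp add: Complex_eq)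
    ultimately show ?thesis
      using field_vector_diff_chain_at by (fastforce simp: o_def Complex_eq)
  qed
  have div: "((\<lambda>x. f x / g x) has_vector_derivative (f' / g x - f x * g' / g x ^ 2)) (at x)"
    if "(f has_vector_derivative f') (at x)" "(g has_vector_derivative g') (at x)" "g x \<noteq> 0"
    for f g :: "real \<Rightarrow> complex" and f' g' x
  proof -
    have "(inverse has_field_derivative - (inverse (g x) ^ 2)) (at (g x))"
      using that DERIV_inverse[of "g x"] by (simp add: numeral_2_eq_2)
    hence "(inverse \<circ> g has_vector_derivative g' * - (inverse (g x) ^ 2)) (at x)"
      by (rule field_vector_diff_chain_at[OF that(2)])
    hence "((\<lambda>x. f x * inverse (g x)) has_vector_derivative f x * (g' * - (inverse (g x) ^ 2)) + f' * inverse (g x)) (at x)"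
      using that by (intro has_vector_derivative_mult) (auto simp: o_def)
    thus ?thesis using that by (simp add: field_simps)
  qed
  note fd_s = chain_s[OF F(1)] chain_s[OF F(2)] chain_s[OF D(1)] chain_s[OF D(2)]
  note fd_t = chain_t[OF F(1)] chain_t[OF F(2)] chain_t[OF D(1)] chain_t[OF D(2)]
  have Ns: "((\<lambda>s. N (Complex s t)) has_vector_derivative (P (Complex s t) + cnj (P (Complex s t)))) (at s)" for s t
    unfolding N_def P_def
    by (rule has_vector_derivative_eq_rhs, (rule has_vector_derivative_add has_vector_derivative_mult
        has_vector_derivative_cnj fd_s)+) (simp add: algebra_simps)
  have Ps: "((\<lambda>s. P (Complex s t)) has_vector_derivative (Q (Complex s t) + M (Complex s t))) (at s)" for s t
    unfolding M_def P_def Q_def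
    by (rule has_vector_derivative_eq_rhs, (rule has_vector_derivative_add has_vector_derivative_mult
        has_vector_derivative_cnj fd_s)+) (simp add: algebra_simps)
  have Nt: "((\<lambda>t. N (Complex s t)) has_vector_derivative \<i> * (P (Complex s t) - cnj (P (Complex s t)))) (at t)" for s t
    unfolding N_def P_def
    by (rule has_vector_derivative_eq_rhs, (rule has_vector_derivative_add has_vector_derivative_mult
        has_vector_derivative_cnj fd_t)+) (simp add: algebra_simps)
  have Pt: "((\<lambda>t. P (Complex s t)) has_vector_derivative \<i> * (Q (Complex s t) - M (Complex s t))) (at t)" for s t
    unfolding M_def P_def Q_def
    by (rule has_vector_derivative_eq_rhs, (rule has_vector_derivative_add has_vector_derivative_mult
        has_vector_derivative_cnj fd_t)+) (simp add: algebra_simps)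
  have C_s: "((\<lambda>s. P (Complex s t) / N (Complex s t)) has_vector_derivative Cs (Complex s t)) (at s)" for s t
    unfolding Cs_def by (rule div[OF Ps Ns N_nz])
  have C_t: "((\<lambda>t. P (Complex s t) / N (Complex s t)) has_vector_derivative Ct (Complex s t)) (at t)" for s t
    unfolding Ct_def by (rule div[OF Pt Nt N_nz])
  have n_s: "((\<lambda>s. n (Complex s t)) has_vector_derivative 2 * Re (P (Complex s t))) (at s)" for s t
    using bounded_linear.has_vector_derivative[OF bounded_linear_Re, OF Ns[of t s]] by (simp add: N_n)
  have L_s: "((\<lambda>s. ln (n (Complex s t))) has_vector_derivative 2 * Re (P (Complex s t) / N (Complex s t))) (at s)" for s t
  proof -
    have "((\<lambda>s. ln (n (Complex s t))) has_real_derivative (1 / n (Complex s t) * (2 * Re (P (Complex s t))))) (at s)"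
      using n_s[of t s] n_pos
      by (intro DERIV_ln_divide[THEN DERIV_chain2]) (auto simp: has_real_derivative_iff_has_vector_derivative)
    thus ?thesis
      by (simp add: has_real_derivative_iff_has_vector_derivative N_n)
  qed
  \<comment> \<open>Lagrange's identity for the vectors \<open>(F1, F2)\<close> and
    \<open>(D1, D2)\<close>; it exhibits the second derivative as a mean of squares.\<close>
  have lagrange: "Cs z + \<i> * Ct z = of_real (2 * norm (W z) ^ 2 / n z ^ 2)" for z
  proof -
    have "Cs z + \<i> * Ct z = 2 * (M z * N z - P z * cnj (P z)) / N z ^ 2"
      using N_nz[of z] by (simp add: Cs_def Ct_def field_simps power2_eq_square)
    also have "M z * N z - P z * cnj (P z) = W z * cnj (W z)"
      by (simp add: M_def N_def P_def W_def algebra_simps)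
    also have "W z * cnj (W z) = of_real (norm (W z) ^ 2)"
      by (rule complex_norm_square[symmetric])
    finally show ?thesis by (simp add: N_n)
  qed
  \<comment> \<open>\<open>Ct\<close> is the \<open>t\<close>-derivative of a function of period
    \<open>2 * pi\<close>.\<close>
  have intCt: "integral {0..2*pi} (\<lambda>t. Ct (Complex s t)) = 0" "(\<lambda>t. Ct (Complex s t)) integrable_on {0..2*pi}" for s
  proof -
    have "((\<lambda>t. Ct (Complex s t)) has_integral (P (Complex s (2*pi)) / N (Complex s (2*pi)) - P (Complex s 0) / N (Complex s 0))) {0..2*pi}"
      using C_t by (intro fundamental_theorem_of_calculus) (auto intro: has_vector_derivative_at_within)
    moreover have "Complex s (2*pi) = Complex s 0 + 2 * of_real pi * \<i>"
      by (simp add: complex_eq_iff)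
    ultimately have "((\<lambda>t. Ct (Complex s t)) has_integral 0) {0..2*pi}"
      by (simp add: P_def N_def per)
    thus "integral {0..2*pi} (\<lambda>t. Ct (Complex s t)) = 0" "(\<lambda>t. Ct (Complex s t)) integrable_on {0..2*pi}"
      by (auto simp: integral_unique has_integral_integrable)
  qed
  have cCplx: "continuous_on A (\<lambda>x. Complex (fst x) (snd x))" for A :: "(real \<times> real) set"
    by (auto simp: Complex_eq intro!: continuous_intros)
  have cCplx': "continuous_on A (\<lambda>t. Complex s t)" for A s
    by (auto simp: Complex_eq intro!: continuous_intros)
  define J1 where "J1 = (\<lambda>s. integral (cbox 0 (2*pi)) (\<lambda>t. 2 * Re (P (Complex s t) / N (Complex s t))))"
  have J_eq: "J = (\<lambda>s. integral (cbox 0 (2*pi)) (\<lambda>t. ln (n (Complex s t))))"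
    by (simp add: J_def n_def)
  have "(J has_real_derivative J1 s) (at s)" for s
    unfolding has_real_derivative_iff_has_vector_derivative J_eq J1_def
    using L_s n_pos
    by (intro leibniz_rule_vector_derivative[where U = UNIV])
       (auto simp: case_prod_unfold less_imp_neq[symmetric] intro!: continuous_intros cP cN cCplx cCplx' integrable_continuous_real)
  moreover have "(J1 has_real_derivative J2 s) (at s)" for s
  proof -
    have "(J1 has_vector_derivative integral (cbox 0 (2*pi)) (\<lambda>t. 2 * Re (Cs (Complex s t)))) (at s)"
      unfolding J1_def
    proof (intro leibniz_rule_vector_derivative[where U = UNIV])
      show "((\<lambda>s. 2 * Re (P (Complex s t) / N (Complex s t))) has_vector_derivative 2 * Re (Cs (Complex s t))) (at s)" for s t
        using bounded_linear.has_vector_derivative[OF bounded_linear_Re, OF C_s[of t s]] by (intro has_vector_derivative_mult_right)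
    qed (auto simp: case_prod_unfold intro!: continuous_intros cP cCs cCplx cCplx' integrable_continuous_real)
    also have "integral (cbox 0 (2*pi)) (\<lambda>t. 2 * Re (Cs (Complex s t))) = J2 s"
    proof -
      have "((\<lambda>t. Ct (Complex s t)) has_integral 0) {0..2*pi}"
        using intCt[of s] by (metis has_integral_integral)
      hence "((\<lambda>t. 2 * Re (\<i> * Ct (Complex s t))) has_integral 2 * Re (\<i> * 0)) {0..2*pi}"
        by (intro has_integral_mult_right has_integral_Re)
      hence h0: "((\<lambda>t. 2 * Re (\<i> * Ct (Complex s t))) has_integral 0) {0..2*pi}"
        by simp
      have "2 * Re (Cs z) = 4 * norm (W z) ^ 2 / n z ^ 2 - 2 * Re (\<i> * Ct z)" for z
      proof -
        have "Re (Cs z) = Re (of_real (2 * norm (W z) ^ 2 / n z ^ 2)) - Re (\<i> * Ct z)"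
          by (simp only: lagrange[symmetric] plus_complex.sel)
        thus ?thesis by simp
      qed
      hence "integral {0..2*pi} (\<lambda>t. 2 * Re (Cs (Complex s t))) =
         integral {0..2*pi} (\<lambda>t. 4 * norm (W (Complex s t)) ^ 2 / n (Complex s t) ^ 2 - 2 * Re (\<i> * Ct (Complex s t)))"
        by simp
      also have "\<dots> = integral {0..2*pi} (\<lambda>t. 4 * norm (W (Complex s t)) ^ 2 / n (Complex s t) ^ 2) - integral {0..2*pi} (\<lambda>t. 2 * Re (\<i> * Ct (Complex s t)))"
        using h0 n_pos
        by (intro integral_diff has_integral_integrable[OF h0])
           (auto simp: less_imp_neq[symmetric] intro!: integrable_continuous_real continuous_intros cW cN cCplx')
      also have "integral {0..2*pi} (\<lambda>t. 2 * Re (\<i> * Ct (Complex s t))) = 0"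
        by (rule integral_unique[OF h0])
      finally show ?thesis by (simp add: J2_def W_def n_def)
    qed
    finally show ?thesis by (simp add: has_real_derivative_iff_has_vector_derivative)
  qed
  moreover have "continuous_on UNIV J2"
  proof -
    have "continuous_on UNIV (\<lambda>s. integral (cbox 0 (2*pi)) (\<lambda>t. 4 * norm (W (Complex s t)) ^ 2 / n (Complex s t) ^ 2))"
      using n_pos
      by (intro integral_continuous_on_param)
         (auto simp: case_prod_unfold less_imp_neq[symmetric] intro!: continuous_intros cW cN cCplx)
    thus ?thesis by (simp add: J2_def W_def n_def)
  qed
  ultimately show ?thesis by blast
qed

section \<open>Convexity in the logarithmic radius\<close>

definition log_norm_mean :: "(complex \<Rightarrow> complex) \<Rightarrow> (complex \<Rightarrow> complex) \<Rightarrow> real \<Rightarrow> real" where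
  "log_norm_mean g h s = circ_mean (\<lambda>z. ln (norm (g z) ^ 2 + norm (h z) ^ 2)) (exp s)"

text \<open>This is the second derivative of \<open>log_norm_mean g h\<close> in
  \<open>s = ln r\<close>; the numerator contains the Wronskian of \<open>g\<close> and
  \<open>h\<close>, and the factor \<open>norm z\<close> comes from differentiating along
  \<open>exp\<close>.\<close>

definition curvature_mean :: "(complex \<Rightarrow> complex) \<Rightarrow> (complex \<Rightarrow> complex) \<Rightarrow> real \<Rightarrow> real" where
  "curvature_mean g h s = circ_mean (\<lambda>z. 4 * (norm z * norm (deriv g z * h z - g z * deriv h z) /
     (norm (g z) ^ 2 + norm (h z) ^ 2)) ^ 2) (exp s)"

lemma exp_Complex: "exp (Complex s t) = of_real (exp s) * cis t"
  by (simp add: exp_eq_polar)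

lemma curvature_mean_nonneg: "curvature_mean g h s \<ge> 0"
  unfolding curvature_mean_def by (rule circ_mean_nonneg) simp

text \<open>Both derivatives come from the preceding calculation applied to \<open>g\<close> and
  \<open>h\<close> composed with \<open>exp\<close>. The first is nonnegative since the mean is
  convex in \<open>s\<close> and stays bounded above as \<open>s\<close> tends to minus
  infinity.\<close>

lemma log_norm_mean_convex:
  assumes g: "g holomorphic_on UNIV" and h: "h holomorphic_on UNIV"
    and nz: "\<And>z. g z \<noteq> 0 \<or> h z \<noteq> 0"
  shows "\<exists>J1. (\<forall>s. (log_norm_mean g h has_real_derivative J1 s) (at s)) \<and>
              (\<forall>s. (J1 has_real_derivative curvature_mean g h s) (at s)) \<and>
              continuous_on UNIV (curvature_mean g h) \<and> (\<forall>s. J1 s \<ge> 0)"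
proof -
  define D where "D = (\<lambda>G :: complex \<Rightarrow> complex. \<lambda>w. deriv G (exp w) * exp w)"
  define E where "E = (\<lambda>G :: complex \<Rightarrow> complex. \<lambda>w. deriv (deriv G) (exp w) * exp w * exp w + deriv G (exp w) * exp w)"
  have hd: "((\<lambda>w. G (exp w)) has_field_derivative D G w) (at w)" if "G holomorphic_on UNIV" for G w
    unfolding D_def using holomorphic_derivI[OF that, of "exp w"]
    by (intro DERIV_chain2) auto
  have hD: "(D G has_field_derivative E G w) (at w)" if "G holomorphic_on UNIV" for G w
  proof -
    have "((\<lambda>w. deriv G (exp w)) has_field_derivative D (deriv G) w) (at w)"
      using that by (intro hd holomorphic_deriv) auto
    thus ?thesis unfolding D_def E_def
      by (auto intro!: derivative_eq_intros)
  qed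
  have cE: "continuous_on UNIV (E G)" if "G holomorphic_on UNIV" for G
  proof -
    have "deriv G holomorphic_on UNIV" "deriv (deriv G) holomorphic_on UNIV"
      using that by (intro holomorphic_deriv; simp)+
    note holomorphic_on_compose[OF _ holomorphic_on_subset[OF this(1) subset_UNIV], unfolded o_def, of exp]
         holomorphic_on_compose[OF _ holomorphic_on_subset[OF this(2) subset_UNIV], unfolded o_def, of exp]
    hence "E G holomorphic_on UNIV" unfolding E_def
      by (auto intro!: holomorphic_intros)
    thus ?thesis by (rule holomorphic_on_imp_continuous_on)
  qed
  have per: "exp (z + 2 * of_real pi * \<i>) = exp z" for z :: complex
    by (simp add: exp_add)
  obtain J1 where J1: "\<And>s. ((\<lambda>s. integral {0..2*pi} (\<lambda>t. ln (norm (g (exp (Complex s t))) ^ 2 + norm (h (exp (Complex s t))) ^ 2))) has_real_derivative J1 s) (at s)"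
     "\<And>s. (J1 has_real_derivative integral {0..2*pi} (\<lambda>t. 4 * norm (D g (Complex s t) * h (exp (Complex s t)) - g (exp (Complex s t)) * D h (Complex s t)) ^ 2
                 / (norm (g (exp (Complex s t))) ^ 2 + norm (h (exp (Complex s t))) ^ 2) ^ 2)) (at s)"
     "continuous_on UNIV (\<lambda>s. integral {0..2*pi} (\<lambda>t. 4 * norm (D g (Complex s t) * h (exp (Complex s t)) - g (exp (Complex s t)) * D h (Complex s t)) ^ 2
                 / (norm (g (exp (Complex s t))) ^ 2 + norm (h (exp (Complex s t))) ^ 2) ^ 2))"
    using integral_log_norm_second_derivative[of "\<lambda>w. g (exp w)" "D g" "\<lambda>w. h (exp w)" "D h" "E g" "E h"]
      hd[OF g] hd[OF h] hD[OF g] hD[OF h] cE[OF g] cE[OF h] nz per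
    by (auto simp: D_def)
  have J_eq: "log_norm_mean g h = (\<lambda>s. integral {0..2*pi} (\<lambda>t. ln (norm (g (exp (Complex s t))) ^ 2 + norm (h (exp (Complex s t))) ^ 2)) / (2 * pi))"
    by (simp add: log_norm_mean_def circ_mean_def exp_Complex fun_eq_iff)
  have J2_eq: "curvature_mean g h = (\<lambda>s. integral {0..2*pi} (\<lambda>t. 4 * norm (D g (Complex s t) * h (exp (Complex s t)) - g (exp (Complex s t)) * D h (Complex s t)) ^ 2
                 / (norm (g (exp (Complex s t))) ^ 2 + norm (h (exp (Complex s t))) ^ 2) ^ 2) / (2 * pi))"
  proof
    fix s
    have "4 * norm (D g (Complex s t) * h (exp (Complex s t)) - g (exp (Complex s t)) * D h (Complex s t)) ^ 2
                 / (norm (g (exp (Complex s t))) ^ 2 + norm (h (exp (Complex s t))) ^ 2) ^ 2 =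
        (\<lambda>z. 4 * (norm z * norm (deriv g z * h z - g z * deriv h z) /
     (norm (g z) ^ 2 + norm (h z) ^ 2)) ^ 2) (exp (Complex s t))" for t
    proof -
      have "D g (Complex s t) * h (exp (Complex s t)) - g (exp (Complex s t)) * D h (Complex s t) =
         exp (Complex s t) * (deriv g (exp (Complex s t)) * h (exp (Complex s t)) - g (exp (Complex s t)) * deriv h (exp (Complex s t)))"
        by (simp add: D_def algebra_simps)
      thus ?thesis by (simp only: norm_mult power_divide power_mult_distrib times_divide_eq_right)
    qed
    thus "curvature_mean g h s = integral {0..2*pi} (\<lambda>t. 4 * norm (D g (Complex s t) * h (exp (Complex s t)) - g (exp (Complex s t)) * D h (Complex s t)) ^ 2
                 / (norm (g (exp (Complex s t))) ^ 2 + norm (h (exp (Complex s t))) ^ 2) ^ 2) / (2 * pi)"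
      by (simp add: curvature_mean_def circ_mean_def exp_Complex)
  qed
  have d1: "(log_norm_mean g h has_real_derivative J1 s / (2 * pi)) (at s)" for s
    unfolding J_eq by (intro DERIV_cdivide J1)
  have d2: "((\<lambda>s. J1 s / (2 * pi)) has_real_derivative curvature_mean g h s) (at s)" for s
    unfolding J2_eq by (intro DERIV_cdivide J1)
  have c2: "continuous_on UNIV (curvature_mean g h)"
    unfolding J2_eq by (intro continuous_intros J1) auto
  have mono: "J1 s / (2 * pi) \<le> J1 t / (2 * pi)" if "s \<le> t" for s t
    using d2 curvature_mean_nonneg that by (intro DERIV_nonneg_imp_nondecreasing[OF that]) blast
  have bdd: "\<exists>K. \<forall>s\<le>0. log_norm_mean g h s \<le> K"
  proof -
    have cont: "continuous_on (cball 0 1) (\<lambda>z. ln (norm (g z) ^ 2 + norm (h z) ^ 2))"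
      using nz g h
      by (intro continuous_intros holomorphic_on_imp_continuous_on holomorphic_on_subset[OF g] holomorphic_on_subset[OF h])
         (auto simp: add_nonneg_eq_0_iff)
    obtain K where K: "\<And>z. z \<in> cball 0 1 \<Longrightarrow> ln (norm (g z) ^ 2 + norm (h z) ^ 2) \<le> K"
      using continuous_attains_sup[OF compact_cball _ cont] by (metis cball_eq_empty not_one_less_zero)
    have "log_norm_mean g h s \<le> K" if "s \<le> 0" for s
    proof -
      have "log_norm_mean g h s \<le> circ_mean (\<lambda>_. K) (exp s)"
        unfolding log_norm_mean_def using that
        by (intro circ_mean_mono continuous_on_subset[OF cont] K) auto
      thus ?thesis by simp
    qed
    thus ?thesis by blast
  qed
  have "J1 s / (2 * pi) \<ge> 0" for s
  proof (rule ccontr)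
    assume neg: "\<not> J1 s / (2 * pi) \<ge> 0"
    define d where "d = - (J1 s / (2 * pi))"
    have d: "d > 0" using neg by (simp add: d_def)
    obtain K where K: "\<And>s. s \<le> 0 \<Longrightarrow> log_norm_mean g h s \<le> K" using bdd by blast
    \<comment> \<open>So far to the left that the slope, at most \<open>- d\<close> between
      \<open>t\<close> and \<open>s\<close>, makes the mean at \<open>t\<close> at least
      \<open>K + 1\<close>.\<close>
    define t where "t = min (min 0 s) (s - (K + 1 - log_norm_mean g h s) / d)"
    have t: "t \<le> 0" "t \<le> s" "t \<le> s - (K + 1 - log_norm_mean g h s) / d" by (auto simp: t_def)
    have "log_norm_mean g h s + d * s \<le> log_norm_mean g h t + d * t"
    proof (rule DERIV_nonpos_imp_nonincreasing[OF t(2)])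
      fix x assume "t \<le> x" "x \<le> s"
      have "((\<lambda>x. log_norm_mean g h x + d * x) has_real_derivative J1 x / (2 * pi) + d) (at x)"
        by (auto intro!: derivative_eq_intros d1)
      moreover have "J1 x / (2 * pi) + d \<le> 0"
        using mono[OF \<open>x \<le> s\<close>] by (simp add: d_def)
      ultimately show "\<exists>y. ((\<lambda>x. log_norm_mean g h x + d * x) has_real_derivative y) (at x) \<and> y \<le> 0"
        by blast
    qed
    moreover have "d * t \<le> d * s - (K + 1 - log_norm_mean g h s)"
    proof -
      have "d * t \<le> d * (s - (K + 1 - log_norm_mean g h s) / d)"
        using d t(3) by (intro mult_left_mono) auto
      also have "\<dots> = d * s - (K + 1 - log_norm_mean g h s)"
        using d by (subst right_diff_distrib) simp
      finally show ?thesis .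
    qed
    ultimately show False using K[OF t(1)] by simp
  qed
  thus ?thesis using d1 d2 c2 by (intro exI[of _ "\<lambda>s. J1 s / (2 * pi)"]) auto
qed

text \<open>On the exceptional set \<open>h' / (B * h ^ 2)\<close> exceeds 1, and its integral
  telescopes to at most \<open>1 / (B * h a) \<le> 1 / B\<close>. The explicit dependence on
  \<open>B\<close> is what later allows countably many applications at once.\<close>

lemma borel_growth:
  fixes h h' :: "real \<Rightarrow> real"
  assumes der: "\<And>s. (h has_real_derivative h' s) (at s)"
    and cont: "continuous_on UNIV h'" and nonneg: "\<And>s. h' s \<ge> 0"
    and ge1: "\<And>s. s \<ge> a \<Longrightarrow> h s \<ge> 1" and B: "B > 0"
  shows "{s. s \<ge> a \<and> h' s > B * h s ^ 2} \<in> sets lborel"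
    and "emeasure lborel {s. s \<ge> a \<and> h' s > B * h s ^ 2} \<le> ennreal (1 / B)"
proof -
  define A where "A = {s. s \<ge> a \<and> h' s > B * h s ^ 2}"
  have conth: "continuous_on UNIV h"
    using der by (meson DERIV_continuous_on has_field_derivative_at_within)
  have [measurable]: "h \<in> borel_measurable borel" "h' \<in> borel_measurable borel"
    using conth cont by (auto intro: borel_measurable_continuous_onI)
  have meas: "A \<in> sets lborel" unfolding A_def by measurable
  thus "{s. s \<ge> a \<and> h' s > B * h s ^ 2} \<in> sets lborel" by (simp add: A_def)
  have fin: "emeasure lborel (A \<inter> {a..a + real n}) \<le> ennreal (1 / B)" for n
  proof -
    define F where "F = (\<lambda>s. - 1 / (B * h s))"
    define F' where "F' = (\<lambda>s. h' s / (B * h s ^ 2))"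
    have "emeasure lborel (A \<inter> {a..a + real n}) = (\<integral>\<^sup>+ x. indicator (A \<inter> {a..a + real n}) x \<partial>lborel)"
      using meas by simp
    also have "\<dots> \<le> (\<integral>\<^sup>+ x. ennreal (F' x) * indicator {a..a + real n} x \<partial>lborel)"
    proof (rule nn_integral_mono)
      fix x
      show "indicator (A \<inter> {a..a + real n}) x \<le> ennreal (F' x) * indicator {a..a + real n} x"
      proof (cases "x \<in> A \<inter> {a..a + real n}")
        case True
        hence "B * h x ^ 2 > 0" "h' x > B * h x ^ 2" using ge1[of x] B by (auto simp: A_def intro!: mult_pos_pos)
        hence "F' x \<ge> 1" by (simp add: F'_def)
        thus ?thesis using True by (simp add: indicator_def)
      qed (auto simp: indicator_def)
    qed
    also have "\<dots> = ennreal (F (a + real n) - F a)"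
    proof (rule nn_integral_FTC_Icc)
      show "F' \<in> borel_measurable borel" unfolding F'_def by measurable
      show "(F has_real_derivative F' x) (at x)" if "x \<in> {a..a + real n}" for x
        unfolding F_def F'_def using ge1[of x] that B
        by (auto intro!: derivative_eq_intros der simp: power2_eq_square field_simps)
      show "F' x \<ge> 0" if "x \<in> {a..a + real n}" for x
        using nonneg B by (simp add: F'_def)
    qed auto
    also have "F (a + real n) - F a \<le> 1 / B"
    proof -
      have "1 / (B * h (a + real n)) \<ge> 0" using ge1[of "a + real n"] B by simp
      moreover have "1 / (B * h a) \<le> 1 / B"
        using ge1[of a] B by (intro divide_left_mono) auto
      moreover have "F (a + real n) - F a = 1 / (B * h a) - 1 / (B * h (a + real n))" by (simp add: F_def)
      ultimately show ?thesis by linarith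
    qed
    finally show ?thesis by (simp add: ennreal_leI)
  qed
  have "A = (\<Union>n. A \<inter> {a..a + real n})"
  proof (intro equalityI subsetI)
    fix x assume x: "x \<in> A"
    obtain n where "x - a \<le> real n" using real_arch_simple by blast
    hence "x \<le> a + real n" by simp
    thus "x \<in> (\<Union>n. A \<inter> {a..a + real n})" using x by (auto simp: A_def)
  qed auto
  also have "emeasure lborel (\<Union>n. A \<inter> {a..a + real n}) = (SUP n. emeasure lborel (A \<inter> {a..a + real n}))"
    using meas by (intro SUP_emeasure_incseq[symmetric]) (auto simp: incseq_def)
  also have "\<dots> \<le> ennreal (1 / B)" by (intro SUP_least fin)
  finally show "emeasure lborel {s. s \<ge> a \<and> h' s > B * h s ^ 2} \<le> ennreal (1 / B)"
    by (simp add: A_def)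
qed

text \<open>Two applications of the growth lemma, to \<open>J\<close> and to \<open>1 + J1\<close>,
  are chained: \<open>J2 \<le> B * (1 + J1) ^ 2 \<le> B * (2 * B * J ^ 2) ^ 2\<close>.\<close>

lemma borel_growth_second_derivative:
  fixes J J1 J2 :: "real \<Rightarrow> real"
  assumes d1: "\<And>s. (J has_real_derivative J1 s) (at s)" and d2: "\<And>s. (J1 has_real_derivative J2 s) (at s)"
    and cont: "continuous_on UNIV J2" and nn: "\<And>s. J1 s \<ge> 0" "\<And>s. J2 s \<ge> 0"
    and ge1: "\<And>s. s \<ge> a \<Longrightarrow> J s \<ge> 1" and B: "B \<ge> 1"
  shows "\<exists>E\<in>sets lborel. emeasure lborel E \<le> ennreal (2 / B) \<and>
           (\<forall>s\<ge>a. s \<notin> E \<longrightarrow> J2 s \<le> 4 * B ^ 3 * J s ^ 4)"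
proof -
  define E1 where "E1 = {s. s \<ge> a \<and> J1 s > B * J s ^ 2}"
  \<comment> \<open>For \<open>J1\<close> only nonnegativity is given, and the growth lemma asks for
    a function at least 1; hence the summand 1.\<close>
  define E2 where "E2 = {s. s \<ge> a \<and> J2 s > B * (1 + J1 s) ^ 2}"
  have cont1: "continuous_on UNIV J1"
    using d2 by (meson DERIV_continuous_on has_field_derivative_at_within)
  have E1: "E1 \<in> sets lborel" "emeasure lborel E1 \<le> ennreal (1 / B)"
    unfolding E1_def using B by (intro borel_growth[OF d1 cont1 nn(1) ge1]; simp)+
  have d2': "((\<lambda>s. 1 + J1 s) has_real_derivative J2 s) (at s)" for s
    by (auto intro!: derivative_eq_intros d2)
  have E2: "E2 \<in> sets lborel" "emeasure lborel E2 \<le> ennreal (1 / B)"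
    unfolding E2_def using B nn by (intro borel_growth[OF d2' cont nn(2)]; simp)+
  have "emeasure lborel (E1 \<union> E2) \<le> emeasure lborel E1 + emeasure lborel E2"
    using E1 E2 by (intro emeasure_subadditive) auto
  also have "\<dots> \<le> ennreal (1 / B) + ennreal (1 / B)"
    by (intro add_mono E1 E2)
  also have "\<dots> = ennreal (2 / B)" using B by (simp flip: ennreal_plus)
  finally have em: "emeasure lborel (E1 \<union> E2) \<le> ennreal (2 / B)" .
  have "J2 s \<le> 4 * B ^ 3 * J s ^ 4" if s: "s \<ge> a" "s \<notin> E1 \<union> E2" for s
  proof -
    have 1: "J1 s \<le> B * J s ^ 2" and 2: "J2 s \<le> B * (1 + J1 s) ^ 2"
      using s by (auto simp: E1_def E2_def)
    have "1 \<le> B * J s ^ 2" using B ge1[OF s(1)] by (simp add: mult_ge1_I)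
    with 1 have "(1 + J1 s) ^ 2 \<le> (2 * (B * J s ^ 2)) ^ 2"
      using nn(1)[of s] by (intro power_mono) auto
    hence "B * (1 + J1 s) ^ 2 \<le> B * (2 * (B * J s ^ 2)) ^ 2"
      using B by (intro mult_left_mono) auto
    also have "\<dots> = 4 * B ^ 3 * J s ^ 4"
      by (simp add: power_mult_distrib power2_eq_square power3_eq_cube power4_eq_xxxx)
    finally show ?thesis using 2 by simp
  qed
  thus ?thesis using em E1 E2 by (intro bexI[of _ "E1 \<union> E2"]) auto
qed

section \<open>Curvature estimates\<close>

text \<open>The Weierstrass factorization supplies the denominator \<open>f2\<close>, whose zeros
  are the poles of \<open>f\<close> with the same orders; its zero-free factor is absorbed into
  \<open>f1\<close>.\<close>

lemma mero_quotient:
  assumes "f \<noteq> 0"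
  obtains f1 f2 where "f1 holomorphic_on UNIV" "f2 holomorphic_on UNIV"
    "\<And>z. f1 z \<noteq> 0 \<or> f2 z \<noteq> 0" "\<And>z. f2 z = 0 \<longleftrightarrow> mpole f z"
    "\<And>z. mero_eval f z = f1 z / f2 z" "\<And>z. zorder f2 z = ord_minus f z"
proof -
  obtain h g1 g2 where hol: "h holomorphic_on UNIV" "g1 holomorphic_on UNIV" "g2 holomorphic_on UNIV"
    and g1: "\<forall>z. g1 z = 0 \<longleftrightarrow> \<not> mpole f z \<and> mero_eval f z = 0"
    and g2: "\<forall>z. g2 z = 0 \<longleftrightarrow> mpole f z"
    and "\<forall>z. \<not> mpole f z \<longrightarrow> zorder g1 z = mord f z"
    and zo: "\<forall>z. mpole f z \<longrightarrow> zorder g2 z = - mord f z"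
    and h: "\<forall>z. h z \<noteq> 0" and eq: "\<forall>z. mero_eval f z = h z * g1 z / g2 z"
    by (rule weierstrass_factorization_meromorphic_UNIV[OF nicely_meromorphic_mero_eval[of f]])
  have "zorder g2 z = ord_minus f z" for z
  proof (cases "mpole f z")
    case True
    thus ?thesis using zo mpole_iff[of f z] by (simp add: ord_minus_def)
  next
    case False
    hence "g2 z \<noteq> 0" using g2 by simp
    moreover have "g2 analytic_on {z}"
      using hol(3) analytic_on_open[of UNIV g2] analytic_on_subset[of g2 UNIV "{z}"] by simp
    ultimately have "zorder g2 z = 0"
      by (metis analytic_at_imp_isCont at_neq_bot continuous_at_avoid dist_commute eventually_at
          eventually_frequently zorder_eq_0_iff analytic_at_neq_imp_eventually_neq)
    thus ?thesis using False mpole_iff[of f z] assms by (simp add: ord_minus_def)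
  qed
  thus ?thesis
    using hol g1 g2 h eq by (intro that[of "\<lambda>z. h z * g1 z" g2]) (auto intro!: holomorphic_intros)
qed

section \<open>Logarithmic means of entire functions and the choice of regular radii\<close>

lemma proximity_fun_circ_mean: "proximity_fun f r = circ_mean (\<lambda>z. log_plus (norm (mero_eval f z))) r"
  by (simp add: proximity_fun_def circ_mean_def)

lemma log_plus_alt: "x \<ge> 0 \<Longrightarrow> log_plus x = ln (max 1 x)"
  by (cases "x \<ge> 1"; cases "x = 0") (auto simp: log_plus_def max_def)

lemma log_plus_nonneg [simp]: "log_plus x \<ge> 0"
  by (simp add: log_plus_def)

lemma continuous_on_log_plus [continuous_intros]:
  "continuous_on A f \<Longrightarrow> continuous_on A (\<lambda>x. log_plus (norm (f x)))"
  by (simp add: log_plus_alt) (intro continuous_intros, auto)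

lemma counting_fun_log_sum:
  assumes "g \<noteq> 0" "\<And>z. mord g z = ord_minus f z" "r > 0"
  shows "log_sum g r = counting_fun f r"
  using assms by (simp add: log_sum_def counting_fun_def norm_divide)

text \<open>Applied to the denominator of \<open>f\<close>, this identifies the mean of its
  logarithm with the counting function of the poles, up to a constant.\<close>

lemma jensen_entire:
  assumes hol: "g holomorphic_on UNIV" and nz: "g z0 \<noteq> 0" and ord: "\<And>z. zorder g z = ord_minus f z"
  shows "\<exists>c. \<forall>r>0. regular_radius f r \<longrightarrow> circ_mean (\<lambda>z. ln (norm (g z))) r = counting_fun f r + c"
proof -
  define m where "m = to_mero g"
  have ana: "g analytic_on A" for A
    using hol analytic_on_open[of UNIV g] analytic_on_subset[of g UNIV A] by simp
  have ev: "mero_eval m = g"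
    unfolding m_def by (rule ext, rule to_mero_eval_analytic) (auto intro: ana analytic_on_imp_meromorphic_on)
  have m0: "m \<noteq> 0" using nz ev by auto
  have mm: "mord m z = ord_minus f z" for z by (simp add: ev ord)
  obtain c where c: "\<forall>r>0. regular_radius m r \<longrightarrow> circ_mean (\<lambda>z. ln (norm (mero_eval m z))) r = log_sum m r + c"
    using jensen_log_sum[OF m0] by blast
  have "regular_radius m r" if "regular_radius f r" for r
    using that by (auto simp: regular_radius_def mm ord_minus_def)
  thus ?thesis using c counting_fun_log_sum[OF m0 mm] by (auto simp: ev)
qed

lemma countable_irregular_radii:
  assumes "f \<noteq> 0"
  shows "countable {s. \<not> regular_radius f (exp s)}"
proof -
  have "countable (ln ` norm ` {z. mord f z \<noteq> 0})"
    using countable_zeros_poles[OF assms] by blast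
  moreover have "{s. \<not> regular_radius f (exp s)} \<subseteq> ln ` norm ` {z. mord f z \<noteq> 0}"
    by (auto simp: regular_radius_def image_iff) (metis ln_exp)
  ultimately show ?thesis by (rule countable_subset[rotated])
qed

text \<open>Irregular radii are countable, hence null, and a set of finite measure cannot contain a
  half-line. Inequalities valid outside exceptional sets are thereby brought to one common,
  arbitrarily large radius.\<close>

lemma exists_regular_radius:
  assumes "finite Fs" "0 \<notin> Fs" "E \<in> sets lborel" "emeasure lborel E < \<infinity>"
  shows "\<exists>s\<ge>s0. s \<notin> E \<and> (\<forall>f\<in>Fs. regular_radius f (exp s))"
proof (rule ccontr)
  define X where "X = (\<Union>f\<in>Fs. {s. \<not> regular_radius f (exp s)})"
  have "countable X"
    unfolding X_def using assms by (intro countable_UN countable_irregular_radii countable_finite) auto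
  hence "X \<in> null_sets lborel" by (rule countable_imp_null_set_lborel)
  hence X: "X \<in> sets lborel" "emeasure lborel X = 0" by auto
  assume "\<not> ?thesis"
  hence "{s0..} \<subseteq> E \<union> X" by (auto simp: X_def)
  hence "emeasure lborel {s0..} \<le> emeasure lborel (E \<union> X)"
    using X assms by (intro emeasure_mono) auto
  also have "\<dots> \<le> emeasure lborel E + emeasure lborel X"
    using X assms by (intro emeasure_subadditive) auto
  also have "\<dots> < \<infinity>" using assms X by simp
  finally have fin: "emeasure lborel {s0..} < \<infinity>" .
  have "emeasure lborel {s0..s0 + real n} \<le> emeasure lborel {s0..}" for n
    by (intro emeasure_mono) auto
  hence le: "ennreal (real n) \<le> emeasure lborel {s0..}" for n by simp
  obtain x where x: "x \<ge> 0" "emeasure lborel {s0..} = ennreal x"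
    using fin by (cases "emeasure lborel {s0..}") auto
  obtain n where "x < real n" using reals_Archimedean2 by blast
  with le[of n] x show False by simp
qed

text \<open>For \<open>a = 0\<close> and \<open>\<eta> = 1\<close> this is the mean square of the
  spherical derivative. For small \<open>\<eta>\<close> the weight is largest where \<open>f\<close>
  is within about \<open>sqrt \<eta>\<close> of \<open>a\<close>, so the scales
  \<open>(1/2) ^ k\<close> together detect closeness of \<open>f\<close> to
  \<open>a\<close>.\<close>

definition curv :: "mero \<Rightarrow> complex \<Rightarrow> real \<Rightarrow> real \<Rightarrow> real" where
  "curv f a \<eta> r = circ_mean (\<lambda>z. \<eta> * norm (mero_eval (mero_deriv f) z) ^ 2 /
     (norm (mero_eval f z - a) ^ 2 + \<eta>) ^ 2) r"

text \<open>The Wronskian of the two entire functions is \<open>sqrt \<eta>\<close> times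
  \<open>f' * f2 ^ 2\<close>, so all powers of \<open>f2\<close> cancel and only expressions in
  \<open>f\<close> remain.\<close>

lemma curvature_mean_curv:
  assumes f0: "f \<noteq> 0" and hol: "f1 holomorphic_on UNIV" "f2 holomorphic_on UNIV"
    and f2: "\<And>z. f2 z = 0 \<longleftrightarrow> mpole f z" and ev: "\<And>z. mero_eval f z = f1 z / f2 z"
    and reg: "regular_radius f (exp s)" and eta: "\<eta> > 0"
  shows "curvature_mean (\<lambda>z. f1 z - a * f2 z) (\<lambda>z. of_real (sqrt \<eta>) * f2 z) s = 4 * exp s ^ 2 * curv f a \<eta> (exp s)"
proof -
  have "4 * (norm z * norm (deriv (\<lambda>z. f1 z - a * f2 z) z * (of_real (sqrt \<eta>) * f2 z) - (f1 z - a * f2 z) * deriv (\<lambda>z. of_real (sqrt \<eta>) * f2 z) z) /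
     (norm (f1 z - a * f2 z) ^ 2 + norm (of_real (sqrt \<eta>) * f2 z) ^ 2)) ^ 2 =
     4 * exp s ^ 2 * (\<eta> * norm (mero_eval (mero_deriv f) z) ^ 2 / (norm (mero_eval f z - a) ^ 2 + \<eta>) ^ 2)"
    if z: "norm z = exp s" for z
  proof -
    have np: "\<not> mpole f z" using regular_radiusD[OF reg f0 z] by simp
    hence f2z: "f2 z \<noteq> 0" using f2 by simp
    have d: "f1 field_differentiable at z" "f2 field_differentiable at z"
      using hol by (auto simp: holomorphic_on_def)
    have "mero_eval (mero_deriv f) z = deriv (\<lambda>z. f1 z / f2 z) z"
      using mero_deriv_eval(2)[OF np] ev by presburger
    also have "\<dots> = (deriv f1 z * f2 z - f1 z * deriv f2 z) / f2 z ^ 2"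
      using d f2z by (rule deriv_divide)
    finally have df: "deriv f1 z * f2 z - f1 z * deriv f2 z = mero_eval (mero_deriv f) z * f2 z ^ 2"
      using f2z by simp
    have dG: "deriv (\<lambda>z. f1 z - a * f2 z) z = deriv f1 z - a * deriv f2 z"
         "deriv (\<lambda>z. of_real (sqrt \<eta>) * f2 z) z = of_real (sqrt \<eta>) * deriv f2 z"
      using d by (auto simp: field_differentiable_mult)
    have "deriv (\<lambda>z. f1 z - a * f2 z) z * (of_real (sqrt \<eta>) * f2 z) - (f1 z - a * f2 z) * deriv (\<lambda>z. of_real (sqrt \<eta>) * f2 z) z
      = of_real (sqrt \<eta>) * (deriv f1 z * f2 z - f1 z * deriv f2 z)"
      unfolding dG by (simp add: algebra_simps)
    hence num: "norm (deriv (\<lambda>z. f1 z - a * f2 z) z * (of_real (sqrt \<eta>) * f2 z) - (f1 z - a * f2 z) * deriv (\<lambda>z. of_real (sqrt \<eta>) * f2 z) z)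
      = sqrt \<eta> * norm (mero_eval (mero_deriv f) z) * norm (f2 z) ^ 2"
      unfolding df using eta by (simp add: norm_mult norm_power)
    have fac: "f1 z - a * f2 z = f2 z * (mero_eval f z - a)" using f2z by (simp add: ev field_simps)
    have den: "norm (f1 z - a * f2 z) ^ 2 + norm (of_real (sqrt \<eta>) * f2 z) ^ 2 = norm (f2 z) ^ 2 * (norm (mero_eval f z - a) ^ 2 + \<eta>)"
      unfolding fac using eta by (simp add: norm_mult power_mult_distrib distrib_left)
    have cancel: "x * (y * w * q) / (q * v) = x * y * w / v" if "q \<noteq> 0" for x y w q v :: real
      using that by (simp add: field_simps)
    show ?thesis
      unfolding num den using f2z eta
      by (subst cancel) (simp_all add: z power_divide power_mult_distrib)
  qed
  hence "curvature_mean (\<lambda>z. f1 z - a * f2 z) (\<lambda>z. of_real (sqrt \<eta>) * f2 z) s =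
     circ_mean (\<lambda>z. 4 * exp s ^ 2 * (\<eta> * norm (mero_eval (mero_deriv f) z) ^ 2 / (norm (mero_eval f z - a) ^ 2 + \<eta>) ^ 2)) (exp s)"
    unfolding curvature_mean_def by (intro circ_mean_cong) auto
  thus ?thesis by (simp only: circ_mean_cmult curv_def)
qed

text \<open>After factoring out \<open>norm (f2 z) ^ 2\<close>, the argument of \<open>ln\<close> is
  at most a constant times \<open>max 1 (norm f) ^ 2\<close>. The mean of
  \<open>ln (norm f2)\<close> gives the counting function, the rest the proximity function. The
  bound is the same for all \<open>\<eta>\<close> in (0, 1].\<close>

lemma log_norm_mean_le:
  assumes f0: "f \<noteq> 0" and hol: "f1 holomorphic_on UNIV" "f2 holomorphic_on UNIV"
    and f2: "\<And>z. f2 z = 0 \<longleftrightarrow> mpole f z" and ev: "\<And>z. mero_eval f z = f1 z / f2 z"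
    and c: "\<forall>r>0. regular_radius f r \<longrightarrow> circ_mean (\<lambda>z. ln (norm (f2 z))) r = counting_fun f r + c"
    and reg: "regular_radius f (exp s)" and eta: "0 < \<eta>" "\<eta> \<le> 1"
  shows "log_norm_mean (\<lambda>z. f1 z - a * f2 z) (\<lambda>z. of_real (sqrt \<eta>) * f2 z) s
    \<le> 2 * nevanlinna_char f (exp s) + 2 * c + ln (2 * norm a ^ 2 + 3)"
proof -
  let ?r = "exp s"
  have nz: "f2 z \<noteq> 0" if "norm z = ?r" for z
    using regular_radiusD(1)[OF reg f0 that] f2 by simp
  have cf: "continuous_on (sphere 0 ?r) (mero_eval f)" by (rule regular_radius_continuous[OF reg f0])
  have c2: "continuous_on (sphere 0 ?r) f2" "continuous_on (sphere 0 ?r) f1"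
    using hol holomorphic_on_imp_continuous_on continuous_on_subset by blast+
  have ineq: "ln (norm (f1 z - a * f2 z) ^ 2 + norm (of_real (sqrt \<eta>) * f2 z) ^ 2)
     \<le> 2 * ln (norm (f2 z)) + 2 * log_plus (norm (mero_eval f z)) + ln (2 * norm a ^ 2 + 3)"
    if z: "norm z = ?r" for z
  proof -
    let ?w = "mero_eval f z"
    let ?M = "max 1 (norm ?w)"
    have fac: "f1 z - a * f2 z = f2 z * (?w - a)" using nz[OF z] by (simp add: ev field_simps)
    have "norm (f1 z - a * f2 z) ^ 2 + norm (of_real (sqrt \<eta>) * f2 z) ^ 2 = norm (f2 z) ^ 2 * (norm (?w - a) ^ 2 + \<eta>)"
      unfolding fac using eta by (simp add: norm_mult power_mult_distrib distrib_left)
    also have "\<dots> \<le> norm (f2 z) ^ 2 * ((2 * norm a ^ 2 + 3) * ?M ^ 2)"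
    proof (rule mult_left_mono)
      have "norm (?w - a) ^ 2 \<le> (norm ?w + norm a) ^ 2"
        by (intro power_mono norm_triangle_ineq4) auto
      also have "\<dots> \<le> 2 * norm ?w ^ 2 + 2 * norm a ^ 2"
        using sum_squares_bound[of "norm ?w" "norm a"] by (simp add: power2_sum)
      also have "\<dots> + \<eta> \<le> 2 * ?M ^ 2 + 2 * norm a ^ 2 * ?M ^ 2 + ?M ^ 2"
      proof (intro add_mono)
        have M: "1 \<le> ?M ^ 2" by (rule one_le_power) simp
        show "2 * norm ?w ^ 2 \<le> 2 * ?M ^ 2" by (simp add: power_mono)
        show "2 * norm a ^ 2 \<le> 2 * norm a ^ 2 * ?M ^ 2"
          using mult_left_mono[OF M, of "2 * norm a ^ 2"] by simp
        show "\<eta> \<le> ?M ^ 2" using M eta by linarith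
      qed
      finally show "norm (?w - a) ^ 2 + \<eta> \<le> (2 * norm a ^ 2 + 3) * ?M ^ 2"
        by (simp add: algebra_simps)
    qed simp
    finally have "ln (norm (f1 z - a * f2 z) ^ 2 + norm (of_real (sqrt \<eta>) * f2 z) ^ 2) \<le> ln (norm (f2 z) ^ 2 * ((2 * norm a ^ 2 + 3) * ?M ^ 2))"
      using nz[OF z] eta by (intro ln_mono) (auto intro: add_nonneg_pos)
    also have "\<dots> = 2 * ln (norm (f2 z)) + (ln (2 * norm a ^ 2 + 3) + 2 * ln ?M)"
    proof -
      have "2 * norm a ^ 2 + 3 > 0" using zero_le_power2[of "norm a"] by linarith
      thus ?thesis using nz[OF z] by (simp add: ln_mult ln_realpow)
    qed
    finally show ?thesis by (simp add: log_plus_alt)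
  qed
  have cont1: "continuous_on (sphere 0 ?r) (\<lambda>z. ln (norm (f2 z)))"
    using nz by (intro continuous_intros c2) auto
  have cont2: "continuous_on (sphere 0 ?r) (\<lambda>z. log_plus (norm (mero_eval f z)))"
    by (intro continuous_intros cf)
  have "log_norm_mean (\<lambda>z. f1 z - a * f2 z) (\<lambda>z. of_real (sqrt \<eta>) * f2 z) s
     \<le> circ_mean (\<lambda>z. 2 * ln (norm (f2 z)) + 2 * log_plus (norm (mero_eval f z)) + ln (2 * norm a ^ 2 + 3)) ?r"
    unfolding log_norm_mean_def
  proof (rule circ_mean_mono)
    show "continuous_on (sphere 0 ?r) (\<lambda>z. ln (norm (f1 z - a * f2 z) ^ 2 + norm (of_real (sqrt \<eta>) * f2 z) ^ 2))"
      using nz eta by (intro continuous_on_ln continuous_intros c2) auto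
    show "continuous_on (sphere 0 ?r) (\<lambda>z. 2 * ln (norm (f2 z)) + 2 * log_plus (norm (mero_eval f z)) + ln (2 * norm a ^ 2 + 3))"
      by (intro continuous_on_add continuous_on_mult continuous_on_const cont1 cont2)
  qed (use ineq in auto)
  also have "\<dots> = 2 * circ_mean (\<lambda>z. ln (norm (f2 z))) ?r + 2 * proximity_fun f ?r + ln (2 * norm a ^ 2 + 3)"
  proof -
    have "continuous_on (sphere 0 ?r) (\<lambda>z. 2 * ln (norm (f2 z)))"
      "continuous_on (sphere 0 ?r) (\<lambda>z. 2 * log_plus (norm (mero_eval f z)))"
      by (intro continuous_intros cont1 cont2)+
    thus ?thesis
      by (simp add: circ_mean_add circ_mean_cmult continuous_on_add proximity_fun_circ_mean)
  qed
  also have "circ_mean (\<lambda>z. ln (norm (f2 z))) ?r = counting_fun f ?r + c"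
    using c reg by simp
  finally show ?thesis by (simp add: nevanlinna_char_def algebra_simps)
qed

text \<open>The growth lemma is applied with \<open>B = b ^ k\<close> at the scale
  \<open>\<eta> = (1/2) ^ k\<close>. The exceptional sets have measure at most
  \<open>2 / b ^ k\<close>, which is summable because \<open>b > 1\<close>; the price is the factor
  \<open>b ^ (3 * k)\<close>.\<close>

lemma curvature_bound:
  assumes nonconst: "f \<notin> range mero_const" and b: "b > 1"
  shows "\<exists>E\<in>sets lborel. emeasure lborel E < \<infinity> \<and> (\<exists>C s0. s0 \<ge> 0 \<and> (\<forall>s\<ge>s0. s \<notin> E \<longrightarrow> regular_radius f (exp s) \<longrightarrow>
     2 * nevanlinna_char f (exp s) + C \<ge> 1 \<and>
     (\<forall>k. curv f a ((1/2) ^ k) (exp s) \<le> b ^ (3 * k) * (2 * nevanlinna_char f (exp s) + C) ^ 4)))"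
proof -
  have f0: "f \<noteq> 0" using nonconst by (metis mero_const_0 rangeI)
  define g where "g = f - mero_const a"
  have g0: "g \<noteq> 0" using nonconst by (auto simp: g_def)
  obtain f1 f2 where hol: "f1 holomorphic_on UNIV" "f2 holomorphic_on UNIV"
    and nz: "\<And>z. f1 z \<noteq> 0 \<or> f2 z \<noteq> 0" and f2: "\<And>z. f2 z = 0 \<longleftrightarrow> mpole f z"
    and ev: "\<And>z. mero_eval f z = f1 z / f2 z" and zo: "\<And>z. zorder f2 z = ord_minus f z"
    using mero_quotient[OF f0] by blast
  obtain s0 where s0: "s0 \<ge> 0" "regular_radius f (exp s0)" "regular_radius g (exp s0)"
    using exists_regular_radius[of "{f, g}" "{}" 0] f0 g0 by auto
  have "f2 (of_real (exp s0)) \<noteq> 0"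
    using regular_radiusD(1)[OF s0(2) f0, of "of_real (exp s0)"] f2 by simp
  then obtain c where c: "\<forall>r>0. regular_radius f r \<longrightarrow> circ_mean (\<lambda>z. ln (norm (f2 z))) r = counting_fun f r + c"
    using jensen_entire[OF hol(2) _ zo] by blast
  define G1 where "G1 = (\<lambda>z. f1 z - a * f2 z)"
  define G2 where "G2 = (\<lambda>k::nat. \<lambda>z. of_real (sqrt ((1/2) ^ k)) * f2 z)"
  have holG: "G1 holomorphic_on UNIV" "G2 k holomorphic_on UNIV" for k
    unfolding G1_def G2_def by (intro holomorphic_intros hol)+
  have nzG: "G1 z \<noteq> 0 \<or> G2 k z \<noteq> 0" for z k
    using nz[of z] by (auto simp: G1_def G2_def)
  have G1nz: "G1 z \<noteq> 0" if "norm z = exp s0" for z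
  proof -
    have "\<not> mpole f z" using regular_radiusD[OF s0(2) f0 that] by simp
    moreover from this have "mero_eval g z = mero_eval f z - a" by (simp add: g_def mero_eval_diff)
    ultimately show ?thesis
      using regular_radiusD[OF s0(3) g0 that] f2[of z] by (auto simp: G1_def ev field_simps)
  qed
  have contG: "continuous_on A G1" "continuous_on A (G2 k)" for A k
    using holG holomorphic_on_imp_continuous_on continuous_on_subset by blast+
  \<comment> \<open>The lower bound is taken from \<open>G1\<close> alone, so as to be independent
    of \<open>k\<close>: the functions \<open>G2 k\<close> tend to 0.\<close>
  obtain d where d: "d > 0" "\<And>z. norm z = exp s0 \<Longrightarrow> norm (G1 z) ^ 2 \<ge> d"
  proof -
    obtain z0 where z0: "z0 \<in> sphere 0 (exp s0)" "\<And>z. z \<in> sphere 0 (exp s0) \<Longrightarrow> norm (G1 z0) ^ 2 \<le> norm (G1 z) ^ 2"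
    proof -
      have "complex_of_real (exp s0) \<in> sphere 0 (exp s0)" by simp
      hence "sphere 0 (exp s0) \<noteq> ({} :: complex set)" by blast
      moreover have "continuous_on (sphere 0 (exp s0)) (\<lambda>z. norm (G1 z) ^ 2)"
        by (intro continuous_intros contG)
      ultimately show ?thesis
        using continuous_attains_inf[OF compact_sphere, of 0 "exp s0" "\<lambda>z. norm (G1 z) ^ 2"] that by blast
    qed
    show ?thesis by (rule that[of "norm (G1 z0) ^ 2"]) (use z0 G1nz in auto)
  qed
  define J where "J = (\<lambda>k. log_norm_mean G1 (G2 k))"
  have "\<forall>k. \<exists>J1. (\<forall>s. (J k has_real_derivative J1 s) (at s)) \<and> (\<forall>s. (J1 has_real_derivative curvature_mean G1 (G2 k) s) (at s)) \<and>
              continuous_on UNIV (curvature_mean G1 (G2 k)) \<and> (\<forall>s. J1 s \<ge> 0)"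
    unfolding J_def using log_norm_mean_convex[OF holG nzG] by blast
  then obtain J1 where J1: "\<And>k s. (J k has_real_derivative J1 k s) (at s)"
      "\<And>k s. (J1 k has_real_derivative curvature_mean G1 (G2 k) s) (at s)"
      "\<And>k. continuous_on UNIV (curvature_mean G1 (G2 k))" "\<And>k s. J1 k s \<ge> 0"
    by metis
  have Jlow: "J k s \<ge> ln d" if "s \<ge> s0" for k s
  proof -
    have "ln d \<le> J k s0"
    proof -
      have pos: "norm (G1 z) ^ 2 + norm (G2 k z) ^ 2 \<ge> d" if "norm z = exp s0" for z
        using d(2)[OF that] by (smt (verit) zero_le_power2)
      hence "circ_mean (\<lambda>z. ln d) (exp s0) \<le> J k s0"
        unfolding J_def log_norm_mean_def using d(1)
        by (intro circ_mean_mono continuous_intros contG) (auto intro!: ln_mono simp: sum_power2_eq_zero_iff dest: G1nz)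
      thus ?thesis by simp
    qed
    also have "\<dots> \<le> J k s"
      using J1(1,4) by (intro DERIV_nonneg_imp_nondecreasing[OF that]) blast
    finally show ?thesis .
  qed
  \<comment> \<open>With this shift \<open>J k s + K \<ge> 1\<close> from \<open>s0\<close> on, for
    all \<open>k\<close>, as the growth lemma demands.\<close>
  define K where "K = 1 - ln d"
  have "\<forall>k. \<exists>E\<in>sets lborel. emeasure lborel E \<le> ennreal (2 / b ^ k) \<and>
           (\<forall>s\<ge>s0. s \<notin> E \<longrightarrow> curvature_mean G1 (G2 k) s \<le> 4 * (b ^ k) ^ 3 * (J k s + K) ^ 4)"
  proof
    fix k
    have "((\<lambda>s. J k s + K) has_real_derivative J1 k s) (at s)" for s
      by (auto intro!: derivative_eq_intros J1)
    thus "\<exists>E\<in>sets lborel. emeasure lborel E \<le> ennreal (2 / b ^ k) \<and>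
           (\<forall>s\<ge>s0. s \<notin> E \<longrightarrow> curvature_mean G1 (G2 k) s \<le> 4 * (b ^ k) ^ 3 * (J k s + K) ^ 4)"
      using b Jlow J1 curvature_mean_nonneg
      by (intro borel_growth_second_derivative[where ?J1.0 = "J1 k"]) (auto simp: K_def algebra_simps)
  qed
  then obtain E where E: "\<And>k. E k \<in> sets lborel" "\<And>k. emeasure lborel (E k) \<le> ennreal (2 / b ^ k)"
      "\<And>k s. s \<ge> s0 \<Longrightarrow> s \<notin> E k \<Longrightarrow> curvature_mean G1 (G2 k) s \<le> 4 * (b ^ k) ^ 3 * (J k s + K) ^ 4"
    by metis
  define C where "C = 2 * c + ln (2 * norm a ^ 2 + 3) + K"
  have sum: "summable (\<lambda>k. 2 / b ^ k)"
    using summable_mult[OF summable_geometric[of "1 / b"], of 2] b by (simp add: power_divide)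
  have "emeasure lborel (\<Union>k. E k) \<le> suminf (\<lambda>k. emeasure lborel (E k))"
    using E by (intro emeasure_subadditive_countably) auto
  also have "\<dots> \<le> suminf (\<lambda>k. ennreal (2 / b ^ k))"
    by (intro suminf_le E) auto
  also have "\<dots> = ennreal (suminf (\<lambda>k. 2 / b ^ k))"
    using b by (intro suminf_ennreal2 sum) auto
  also have "\<dots> < \<infinity>" by simp
  finally have fin: "emeasure lborel (\<Union>k. E k) < \<infinity>" .
  have main: "2 * nevanlinna_char f (exp s) + C \<ge> 1 \<and> curv f a ((1/2) ^ k) (exp s) \<le> b ^ (3 * k) * (2 * nevanlinna_char f (exp s) + C) ^ 4"
    if s: "s \<ge> s0" "s \<notin> (\<Union>k. E k)" "regular_radius f (exp s)" for s k
  proof -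
    have JK: "J k s + K \<le> 2 * nevanlinna_char f (exp s) + C"
      using log_norm_mean_le[OF f0 hol f2 ev c s(3), of "(1/2) ^ k" a]
      by (simp add: J_def G1_def G2_def C_def power_le_one)
    have JK1: "J k s + K \<ge> 1" using Jlow[OF s(1)] by (simp add: K_def)
    have nn: "curv f a ((1/2) ^ k) (exp s) \<ge> 0"
    proof -
      have "0 \<le> 4 * exp s ^ 2 * curv f a ((1/2) ^ k) (exp s)"
        using curvature_mean_nonneg[of "\<lambda>z. f1 z - a * f2 z" "\<lambda>z. of_real (sqrt ((1/2) ^ k)) * f2 z" s]
        by (subst (asm) curvature_mean_curv[OF f0 hol f2 ev s(3)]) simp_all
      thus ?thesis by (simp add: zero_le_mult_iff)
    qed
    have "exp s ^ 2 \<ge> 1" using s(1) s0(1) by (intro one_le_power) simp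
    hence "curv f a ((1/2) ^ k) (exp s) \<le> exp s ^ 2 * curv f a ((1/2) ^ k) (exp s)"
      using nn mult_right_mono by fastforce
    also have "4 * \<dots> = curvature_mean G1 (G2 k) s"
      using curvature_mean_curv[OF f0 hol f2 ev s(3), of "(1/2) ^ k" a] by (simp add: G1_def G2_def)
    also have "\<dots> \<le> 4 * (b ^ k) ^ 3 * (J k s + K) ^ 4"
      using s by (intro E) auto
    also have "\<dots> \<le> 4 * (b ^ k) ^ 3 * (2 * nevanlinna_char f (exp s) + C) ^ 4"
      using b JK JK1 by (intro mult_left_mono power_mono) auto
    finally have "4 * curv f a ((1/2) ^ k) (exp s) \<le> 4 * (b ^ k) ^ 3 * (2 * nevanlinna_char f (exp s) + C) ^ 4"
      by simp
    thus ?thesis using JK JK1 by (simp add: power_mult[symmetric] mult.commute)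
  qed
  show ?thesis
    using E(1) fin main s0(1) by (intro bexI[of _ "\<Union>k. E k"] conjI exI[of _ C] exI[of _ s0]) auto
qed

section \<open>Jensen's inequality and unboundedness of the characteristic\<close>

lemma circ_mean_lower_bound:
  assumes "continuous_on (sphere 0 r) g" "r \<ge> 0" "\<And>z. norm z = r \<Longrightarrow> c \<le> g z"
  shows "c \<le> circ_mean g r"
  using circ_mean_mono[of r "\<lambda>_. c" g] assms by simp

lemma circ_mean_pos:
  assumes "continuous_on (sphere 0 r) g" "r \<ge> 0" "\<And>z. norm z = r \<Longrightarrow> g z > 0"
  shows "circ_mean g r > 0"
proof -
  have "complex_of_real r \<in> sphere 0 r" using assms(2) by simp
  hence "sphere 0 r \<noteq> ({} :: complex set)" by blast
  then obtain z0 where z0: "z0 \<in> sphere 0 r" "\<And>z. z \<in> sphere 0 r \<Longrightarrow> g z0 \<le> g z"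
    using continuous_attains_inf[OF compact_sphere _ assms(1)] by blast
  have "g z0 \<le> circ_mean g r"
    using z0 assms by (intro circ_mean_lower_bound) auto
  thus ?thesis using z0(1) assms(3)[of z0] by simp
qed

text \<open>Concavity of \<open>ln\<close> in the form of its tangent at the mean \<open>M\<close>:
  \<open>ln x \<le> x / M + ln M - 1\<close>.\<close>

lemma circ_mean_ln_le:
  assumes "continuous_on (sphere 0 r) g" "r \<ge> 0" "\<And>z. norm z = r \<Longrightarrow> g z > 0"
  shows "circ_mean (\<lambda>z. ln (g z)) r \<le> ln (circ_mean g r)"
proof -
  define M where "M = circ_mean g r"
  have M: "M > 0" unfolding M_def by (rule circ_mean_pos[OF assms])
  have c1: "continuous_on (sphere 0 r) (\<lambda>z. ln (g z))"
    by (intro continuous_on_ln assms(1)) (use assms(3) in force)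
  have c2: "continuous_on (sphere 0 r) (\<lambda>z. inverse M * g z)"
    by (intro continuous_intros assms(1))
  have "circ_mean (\<lambda>z. ln (g z)) r \<le> circ_mean (\<lambda>z. inverse M * g z + (ln M - 1)) r"
  proof (rule circ_mean_mono[OF c1])
    show "continuous_on (sphere 0 r) (\<lambda>z. inverse M * g z + (ln M - 1))"
      by (intro continuous_on_add c2 continuous_on_const)
    show "ln (g z) \<le> inverse M * g z + (ln M - 1)" if "norm z = r" for z
      using ln_le_minus_one[of "inverse M * g z"] M assms(3)[OF that]
      by (simp add: ln_mult ln_inverse)
  qed (use assms in auto)
  also have "\<dots> = inverse M * circ_mean g r + (ln M - 1)"
    by (subst circ_mean_add) (use assms c2 in \<open>auto simp: circ_mean_cmult\<close>)
  also have "\<dots> = ln M" using M by (simp add: M_def)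
  finally show ?thesis by (simp add: M_def)
qed

lemma curv_continuous:
  assumes "regular_radius f r" "f \<noteq> 0" "\<eta> > 0"
  shows "continuous_on (sphere 0 r) (\<lambda>z. \<eta> * norm (mero_eval (mero_deriv f) z) ^ 2 /
     (norm (mero_eval f z - a) ^ 2 + \<eta>) ^ 2)"
proof -
  have c1: "continuous_on (sphere 0 r) (mero_eval (mero_deriv f))"
    using regular_radiusD(1)[OF assms(1,2)] mero_deriv_eval(1)
    by (intro analytic_imp_holomorphic holomorphic_on_imp_continuous_on)
       (subst analytic_on_analytic_at, auto intro!: mero_eval_analytic)
  note c2 = regular_radius_continuous[OF assms(1,2)]
  have "norm (mero_eval f z - a) ^ 2 + \<eta> > 0" for z
    using assms(3) by (intro add_nonneg_pos) auto
  hence "(norm (mero_eval f z - a) ^ 2 + \<eta>) ^ 2 \<noteq> 0" for z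
    by (metis less_irrefl zero_eq_power2)
  thus ?thesis
    by (intro continuous_on_divide continuous_on_mult continuous_on_power continuous_on_norm
        continuous_on_add continuous_on_diff continuous_on_const c1 c2) auto
qed

text \<open>The mean for \<open>a = 0\<close>, \<open>\<eta> = 1\<close> is convex in
  \<open>s\<close> and, as \<open>f'\<close> is not identically zero, has positive curvature
  somewhere. To the right of that point its slope is bounded below by a positive number, and the
  mean is at most \<open>2 * nevanlinna_char f\<close> plus a constant.\<close>

lemma nevanlinna_char_unbounded:
  assumes nonconst: "f \<notin> range mero_const"
  shows "\<exists>s1. \<forall>s\<ge>s1. regular_radius f (exp s) \<longrightarrow> nevanlinna_char f (exp s) \<ge> M"
proof -
  have f0: "f \<noteq> 0" using nonconst by (metis mero_const_0 rangeI)
  have df0: "mero_deriv f \<noteq> 0" by (rule mero_deriv_nonzero[OF nonconst])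
  obtain f1 f2 where hol: "f1 holomorphic_on UNIV" "f2 holomorphic_on UNIV"
    and nz: "\<And>z. f1 z \<noteq> 0 \<or> f2 z \<noteq> 0" and f2: "\<And>z. f2 z = 0 \<longleftrightarrow> mpole f z"
    and ev: "\<And>z. mero_eval f z = f1 z / f2 z" and zo: "\<And>z. zorder f2 z = ord_minus f z"
    using mero_quotient[OF f0] by blast
  obtain s0 where s0: "s0 \<ge> 0" "regular_radius f (exp s0)" "regular_radius (mero_deriv f) (exp s0)"
    using exists_regular_radius[of "{f, mero_deriv f}" "{}" 0] f0 df0 by auto
  have "f2 (of_real (exp s0)) \<noteq> 0"
    using regular_radiusD(1)[OF s0(2) f0, of "of_real (exp s0)"] f2 by simp
  then obtain c where c: "\<forall>r>0. regular_radius f r \<longrightarrow> circ_mean (\<lambda>z. ln (norm (f2 z))) r = counting_fun f r + c"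
    using jensen_entire[OF hol(2) _ zo] by blast
  \<comment> \<open>\<open>0\<close> and \<open>sqrt 1\<close> are kept so that the general
    curvature lemmas apply literally with \<open>a = 0\<close> and
    \<open>\<eta> = 1\<close>.\<close>
  define G1 where "G1 = (\<lambda>z. f1 z - 0 * f2 z)"
  define G2 where "G2 = (\<lambda>z. of_real (sqrt 1) * f2 z)"
  have holG: "G1 holomorphic_on UNIV" "G2 holomorphic_on UNIV"
    unfolding G1_def G2_def by (intro holomorphic_intros hol)+
  have nzG: "G1 z \<noteq> 0 \<or> G2 z \<noteq> 0" for z using nz[of z] by (auto simp: G1_def G2_def)
  define J where "J = log_norm_mean G1 G2"
  obtain J1 where J1: "\<And>s. (J has_real_derivative J1 s) (at s)"
      "\<And>s. (J1 has_real_derivative curvature_mean G1 G2 s) (at s)" "\<And>s. J1 s \<ge> 0"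
    unfolding J_def using log_norm_mean_convex[OF holG nzG] by blast
  have mono: "J1 s \<le> J1 t" if "s \<le> t" for s t
    using J1(2) curvature_mean_nonneg by (intro DERIV_nonneg_imp_nondecreasing[OF that]) blast
  have "curv f 0 1 (exp s0) > 0"
    unfolding curv_def
  proof (rule circ_mean_pos[OF curv_continuous[OF s0(2) f0]])
    fix z :: complex assume z: "norm z = exp s0"
    have "norm (mero_eval f z - 0) ^ 2 + 1 > 0" by (simp add: add_nonneg_pos)
    thus "1 * norm (mero_eval (mero_deriv f) z) ^ 2 / (norm (mero_eval f z - 0) ^ 2 + 1) ^ 2 > 0"
      using regular_radiusD(2)[OF s0(3) df0 z] by simp
  qed auto
  hence pos: "curvature_mean G1 G2 s0 > 0"
    unfolding G1_def G2_def by (subst curvature_mean_curv[OF f0 hol f2 ev s0(2)]) auto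
  obtain d where d: "d > 0" "\<And>h. 0 < h \<Longrightarrow> h < d \<Longrightarrow> J1 s0 < J1 (s0 + h)"
    using DERIV_pos_inc_right[OF J1(2) pos] by blast
  define s2 where "s2 = s0 + d / 2"
  have e: "J1 s2 > 0" using d(1) d(2)[of "d / 2"] J1(3)[of s0] by (simp add: s2_def)
  have grow: "J s \<ge> J s2 + J1 s2 * (s - s2)" if "s \<ge> s2" for s
  proof -
    have "J s2 - J1 s2 * s2 \<le> J s - J1 s2 * s"
    proof (rule DERIV_nonneg_imp_nondecreasing[OF that])
      fix x assume x: "s2 \<le> x" "x \<le> s"
      have "((\<lambda>s. J s - J1 s2 * s) has_real_derivative (J1 x - J1 s2)) (at x)"
        by (auto intro!: derivative_eq_intros J1)
      thus "\<exists>y. ((\<lambda>s. J s - J1 s2 * s) has_real_derivative y) (at x) \<and> 0 \<le> y"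
        using mono[OF x(1)] by (intro exI[of _ "J1 x - J1 s2"]) simp
    qed
    thus ?thesis by (simp add: algebra_simps)
  qed
  define C where "C = 2 * c + ln (2 * norm (0::complex) ^ 2 + 3)"
  define s1 where "s1 = max s2 (s2 + (2 * M + C - J s2) / J1 s2)"
  have "nevanlinna_char f (exp s) \<ge> M" if s: "s \<ge> s1" "regular_radius f (exp s)" for s
  proof -
    have "s2 + (2 * M + C - J s2) / J1 s2 \<le> s" using s by (simp add: s1_def)
    hence "2 * M + C - J s2 \<le> J1 s2 * (s - s2)"
      using e by (simp add: field_simps)
    also have "\<dots> \<le> J s - J s2" using grow[of s] s by (simp add: s1_def)
    also have "J s \<le> 2 * nevanlinna_char f (exp s) + C"
      using log_norm_mean_le[OF f0 hol f2 ev c s(2), of 1 0] by (simp add: J_def G1_def G2_def C_def)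
    finally show ?thesis by simp
  qed
  thus ?thesis by blast
qed

section \<open>Weighted counting sums\<close>

text \<open>\<open>counting_fun\<close>, \<open>log_sum\<close> and \<open>reduced_counting\<close>
  are all sums of this shape, so inequalities between orders at single points pass to them by
  monotonicity and linearity.\<close>

definition wsum :: "(complex \<Rightarrow> int) \<Rightarrow> real \<Rightarrow> real" where
  "wsum w r = (\<Sum>z | 0 < norm z \<and> norm z \<le> r \<and> w z \<noteq> 0. w z * ln (r / norm z)) + w 0 * ln r"

text \<open>A \<open>sum\<close> over an infinite set is 0 by convention, so the rules for
  \<open>wsum\<close> assume local finiteness.\<close>

definition disc_finite :: "(complex \<Rightarrow> int) \<Rightarrow> bool" where
  "disc_finite w \<longleftrightarrow> (\<forall>r. finite {z. norm z \<le> r \<and> w z \<noteq> 0})"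

lemma wsum_superset:
  assumes "finite Z" "Z \<subseteq> {z. 0 < norm z \<and> norm z \<le> r}" "{z. 0 < norm z \<and> norm z \<le> r \<and> w z \<noteq> 0} \<subseteq> Z"
  shows "wsum w r = (\<Sum>z\<in>Z. w z * ln (r / norm z)) + w 0 * ln r"
  unfolding wsum_def using assms by (intro arg_cong2[where f = "(+)"] sum.mono_neutral_left refl) auto

lemma disc_finiteD: "disc_finite w \<Longrightarrow> finite {z. 0 < norm z \<and> norm z \<le> r \<and> w z \<noteq> 0}"
  unfolding disc_finite_def by (rule finite_subset[of _ "{z. norm z \<le> r \<and> w z \<noteq> 0}"]) auto

text \<open>The weights \<open>ln (r / norm z)\<close> are nonnegative in the disc, and
  \<open>r \<ge> 1\<close> makes the weight \<open>ln r\<close> of the origin nonnegative as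
  well.\<close>

lemma wsum_mono:
  assumes "disc_finite w" "disc_finite v" "\<And>z. w z \<le> v z" "r \<ge> 1"
  shows "wsum w r \<le> wsum v r"
proof -
  define Z where "Z = {z. 0 < norm z \<and> norm z \<le> r \<and> w z \<noteq> 0} \<union> {z. 0 < norm z \<and> norm z \<le> r \<and> v z \<noteq> 0}"
  have Z: "finite Z" unfolding Z_def by (intro finite_UnI disc_finiteD assms)
  have w: "wsum w r = (\<Sum>z\<in>Z. w z * ln (r / norm z)) + w 0 * ln r"
    by (rule wsum_superset[OF Z]) (auto simp: Z_def)
  have v: "wsum v r = (\<Sum>z\<in>Z. v z * ln (r / norm z)) + v 0 * ln r"
    by (rule wsum_superset[OF Z]) (auto simp: Z_def)
  show ?thesis unfolding w v
  proof (intro add_mono sum_mono mult_right_mono)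
    show "0 \<le> ln (r / norm z)" if "z \<in> Z" for z
      using that by (auto simp: Z_def)
  qed (use assms in auto)
qed

lemma disc_finite_add:
  assumes "disc_finite w" "disc_finite v"
  shows "disc_finite (\<lambda>z. w z + v z)"
proof -
  have "finite {z. norm z \<le> r \<and> w z + v z \<noteq> 0}" for r
  proof (rule finite_subset)
    show "{z. norm z \<le> r \<and> w z + v z \<noteq> 0} \<subseteq> {z. norm z \<le> r \<and> w z \<noteq> 0} \<union> {z. norm z \<le> r \<and> v z \<noteq> 0}"
      by auto
    show "finite ({z. norm z \<le> r \<and> w z \<noteq> 0} \<union> {z. norm z \<le> r \<and> v z \<noteq> 0})"
      using assms by (simp add: disc_finite_def)
  qed
  thus ?thesis by (simp add: disc_finite_def)
qed

lemma wsum_add: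
  assumes "disc_finite w" "disc_finite v"
  shows "wsum (\<lambda>z. w z + v z) r = wsum w r + wsum v r"
proof -
  define Z where "Z = {z. 0 < norm z \<and> norm z \<le> r \<and> w z \<noteq> 0} \<union> {z. 0 < norm z \<and> norm z \<le> r \<and> v z \<noteq> 0}"
  have Z: "finite Z" unfolding Z_def by (intro finite_UnI disc_finiteD assms)
  have 1: "wsum w r = (\<Sum>z\<in>Z. w z * ln (r / norm z)) + w 0 * ln r"
    by (rule wsum_superset[OF Z]) (auto simp: Z_def)
  have 2: "wsum v r = (\<Sum>z\<in>Z. v z * ln (r / norm z)) + v 0 * ln r"
    by (rule wsum_superset[OF Z]) (auto simp: Z_def)
  have 3: "wsum (\<lambda>z. w z + v z) r = (\<Sum>z\<in>Z. (w z + v z) * ln (r / norm z)) + (w 0 + v 0) * ln r"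
    by (rule wsum_superset[OF Z]) (auto simp: Z_def)
  show ?thesis
    by (simp only: 1 2 3 of_int_add distrib_right sum.distrib)
qed

lemma disc_finite_subset:
  assumes "disc_finite w" "\<And>z. w z = 0 \<Longrightarrow> v z = 0"
  shows "disc_finite v"
proof -
  have "finite {z. norm z \<le> r \<and> v z \<noteq> 0}" for r
    by (rule finite_subset[of _ "{z. norm z \<le> r \<and> w z \<noteq> 0}"])
       (use assms in \<open>auto simp: disc_finite_def\<close>)
  thus ?thesis by (simp add: disc_finite_def)
qed

lemma disc_finite_cmult: "disc_finite w \<Longrightarrow> disc_finite (\<lambda>z. c * w z)"
  by (erule disc_finite_subset) simp

lemma wsum_cmult:
  assumes "disc_finite w"
  shows "wsum (\<lambda>z. c * w z) r = c * wsum w r"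
proof -
  define Z where "Z = {z. 0 < norm z \<and> norm z \<le> r \<and> w z \<noteq> 0}"
  have Z: "finite Z" unfolding Z_def by (rule disc_finiteD[OF assms])
  have 1: "wsum w r = (\<Sum>z\<in>Z. w z * ln (r / norm z)) + w 0 * ln r"
    by (rule wsum_superset[OF Z]) (auto simp: Z_def)
  have 2: "wsum (\<lambda>z. c * w z) r = (\<Sum>z\<in>Z. (c * w z) * ln (r / norm z)) + (c * w 0) * ln r"
    by (rule wsum_superset[OF Z]) (auto simp: Z_def)
  show ?thesis
    unfolding 1 2 of_int_mult distrib_left sum_distrib_left mult.assoc ..
qed

lemma wsum_0 [simp]: "wsum (\<lambda>_. 0) r = 0" "disc_finite (\<lambda>_. 0)"
  by (simp_all add: wsum_def disc_finite_def)

lemma wsum_sum: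
  assumes "finite A" "\<And>i. i \<in> A \<Longrightarrow> disc_finite (w i)"
  shows "disc_finite (\<lambda>z. \<Sum>i\<in>A. w i z) \<and> wsum (\<lambda>z. \<Sum>i\<in>A. w i z) r = (\<Sum>i\<in>A. wsum (w i) r)"
  using assms
proof (induction A rule: finite_induct)
  case (insert i A)
  hence "disc_finite (\<lambda>z. w i z + (\<Sum>i\<in>A. w i z))"
    by (intro disc_finite_add) auto
  moreover have "wsum (\<lambda>z. w i z + (\<Sum>i\<in>A. w i z)) r = wsum (w i) r + wsum (\<lambda>z. \<Sum>i\<in>A. w i z) r"
    using insert by (intro wsum_add) auto
  ultimately show ?case using insert by simp
qed simp

lemma disc_finite_mord: "f \<noteq> 0 \<Longrightarrow> disc_finite (\<lambda>z. mord f z)"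
  using finite_zeros_poles by (simp add: disc_finite_def)

lemma disc_finite_ord_minus: "disc_finite (\<lambda>z. ord_minus f z)"
proof (cases "f = 0")
  case True
  thus ?thesis by (simp add: ord_minus_def)
next
  case False
  show ?thesis
    by (rule disc_finite_subset[OF disc_finite_mord[OF False]]) (simp add: ord_minus_def)
qed

lemma log_sum_wsum: "log_sum f = wsum (\<lambda>z. mord f z)"
  by (simp add: fun_eq_iff log_sum_def wsum_def)

lemma counting_fun_wsum: "r > 0 \<Longrightarrow> counting_fun f r = wsum (\<lambda>z. ord_minus f z) r"
  by (simp add: counting_fun_def wsum_def norm_divide)

lemma counting_fun_nonneg: "r \<ge> 1 \<Longrightarrow> counting_fun f r \<ge> 0"
proof -
  assume r: "r \<ge> 1"
  have "wsum (\<lambda>_. 0) r \<le> wsum (\<lambda>z. ord_minus f z) r"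
    by (rule wsum_mono[OF wsum_0(2) disc_finite_ord_minus _ r]) (simp add: ord_minus_def)
  thus ?thesis using r by (simp add: counting_fun_wsum)
qed

section \<open>The second main theorem\<close>

lemma mero_const_uminus: "mero_const (- a) = - mero_const a"
proof -
  have "mero_const (- a) + mero_const a = 0" by (simp flip: mero_const_add)
  thus ?thesis by (simp add: eq_neg_iff_add_eq_0)
qed

text \<open>Two ultrametric estimates, for \<open>f - a\<close> and for
  \<open>f = (f - a) + a\<close>, where a nonzero constant has order 0.\<close>

lemma mord_minus_const_pole:
  assumes "mord f z < 0" "f - mero_const a \<noteq> 0" "f \<noteq> 0"
  shows "mord (f - mero_const a) z = mord f z"
proof (cases "a = 0")
  case False
  let ?h = "f - mero_const a"
  have "mord (f + mero_const (-a)) z \<ge> mord f z"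
  proof (intro mord_add_ge)
    show "mero_const (-a) \<noteq> 0" using False by simp
    show "f + mero_const (-a) \<noteq> 0" using assms by (simp add: mero_const_uminus)
    show "mord f z \<le> mord (mero_const (-a)) z" using assms False by simp
  qed (use assms in auto)
  moreover have "mord (?h + mero_const a) z \<ge> min (mord ?h z) 0"
    using assms False by (intro mord_add_ge) auto
  ultimately show ?thesis using assms by (simp add: mero_const_uminus)
qed simp

lemma mord_minus_const_ge:
  assumes "f - mero_const a \<noteq> 0" "f \<noteq> 0"
  shows "mord (f - mero_const a) z \<ge> - ord_minus f z"
proof (cases "mord f z < 0")
  case True
  thus ?thesis using mord_minus_const_pole[OF True assms] assms by (simp add: ord_minus_def)
next
  case False
  hence "\<not> mpole (f - mero_const a) z"
    using mero_eval_diff(1)[of f z "mero_const a"] mpole_iff[of f z] by simp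
  thus ?thesis using assms False mpole_iff[of "f - mero_const a" z] by (simp add: ord_minus_def)
qed

text \<open>The local count for \<open>f' / \<Prod>(f - a)\<close>, with \<open>q = card A\<close>.
  At a pole of order \<open>n\<close> the right side is
  \<open>(q - 1) * n - 1 \<ge> (q - 2) * n\<close>; at a point where \<open>f\<close> takes a value
  in \<open>A\<close>, necessarily just one, differentiation costs exactly 1; elsewhere
  \<open>f'\<close> has no pole and the product no zero.\<close>

lemma mord_log_derivative_ge:
  assumes nonconst: "f \<notin> range mero_const" and A: "finite A" "card A \<ge> 2"
  shows "int (card A - 2) * ord_minus f z - (\<Sum>a\<in>A. of_bool (mord (f - mero_const a) z > 0))
    \<le> mord (mero_deriv f) z - (\<Sum>a\<in>A. mord (f - mero_const a) z)"
proof -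
  have f0: "f \<noteq> 0" using nonconst by (metis mero_const_0 rangeI)
  have h0: "f - mero_const a \<noteq> 0" for a using nonconst by auto
  have df0: "mero_deriv f \<noteq> 0" by (rule mero_deriv_nonzero[OF nonconst])
  show ?thesis
  proof (cases "mord f z < 0")
    case True
    hence "mord (mero_deriv f) z = mord f z - 1" using mord_deriv[OF f0, of z] by simp
    moreover have "mord (f - mero_const a) z = mord f z" for a
      by (rule mord_minus_const_pole[OF True h0 f0])
    moreover have "int (card A - 2) = int (card A) - 2" using A by simp
    ultimately show ?thesis using True f0 by (simp add: ord_minus_def algebra_simps)
  next
    case False
    hence np: "\<not> mpole f z" using mpole_iff by blast
    have om: "ord_minus f z = 0" using False by (simp add: ord_minus_def)
    have nph: "\<not> mpole (f - mero_const a) z" "mero_eval (f - mero_const a) z = mero_eval f z - a" for a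
      using mero_eval_diff[of f z "mero_const a"] np by auto
    have ge: "mord (f - mero_const a) z \<ge> 0" for a
      using nph(1) mpole_iff[of "f - mero_const a" z] h0[of a] by force
    have pos_iff: "mord (f - mero_const a) z > 0 \<longleftrightarrow> mero_eval f z = a" for a
      using mero_zero_iff[OF nph(1)[of a]] h0[of a] nph(2)[of a] by auto
    have dge: "mord (mero_deriv f) z \<ge> 0"
      using mero_deriv_eval(1)[OF np] mpole_iff[of "mero_deriv f" z] df0 by force
    show ?thesis
    proof (cases "mero_eval f z \<in> A")
      case True
      define a where "a = mero_eval f z"
      have "mord (f - mero_const b) z = 0" if "b \<noteq> a" for b
        using pos_iff[of b] ge[of b] that by (auto simp: a_def)
      hence "(\<Sum>b\<in>A. mord (f - mero_const b) z) = (\<Sum>b\<in>A. if b = a then mord (f - mero_const a) z else 0)"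
        by (intro sum.cong) auto
      also have "\<dots> = mord (f - mero_const a) z" using A True by (simp add: a_def)
      finally have 1: "(\<Sum>b\<in>A. mord (f - mero_const b) z) = mord (f - mero_const a) z" .
      have "(\<Sum>b\<in>A. of_bool (mord (f - mero_const b) z > 0)) = (\<Sum>b\<in>A. if b = a then 1 else (0 :: int))"
        by (intro sum.cong) (auto simp: pos_iff a_def)
      also have "\<dots> = 1" using A True by (simp add: a_def)
      finally have 2: "(\<Sum>b\<in>A. of_bool (mord (f - mero_const b) z > 0)) = (1 :: int)" .
      have "mord (f - mero_const a) z > 0" by (simp add: pos_iff a_def)
      hence "mord (mero_deriv f) z = mord (f - mero_const a) z - 1"
        using mord_deriv[OF h0[of a], of z] by (simp add: mero_deriv_diff_const)
      thus ?thesis unfolding 1 2 om by simp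
    next
      case False
      hence "mord (f - mero_const b) z = 0" if "b \<in> A" for b
        using pos_iff[of b] ge[of b] that by force
      thus ?thesis using dge om by simp
    qed
  qed
qed

text \<open>A form of the first main theorem: up to constants the integrand is at most
  \<open>2 * log_plus (norm f) - 2 * ln (norm (f - a))\<close>, and by Jensen's formula the mean of
  the last logarithm is at least \<open>- counting_fun f r\<close> plus a constant. The factor 2 and
  the square are those of \<open>dyadic_bound\<close> with
  \<open>t = norm (f - a) ^ 2\<close>.\<close>

lemma log_plus_reciprocal_mean:
  assumes nonconst: "f \<notin> range mero_const"
  shows "\<exists>C. \<forall>r\<ge>1. regular_radius f r \<longrightarrow> regular_radius (f - mero_const a) r \<longrightarrow>
     circ_mean (\<lambda>z. log_plus (norm (2 / (mero_eval f z - a) ^ 2))) r \<le> 2 * nevanlinna_char f r + C"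
proof -
  define h where "h = f - mero_const a"
  have f0: "f \<noteq> 0" using nonconst by (metis mero_const_0 rangeI)
  have h0: "h \<noteq> 0" using nonconst by (auto simp: h_def)
  obtain c where c: "\<forall>r>0. regular_radius h r \<longrightarrow> circ_mean (\<lambda>z. ln (norm (mero_eval h z))) r = log_sum h r + c"
    using jensen_log_sum[OF h0] by blast
  define L where "L = ln 2 + 2 * ln (1 + norm a)"
  have main: "circ_mean (\<lambda>z. log_plus (norm (2 / (mero_eval f z - a) ^ 2))) r \<le> 2 * nevanlinna_char f r + (L - 2 * c)"
    if r: "r \<ge> 1" and rf: "regular_radius f r" and rh: "regular_radius h r" for r
  proof -
    have ev: "mero_eval h z = mero_eval f z - a" "mero_eval f z - a \<noteq> 0" if "norm z = r" for z
      using regular_radiusD[OF rf f0 that] regular_radiusD[OF rh h0 that] mero_eval_diff(2)[of f z "mero_const a"]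
      by (auto simp: h_def)
    have cf: "continuous_on (sphere 0 r) (\<lambda>z. log_plus (norm (mero_eval f z)))"
      by (intro continuous_on_log_plus regular_radius_continuous rf f0)
    have ch: "continuous_on (sphere 0 r) (\<lambda>z. ln (norm (mero_eval h z)))"
      by (rule regular_radius_continuous_log[OF rh h0])
    have "continuous_on (sphere 0 r) (\<lambda>z. 2 / (mero_eval f z - a) ^ 2)"
      by (intro continuous_on_divide continuous_on_power continuous_on_diff continuous_on_const
          regular_radius_continuous[OF rf f0]) (use ev in auto)
    hence cl: "continuous_on (sphere 0 r) (\<lambda>z. log_plus (norm (2 / (mero_eval f z - a) ^ 2)))"
      by (rule continuous_on_log_plus)
    have cc: "continuous_on (sphere 0 r) (\<lambda>z. 2 * log_plus (norm (mero_eval f z)))"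
       "continuous_on (sphere 0 r) (\<lambda>z. (-2) * ln (norm (mero_eval h z)))"
      by (intro continuous_on_mult continuous_on_const cf ch)+
    have "circ_mean (\<lambda>z. log_plus (norm (2 / (mero_eval f z - a) ^ 2))) r \<le>
       circ_mean (\<lambda>z. (2 * log_plus (norm (mero_eval f z)) + (-2) * ln (norm (mero_eval h z))) + L) r"
    proof (rule circ_mean_mono[OF cl])
      show "continuous_on (sphere 0 r) (\<lambda>z. (2 * log_plus (norm (mero_eval f z)) + (-2) * ln (norm (mero_eval h z))) + L)"
        by (intro continuous_on_add cc continuous_on_const)
      fix z :: complex assume z: "norm z = r"
      define x where "x = norm (mero_eval f z - a)"
      \<comment> \<open>\<open>y\<close> dominates both 1 and \<open>x\<close>, so
        \<open>2 * (y / x) ^ 2\<close> dominates \<open>max 1 (2 / x ^ 2)\<close> and splits under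
        \<open>ln\<close>.\<close>
      define y where "y = (1 + norm a) * max 1 (norm (mero_eval f z))"
      have x: "x > 0" using ev[OF z] by (simp add: x_def)
      have y1: "y \<ge> 1" unfolding y_def by (rule order_trans[OF _ mult_mono[of 1 _ 1]]) auto
      have "x \<le> norm (mero_eval f z) + norm a" by (simp add: x_def norm_triangle_ineq4)
      also have "\<dots> \<le> max 1 (norm (mero_eval f z)) + norm a * max 1 (norm (mero_eval f z))"
        using mult_left_mono[of 1 "max 1 (norm (mero_eval f z))" "norm a"] by (intro add_mono) auto
      finally have xy: "x \<le> y" by (simp add: y_def algebra_simps)
      have "max 1 (2 / x ^ 2) \<le> 2 * (y / x) ^ 2"
      proof (rule max.boundedI)
        have "1 \<le> (y / x) ^ 2" using x xy by (intro one_le_power) simp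
        thus "1 \<le> 2 * (y / x) ^ 2" by simp
        have "1 \<le> y ^ 2" using y1 by (rule one_le_power)
        thus "2 / x ^ 2 \<le> 2 * (y / x) ^ 2" using x by (simp add: field_simps)
      qed
      hence "ln (max 1 (2 / x ^ 2)) \<le> ln (2 * (y / x) ^ 2)"
        by (rule ln_mono) simp
      hence "log_plus (2 / x ^ 2) \<le> ln (2 * (y / x) ^ 2)"
        by (simp add: log_plus_alt)
      also have "\<dots> = ln 2 + 2 * (ln y - ln x)"
        using x y1 by (simp add: ln_mult ln_realpow ln_div)
      also have "ln y = ln (1 + norm a) + log_plus (norm (mero_eval f z))"
      proof -
        have "1 + norm a > 0" by (simp add: add_pos_nonneg)
        thus ?thesis by (simp add: y_def ln_mult log_plus_alt)
      qed
      finally show "log_plus (norm (2 / (mero_eval f z - a) ^ 2)) \<le> (2 * log_plus (norm (mero_eval f z)) + (-2) * ln (norm (mero_eval h z))) + L"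
        using ev(1)[OF z] by (simp add: x_def L_def norm_divide norm_power)
    qed (use r in auto)
    also have "\<dots> = 2 * proximity_fun f r + (-2) * (log_sum h r + c) + L"
    proof -
      have r0: "r \<ge> 0" using r by simp
      have "circ_mean (\<lambda>z. ln (norm (mero_eval h z))) r = log_sum h r + c" using c rh r by simp
      thus ?thesis
        by (simp only: circ_mean_add[OF continuous_on_add[OF cc] continuous_on_const r0]
            circ_mean_add[OF cc r0] circ_mean_cmult circ_mean_const proximity_fun_circ_mean)
    qed
    finally have "circ_mean (\<lambda>z. log_plus (norm (2 / (mero_eval f z - a) ^ 2))) r
       \<le> 2 * proximity_fun f r + (-2) * (log_sum h r + c) + L" .
    moreover have "log_sum h r \<ge> - counting_fun f r"
    proof -
      have "wsum (\<lambda>z. (-1) * ord_minus f z) r \<le> wsum (\<lambda>z. mord h z) r"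
        using mord_minus_const_ge[of f a] h0 f0 r
        by (intro wsum_mono disc_finite_mord disc_finite_cmult disc_finite_ord_minus) (auto simp: h_def)
      thus ?thesis
        using r by (simp add: wsum_cmult[OF disc_finite_ord_minus, of "-1", simplified] log_sum_wsum counting_fun_wsum)
    qed
    ultimately show ?thesis by (simp add: nevanlinna_char_def)
  qed
  thus ?thesis by (auto simp: h_def)
qed

text \<open>Let \<open>a0\<close> be the point of \<open>A\<close> nearest to \<open>w\<close>.
  Every other factor is at least a constant times \<open>1 + norm w ^ 2\<close>, so these
  \<open>card A - 1\<close> factors cancel the numerator and leave one power of
  \<open>1 + norm w ^ 2\<close> below, which is compared with
  \<open>1 + norm (w - a0) ^ 2\<close>.\<close>

lemma partial_fraction_bound:
  fixes A :: "complex set"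
  assumes A: "finite A" "card A \<ge> 2"
  shows "\<exists>C>0. \<forall>w. w \<notin> A \<longrightarrow> (1 + norm w ^ 2) ^ (card A - 2) / (\<Prod>a\<in>A. norm (w - a) ^ 2)
     \<le> C * (\<Sum>a\<in>A. 1 / (norm (w - a) ^ 2 * (1 + norm (w - a) ^ 2)))"
proof -
  define M where "M = (\<Sum>a\<in>A. norm a)"
  have M: "norm a \<le> M" if "a \<in> A" for a
    unfolding M_def using A that by (intro member_le_sum) auto
  obtain d where d: "d > 0" "\<And>a b. a \<in> A \<Longrightarrow> b \<in> A \<Longrightarrow> a \<noteq> b \<Longrightarrow> norm (a - b) \<ge> d"
  proof -
    define D where "D = insert 1 ((\<lambda>(a, b). norm (a - b)) ` {p \<in> A \<times> A. fst p \<noteq> snd p})"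
    have D: "finite D" "D \<noteq> {}" unfolding D_def using A by auto
    have "Min D > 0" using D by (subst Min_gr_iff) (auto simp: D_def)
    moreover have "Min D \<le> norm (a - b)" if "a \<in> A" "b \<in> A" "a \<noteq> b" for a b
      using D that by (intro Min_le) (auto simp: D_def image_iff intro!: bexI[of _ "(a, b)"])
    ultimately show ?thesis using that by blast
  qed
  \<comment> \<open>For a point \<open>b\<close> that is not the nearest,
    \<open>d ^ 2 \<le> 4 * t b\<close>, so the constant in
    \<open>n \<le> 2 * t b + (1 + 2 * M ^ 2)\<close> is absorbed into a multiple of
    \<open>t b\<close>; \<open>K\<close> is the resulting factor.\<close>
  define K where "K = 2 + 4 * (1 + 2 * M ^ 2) / d ^ 2"
  have K: "K > 0" using d(1) by (auto simp: K_def intro!: add_pos_nonneg divide_nonneg_pos)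
  define C where "C = K ^ (card A - 1) * (2 + 2 * M ^ 2)"
  have C: "C > 0" using K by (simp add: C_def add_pos_nonneg)
  have "(1 + norm w ^ 2) ^ (card A - 2) / (\<Prod>a\<in>A. norm (w - a) ^ 2)
     \<le> C * (\<Sum>a\<in>A. 1 / (norm (w - a) ^ 2 * (1 + norm (w - a) ^ 2)))" if w: "w \<notin> A" for w
  proof -
    define n where "n = 1 + norm w ^ 2"
    define t where "t = (\<lambda>a. norm (w - a) ^ 2)"
    have n: "n > 0" by (simp add: n_def add_pos_nonneg)
    have t: "t a > 0" if "a \<in> A" for a using that w by (auto simp: t_def)
    have sq: "norm (x + y) ^ 2 \<le> 2 * norm x ^ 2 + 2 * norm y ^ 2" for x y :: complex
    proof -
      have "norm (x + y) ^ 2 \<le> (norm x + norm y) ^ 2" by (intro power_mono norm_triangle_ineq) auto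
      also have "\<dots> \<le> 2 * norm x ^ 2 + 2 * norm y ^ 2"
        using sum_squares_bound[of "norm x" "norm y"] by (simp add: power2_sum)
      finally show ?thesis .
    qed
    have M2: "norm a ^ 2 \<le> M ^ 2" if "a \<in> A" for a using M[OF that] by (intro power_mono) auto
    have nK: "n \<le> K * t b" if "a \<in> A" "b \<in> A" "a \<noteq> b" "t a \<le> t b" for a b
    proof -
      have "d ^ 2 \<le> norm (a - b) ^ 2" using d that by (intro power_mono) auto
      also have "\<dots> \<le> 2 * t b + 2 * t a"
        using sq[of "w - b" "-(w - a)"] unfolding t_def norm_minus_cancel by simp
      also have "\<dots> \<le> 4 * t b" using that by simp
      finally have d2: "1 \<le> 4 * t b / d ^ 2" using d(1) by (simp add: field_simps)
      have "norm w ^ 2 \<le> 2 * t b + 2 * norm b ^ 2"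
        using sq[of "w - b" b] by (simp add: t_def)
      hence "n \<le> 2 * t b + (1 + 2 * M ^ 2) * 1"
        using M2[OF that(2)] by (simp add: n_def)
      also have "\<dots> \<le> 2 * t b + (1 + 2 * M ^ 2) * (4 * t b / d ^ 2)"
        using d2 by (intro add_left_mono mult_left_mono) auto
      also have "\<dots> = K * t b" by (simp add: K_def algebra_simps)
      finally show ?thesis .
    qed
    have "A \<noteq> {}" using A by auto
    obtain a0 where a0: "a0 \<in> A" "\<And>b. b \<in> A \<Longrightarrow> t a0 \<le> t b"
      using arg_min_if_finite[OF A(1) \<open>A \<noteq> {}\<close>, of t] by (metis not_less)
    have "(\<Prod>b\<in>A - {a0}. n / K) \<le> (\<Prod>b\<in>A - {a0}. t b)"
      using nK[OF a0(1)] a0 n K by (intro prod_mono) (auto simp: field_simps)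
    hence prod: "(n / K) ^ (card A - 1) \<le> (\<Prod>b\<in>A - {a0}. t b)"
      using a0 A by simp
    have t1: "1 + t a0 \<le> (2 + 2 * M ^ 2) * n"
    proof -
      have "t a0 \<le> 2 * norm w ^ 2 + 2 * M ^ 2"
        using sq[of w "- a0"] M2[OF a0(1)] by (simp add: t_def)
      moreover have "0 \<le> M ^ 2 * norm w ^ 2" by simp
      moreover have "(2 + 2 * M ^ 2) * n = 2 + 2 * M ^ 2 + 2 * norm w ^ 2 + 2 * (M ^ 2 * norm w ^ 2)"
        by (simp add: n_def algebra_simps)
      ultimately show ?thesis by linarith
    qed
    have "n ^ (card A - 2) / (\<Prod>a\<in>A. t a) = n ^ (card A - 2) / (t a0 * (\<Prod>b\<in>A - {a0}. t b))"
      using A a0 by (simp add: prod.remove)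
    also have "\<dots> \<le> n ^ (card A - 2) / (t a0 * (n / K) ^ (card A - 1))"
      using prod n K t[OF a0(1)] by (intro divide_left_mono mult_left_mono mult_pos_pos) (auto intro!: prod_pos t)
    also have "\<dots> = K ^ (card A - 1) / (t a0 * n)"
    proof -
      have "card A - 1 = Suc (card A - 2)" using A by simp
      thus ?thesis using n K by (simp add: power_divide field_simps)
    qed
    also have "\<dots> \<le> K ^ (card A - 1) * ((2 + 2 * M ^ 2) / (t a0 * (1 + t a0)))"
    proof -
      have "1 / n \<le> (2 + 2 * M ^ 2) / (1 + t a0)"
        using t1 n t[OF a0(1)] by (simp add: field_simps)
      hence "1 / n / t a0 \<le> (2 + 2 * M ^ 2) / (1 + t a0) / t a0"
        using t[OF a0(1)] by (intro divide_right_mono) auto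
      hence "K ^ (card A - 1) * (1 / n / t a0) \<le> K ^ (card A - 1) * ((2 + 2 * M ^ 2) / (1 + t a0) / t a0)"
        using K by (intro mult_left_mono) auto
      thus ?thesis by (simp add: mult.commute)
    qed
    also have "\<dots> = C * (1 / (t a0 * (1 + t a0)))" by (simp add: C_def)
    also have "\<dots> \<le> C * (\<Sum>a\<in>A. 1 / (t a * (1 + t a)))"
      using C a0 A t by (intro mult_left_mono member_le_sum) (auto intro!: less_imp_le mult_pos_pos add_pos_pos)
    finally show ?thesis by (simp add: n_def t_def)
  qed
  thus ?thesis using C by blast
qed

text \<open>One summand suffices. For \<open>t < 1\<close> it is the least \<open>k\<close> with
  \<open>(1/2) ^ k \<le> t\<close>: then \<open>(1/2) ^ k\<close> lies between \<open>t / 2\<close>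
  and \<open>t\<close>, the fraction is at least \<open>1 / (8 * t)\<close>, and the weight
  \<open>b ^ (4 * k) = (2 ^ k) powr \<delta>\<close> is at most
  \<open>(2 / t) powr \<delta>\<close>. Of the four factors \<open>b ^ k\<close>, three will absorb
  the loss in \<open>curvature_bound\<close> and the fourth makes the series converge.\<close>

lemma dyadic_bound:
  fixes t \<delta> :: real
  assumes t: "t > 0" and \<delta>: "\<delta> > 0" and K: "(1/2) ^ K \<le> t"
  defines "b \<equiv> 2 powr (\<delta> / 4)"
  shows "1 / (t * (1 + t)) \<le> 8 * max 1 (2 / t) powr \<delta> * (\<Sum>k\<le>K. 1 / b ^ (4 * k) * ((1/2) ^ k / (t + (1/2) ^ k) ^ 2))"
proof -
  have b: "b > 0" by (simp add: b_def)
  have b4: "b ^ (4 * k) = (2 ^ k) powr \<delta>" for k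
  proof -
    have "b ^ (4 * k) = b powr (real (4 * k))" by (rule powr_realpow[OF b, symmetric])
    also have "\<dots> = 2 powr (real k * \<delta>)" by (simp add: b_def powr_powr algebra_simps)
    also have "\<dots> = (2 ^ k) powr \<delta>" by (simp add: powr_powr[symmetric] powr_realpow)
    finally show ?thesis .
  qed
  define u where "u = (\<lambda>k::nat. 1 / b ^ (4 * k) * ((1/2) ^ k / (t + (1/2) ^ k) ^ 2))"
  have u: "u k \<ge> 0" for k using b by (simp add: u_def)
  obtain k where k: "k \<le> K" "1 / (t * (1 + t)) \<le> 8 * max 1 (2 / t) powr \<delta> * u k"
  proof (cases "t \<ge> 1")
    case True
    have "1 \<le> max 1 (2 / t) powr \<delta>" using \<delta> by (intro ge_one_powr_ge_zero) auto
    moreover have "1 / (t * (1 + t)) \<le> 8 * u 0"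
    proof -
      have "1 / (t * (1 + t)) = ((t + 1) / t) / (t + 1) ^ 2"
        using True by (simp add: power2_eq_square)
      also have "\<dots> \<le> 8 / (t + 1) ^ 2"
        using True by (intro divide_right_mono) (auto simp: field_simps)
      finally show ?thesis by (simp add: u_def)
    qed
    ultimately have "1 / (t * (1 + t)) \<le> 8 * max 1 (2 / t) powr \<delta> * u 0"
      using mult_right_mono[of 1 "max 1 (2 / t) powr \<delta>" "8 * u 0"] u[of 0] by (simp add: algebra_simps)
    thus ?thesis using that[of 0] by simp
  next
    case False
    define k where "k = (LEAST k. (1/2) ^ k \<le> t)"
    have k1: "(1/2) ^ k \<le> t" unfolding k_def using K by (rule LeastI)
    have kK: "k \<le> K" unfolding k_def using K by (rule Least_le)
    have "k \<noteq> 0" using k1 False by (cases k) auto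
    then obtain j where j: "k = Suc j" by (cases k) auto
    have "\<not> (1/2) ^ j \<le> t" using not_less_Least[of j "\<lambda>k. (1/2) ^ k \<le> t"] j by (simp add: k_def)
    hence k2: "t / 2 \<le> (1/2) ^ k" by (simp add: j)
    define e where "e = (1/2 :: real) ^ k"
    have e: "0 < e" "e \<le> t" "t / 2 \<le> e" using k1 k2 by (auto simp: e_def)
    have "1 / (8 * t) = (t / 2) / (2 * t) ^ 2" using t by (simp add: power2_eq_square)
    also have "\<dots> \<le> e / (t + e) ^ 2"
      using e t by (intro frac_le power_mono) auto
    finally have 1: "1 / (8 * t) \<le> e / (t + e) ^ 2" .
    have "2 ^ k = 1 / e" by (simp add: e_def power_divide)
    also have "\<dots> \<le> 2 / t" using e t by (simp add: field_simps)
    finally have "b ^ (4 * k) \<le> max 1 (2 / t) powr \<delta>"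
      unfolding b4 using \<delta> by (intro powr_mono2) auto
    hence "1 \<le> max 1 (2 / t) powr \<delta> * (1 / b ^ (4 * k))" using b by (simp add: field_simps)
    from mult_mono[OF this 1] have "1 / (8 * t) \<le> max 1 (2 / t) powr \<delta> * u k"
      using t b by (simp add: u_def e_def mult.assoc)
    moreover have "1 / (t * (1 + t)) \<le> 1 / (t * 1)"
      using t by (intro divide_left_mono mult_left_mono) auto
    ultimately have "1 / (t * (1 + t)) \<le> 8 * max 1 (2 / t) powr \<delta> * u k" by simp
    thus ?thesis using that kK by blast
  qed
  have "u k \<le> (\<Sum>k\<le>K. u k)" using k u by (intro member_le_sum) auto
  hence "8 * max 1 (2 / t) powr \<delta> * u k \<le> 8 * max 1 (2 / t) powr \<delta> * (\<Sum>k\<le>K. u k)"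
    by (intro mult_left_mono) auto
  with k(2) show ?thesis by (simp add: u_def)
qed

text \<open>Exceptional sets are united and the largest constant is taken; enlarging
  \<open>C\<close> keeps the bounds valid since the base of the fourth power is at least 1.\<close>

lemma curvature_bound_uniform:
  assumes nonconst: "f \<notin> range mero_const" and b: "b > 1" and A: "finite A"
  shows "\<exists>E\<in>sets lborel. emeasure lborel E < \<infinity> \<and> (\<exists>C s0. s0 \<ge> 0 \<and> (\<forall>s\<ge>s0. s \<notin> E \<longrightarrow> regular_radius f (exp s) \<longrightarrow>
     2 * nevanlinna_char f (exp s) + C \<ge> 1 \<and>
     (\<forall>a\<in>A. \<forall>k. curv f a ((1/2) ^ k) (exp s) \<le> b ^ (3 * k) * (2 * nevanlinna_char f (exp s) + C) ^ 4)))"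
  using A
proof (induction A rule: finite_induct)
  case empty
  obtain E C s0 where "E \<in> sets lborel" "emeasure lborel E < \<infinity>" "s0 \<ge> 0"
    "\<And>s. s \<ge> s0 \<Longrightarrow> s \<notin> E \<Longrightarrow> regular_radius f (exp s) \<Longrightarrow> 2 * nevanlinna_char f (exp s) + C \<ge> 1"
    using curvature_bound[OF nonconst b, of 0] by blast
  thus ?case by auto
next
  case (insert a A)
  obtain E1 C1 s1 where E1: "E1 \<in> sets lborel" "emeasure lborel E1 < \<infinity>" "s1 \<ge> 0"
    "\<And>s. s \<ge> s1 \<Longrightarrow> s \<notin> E1 \<Longrightarrow> regular_radius f (exp s) \<Longrightarrow> 2 * nevanlinna_char f (exp s) + C1 \<ge> 1"
    "\<And>s a k. s \<ge> s1 \<Longrightarrow> s \<notin> E1 \<Longrightarrow> regular_radius f (exp s) \<Longrightarrow> a \<in> A \<Longrightarrow>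
       curv f a ((1/2) ^ k) (exp s) \<le> b ^ (3 * k) * (2 * nevanlinna_char f (exp s) + C1) ^ 4"
    using insert.IH by blast
  obtain E2 C2 s2 where E2: "E2 \<in> sets lborel" "emeasure lborel E2 < \<infinity>" "s2 \<ge> 0"
    "\<And>s. s \<ge> s2 \<Longrightarrow> s \<notin> E2 \<Longrightarrow> regular_radius f (exp s) \<Longrightarrow> 2 * nevanlinna_char f (exp s) + C2 \<ge> 1"
    "\<And>s k. s \<ge> s2 \<Longrightarrow> s \<notin> E2 \<Longrightarrow> regular_radius f (exp s) \<Longrightarrow>
       curv f a ((1/2) ^ k) (exp s) \<le> b ^ (3 * k) * (2 * nevanlinna_char f (exp s) + C2) ^ 4"
    using curvature_bound[OF nonconst b, of a] by blast
  have fin: "emeasure lborel (E1 \<union> E2) < \<infinity>"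
    using emeasure_subadditive[OF E1(1) E2(1)] E1(2) E2(2)
    by (metis ennreal_add_less_top infinity_ennreal_def order_le_less_trans)
  define C where "C = max C1 C2"
  have mono: "b ^ (3 * k) * (2 * T + D) ^ 4 \<le> b ^ (3 * k) * (2 * T + C) ^ 4" if "2 * T + D \<ge> 1" "D \<le> C" for T D k
    using b that by (intro mult_left_mono power_mono) auto
  have H: "1 \<le> 2 * nevanlinna_char f (exp s) + C \<and> (\<forall>a'\<in>insert a A. \<forall>k.
      curv f a' ((1/2) ^ k) (exp s) \<le> b ^ (3 * k) * (2 * nevanlinna_char f (exp s) + C) ^ 4)"
    if s: "max s1 s2 \<le> s" "s \<notin> E1 \<union> E2" "regular_radius f (exp s)" for s
  proof (intro conjI ballI allI)
    show "1 \<le> 2 * nevanlinna_char f (exp s) + C" using E1(4)[of s] s by (simp add: C_def)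
  next
    fix a' k assume "a' \<in> insert a A"
    then consider "a' \<in> A" | "a' = a" by blast
    thus "curv f a' ((1/2) ^ k) (exp s) \<le> b ^ (3 * k) * (2 * nevanlinna_char f (exp s) + C) ^ 4"
    proof cases
      case 1
      thus ?thesis
        using E1(5)[of s a' k] E1(4)[of s] s
          mono[of "nevanlinna_char f (exp s)" C1 k]
        by (simp add: C_def)
    next
      case 2
      thus ?thesis
        using E2(5)[of s k] E2(4)[of s] s
          mono[of "nevanlinna_char f (exp s)" C2 k]
        by (simp add: C_def)
    qed
  qed
  have "\<exists>C s0. s0 \<ge> 0 \<and> (\<forall>s\<ge>s0. s \<notin> E1 \<union> E2 \<longrightarrow> regular_radius f (exp s) \<longrightarrow>
     2 * nevanlinna_char f (exp s) + C \<ge> 1 \<and>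
     (\<forall>a\<in>insert a A. \<forall>k. curv f a ((1/2) ^ k) (exp s) \<le> b ^ (3 * k) * (2 * nevanlinna_char f (exp s) + C) ^ 4))"
    by (rule exI[of _ C], rule exI[of _ "max s1 s2"]) (use H E1(3) in auto)
  thus ?case using E1(1) E2(1) fin by (intro bexI[of _ "E1 \<union> E2"] conjI) auto
qed

text \<open>Here \<open>w\<close> and \<open>D\<close> stand for \<open>f z\<close> and the modulus
  of \<open>f' z\<close>. Taking logarithms in the partial fraction estimate yields the left side;
  the factors \<open>X a\<close> of the dyadic estimate, all at least 1, are bounded by their
  product and become the terms with \<open>\<delta>\<close>.\<close>

lemma log_derivative_pointwise:
  fixes A :: "complex set" and w :: complex and D :: real
  assumes A: "finite A" "card A \<ge> 2" and w: "w \<notin> A" and D: "D > 0" and \<delta>: "\<delta> > 0"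
    and K: "\<And>a. a \<in> A \<Longrightarrow> (1/2) ^ K \<le> norm (w - a) ^ 2"
    and C: "C > 0" "(1 + norm w ^ 2) ^ (card A - 2) / (\<Prod>a\<in>A. norm (w - a) ^ 2)
     \<le> C * (\<Sum>a\<in>A. 1 / (norm (w - a) ^ 2 * (1 + norm (w - a) ^ 2)))"
  defines "b \<equiv> 2 powr (\<delta> / 4)"
  shows "2 * ln D - (\<Sum>a\<in>A. 2 * ln (norm (w - a))) + 2 * real (card A - 2) * log_plus (norm w)
    \<le> ln (8 * C) + (\<Sum>a\<in>A. \<delta> * log_plus (norm (2 / (w - a) ^ 2)))
       + ln (\<Sum>a\<in>A. \<Sum>k\<le>K. 1 / b ^ (4 * k) * ((1/2) ^ k * D ^ 2 / (norm (w - a) ^ 2 + (1/2) ^ k) ^ 2))"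
proof -
  define t where "t = (\<lambda>a. norm (w - a) ^ 2)"
  define n where "n = 1 + norm w ^ 2"
  define X where "X = (\<lambda>a. max 1 (2 / t a) powr \<delta>)"
  define S where "S = (\<lambda>a. \<Sum>k\<le>K. 1 / b ^ (4 * k) * ((1/2) ^ k / (t a + (1/2) ^ k) ^ 2))"
  have b: "b > 0" by (simp add: b_def)
  have t: "t a > 0" if "a \<in> A" for a using that w by (auto simp: t_def)
  have n: "n > 0" by (simp add: n_def add_pos_nonneg)
  have X1: "X a \<ge> 1" for a unfolding X_def using \<delta> by (intro ge_one_powr_ge_zero) auto
  have S: "S a > 0" if "a \<in> A" for a
  proof -
    have "t a + (1/2) ^ k \<noteq> 0" for k
      using t[OF that] zero_less_power[of "1/2 :: real" k] by linarith
    thus ?thesis unfolding S_def using b by (intro sum_pos) auto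
  qed
  have "A \<noteq> {}" using A by auto
  have sumS: "(\<Sum>a\<in>A. S a) > 0" using A \<open>A \<noteq> {}\<close> S by (intro sum_pos) auto
  have Pt: "(\<Prod>a\<in>A. t a) > 0" using t by (intro prod_pos) auto
  have PX: "(\<Prod>a\<in>A. X a) > 0" using X1 by (intro prod_pos) (auto intro: less_le_trans[OF zero_less_one])
  have XP: "X a \<le> (\<Prod>a\<in>A. X a)" if "a \<in> A" for a
  proof -
    have "(\<Prod>b\<in>A - {a}. X b) \<ge> 1" using X1 by (intro prod_ge_1) auto
    hence "X a * 1 \<le> X a * (\<Prod>b\<in>A - {a}. X b)"
      using X1[of a] by (intro mult_left_mono) auto
    thus ?thesis using that A by (simp add: prod.remove)
  qed
  have "n ^ (card A - 2) / (\<Prod>a\<in>A. t a) \<le> C * (\<Sum>a\<in>A. 1 / (t a * (1 + t a)))"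
    using C by (simp add: n_def t_def)
  also have "\<dots> \<le> C * (\<Sum>a\<in>A. 8 * (\<Prod>a\<in>A. X a) * S a)"
  proof (intro mult_left_mono sum_mono)
    fix a assume a: "a \<in> A"
    have "1 / (t a * (1 + t a)) \<le> 8 * X a * S a"
      using dyadic_bound[OF t[OF a] \<delta>, of K] K[OF a] by (simp add: X_def S_def b_def t_def)
    also have "\<dots> \<le> 8 * (\<Prod>a\<in>A. X a) * S a"
      using XP[OF a] S[OF a] by (intro mult_right_mono mult_left_mono) auto
    finally show "1 / (t a * (1 + t a)) \<le> 8 * (\<Prod>a\<in>A. X a) * S a" .
  qed (use C in auto)
  also have "\<dots> = 8 * C * (\<Prod>a\<in>A. X a) * (\<Sum>a\<in>A. S a)"
    by (simp flip: sum_distrib_left)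
  finally have "n ^ (card A - 2) / (\<Prod>a\<in>A. t a) * D ^ 2 \<le> 8 * C * (\<Prod>a\<in>A. X a) * (\<Sum>a\<in>A. S a) * D ^ 2"
    using D by (intro mult_right_mono) auto
  hence "ln (n ^ (card A - 2) / (\<Prod>a\<in>A. t a) * D ^ 2) \<le> ln (8 * C * (\<Prod>a\<in>A. X a) * ((\<Sum>a\<in>A. S a) * D ^ 2))"
    using n Pt D by (intro ln_mono) (auto simp: mult.assoc)
  also have "\<dots> = ln (8 * C) + ln (\<Prod>a\<in>A. X a) + ln ((\<Sum>a\<in>A. S a) * D ^ 2)"
    using C PX sumS D by (simp add: ln_mult)
  also have "ln (\<Prod>a\<in>A. X a) = (\<Sum>a\<in>A. ln (X a))"
  proof -
    have "X a > 0" for a using X1[of a] by linarith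
    thus ?thesis using A by (intro ln_prod) (auto simp: less_imp_neq[symmetric])
  qed
  also have "\<dots> = (\<Sum>a\<in>A. \<delta> * log_plus (norm (2 / (w - a) ^ 2)))"
    by (intro sum.cong refl) (simp add: X_def log_plus_alt t_def ln_powr norm_divide norm_power)
  also have "(\<Sum>a\<in>A. S a) * D ^ 2 = (\<Sum>a\<in>A. \<Sum>k\<le>K. 1 / b ^ (4 * k) * ((1/2) ^ k * D ^ 2 / (norm (w - a) ^ 2 + (1/2) ^ k) ^ 2))"
    unfolding S_def t_def sum_distrib_right by (intro sum.cong refl) simp
  also have "ln (n ^ (card A - 2) / (\<Prod>a\<in>A. t a) * D ^ 2) = real (card A - 2) * ln n - ln (\<Prod>a\<in>A. t a) + 2 * ln D"
    using n Pt D by (simp add: ln_mult ln_div ln_realpow)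
  also have "ln (\<Prod>a\<in>A. t a) = (\<Sum>a\<in>A. ln (t a))"
    using less_imp_neq[OF t, symmetric] by (intro ln_prod A(1)) auto
  also have "\<dots> = (\<Sum>a\<in>A. 2 * ln (norm (w - a)))"
    using w by (intro sum.cong refl) (auto simp: t_def ln_realpow)
  finally have main: "real (card A - 2) * ln n - (\<Sum>a\<in>A. 2 * ln (norm (w - a))) + 2 * ln D \<le>
      ln (8 * C) + (\<Sum>a\<in>A. \<delta> * log_plus (norm (2 / (w - a) ^ 2))) +
      ln (\<Sum>a\<in>A. \<Sum>k\<le>K. 1 / b ^ (4 * k) * ((1/2) ^ k * D ^ 2 / (norm (w - a) ^ 2 + (1/2) ^ k) ^ 2))" .
  have "2 * log_plus (norm w) = ln (max 1 (norm w) ^ 2)" by (simp add: log_plus_alt ln_realpow)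
  also have "\<dots> \<le> ln n"
    by (intro ln_mono) (auto simp: n_def max_def)
  finally have "real (card A - 2) * (2 * log_plus (norm w)) \<le> real (card A - 2) * ln n"
    by (intro mult_left_mono) auto
  with main show ?thesis by (simp add: algebra_simps)
qed

text \<open>The truncated counting function: each \<open>a\<close>-point of \<open>f\<close> counts
  once, whatever its multiplicity.\<close>

definition reduced_counting :: "mero \<Rightarrow> complex \<Rightarrow> real \<Rightarrow> real" where
  "reduced_counting f a = wsum (\<lambda>z. of_bool (mord (f - mero_const a) z > 0))"

lemma disc_finite_reduced:
  assumes "f - mero_const a \<noteq> 0"
  shows "disc_finite (\<lambda>z. of_bool (mord (f - mero_const a) z > 0))"
  by (rule disc_finite_subset[OF disc_finite_mord[OF assms]]) simp

text \<open>This is \<open>mord_log_derivative_ge\<close> summed with logarithmic weights.\<close>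

lemma log_sum_derivative_ge:
  assumes nonconst: "f \<notin> range mero_const" and A: "finite A" "card A \<ge> 2" and r: "r \<ge> 1"
  shows "real (card A - 2) * counting_fun f r - (\<Sum>a\<in>A. reduced_counting f a r)
    \<le> log_sum (mero_deriv f) r - (\<Sum>a\<in>A. log_sum (f - mero_const a) r)"
proof -
  have h0: "f - mero_const a \<noteq> 0" for a using nonconst by auto
  note df0 = mero_deriv_nonzero[OF nonconst]
  define u where "u = (\<lambda>a z. (-1) * (of_bool (mord (f - mero_const a) z > 0) :: int))"
  define v where "v = (\<lambda>a z. (-1) * mord (f - mero_const a) z)"
  have u: "disc_finite (u a)" "wsum (u a) r = - reduced_counting f a r" for a
    unfolding u_def reduced_counting_def
    by (intro disc_finite_cmult disc_finite_reduced h0)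
       (subst wsum_cmult[OF disc_finite_reduced[OF h0]], simp)
  have v: "disc_finite (v a)" "wsum (v a) r = - log_sum (f - mero_const a) r" for a
    unfolding v_def log_sum_wsum
    by (intro disc_finite_cmult disc_finite_mord h0)
       (subst wsum_cmult[OF disc_finite_mord[OF h0]], simp)
  have su: "disc_finite (\<lambda>z. \<Sum>a\<in>A. u a z)" "wsum (\<lambda>z. \<Sum>a\<in>A. u a z) r = (\<Sum>a\<in>A. - reduced_counting f a r)"
    using wsum_sum[of A u] A(1) u by auto
  have sv: "disc_finite (\<lambda>z. \<Sum>a\<in>A. v a z)" "wsum (\<lambda>z. \<Sum>a\<in>A. v a z) r = (\<Sum>a\<in>A. - log_sum (f - mero_const a) r)"
    using wsum_sum[of A v] A(1) v by auto
  have om: "disc_finite (\<lambda>z. int (card A - 2) * ord_minus f z)"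
      "wsum (\<lambda>z. int (card A - 2) * ord_minus f z) r = real (card A - 2) * counting_fun f r"
    using r by (auto simp: disc_finite_cmult disc_finite_ord_minus wsum_cmult counting_fun_wsum)
  have "wsum (\<lambda>z. int (card A - 2) * ord_minus f z + (\<Sum>a\<in>A. u a z)) r \<le> wsum (\<lambda>z. mord (mero_deriv f) z + (\<Sum>a\<in>A. v a z)) r"
  proof (rule wsum_mono)
    show "int (card A - 2) * ord_minus f z + (\<Sum>a\<in>A. u a z) \<le> mord (mero_deriv f) z + (\<Sum>a\<in>A. v a z)" for z
      using mord_log_derivative_ge[OF nonconst A, of z] by (simp add: u_def v_def sum_negf)
  qed (intro disc_finite_add om su sv disc_finite_mord df0 r)+
  thus ?thesis
    by (simp add: wsum_add[OF om(1) su(1)] wsum_add[OF disc_finite_mord[OF df0] sv(1)] om su sv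
        log_sum_wsum[of "mero_deriv f", symmetric] sum_negf)
qed

text \<open>The pointwise estimate is averaged over a circle. Jensen's formula evaluates the left
  side, \<open>log_plus_reciprocal_mean\<close> bounds the terms with \<open>\<delta>\<close>, and
  concavity of \<open>ln\<close> together with the curvature bounds leaves \<open>ln\<close> of a
  fourth power of \<open>2 * T + C0\<close>, which is at most a small multiple of \<open>T\<close>
  plus a constant.\<close>

theorem second_main_theorem:
  assumes nonconst: "f \<notin> range mero_const" and A: "finite A" "card A \<ge> 2" and \<epsilon>: "\<epsilon> > 0"
  shows "\<exists>E\<in>sets lborel. emeasure lborel E < \<infinity> \<and> (\<exists>C s0. s0 \<ge> 0 \<and> (\<forall>s\<ge>s0. s \<notin> E \<longrightarrow>
      regular_radius f (exp s) \<longrightarrow> regular_radius (mero_deriv f) (exp s) \<longrightarrow>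
      (\<forall>a\<in>A. regular_radius (f - mero_const a) (exp s)) \<longrightarrow>
      (real (card A) - 2 - \<epsilon>) * nevanlinna_char f (exp s) \<le> (\<Sum>a\<in>A. reduced_counting f a (exp s)) + C))"
proof -
  have f0: "f \<noteq> 0" using nonconst by (metis mero_const_0 rangeI)
  have h0: "f - mero_const a \<noteq> 0" for a using nonconst by auto
  note df0 = mero_deriv_nonzero[OF nonconst]
  define q where "q = card A"
  have q: "q \<ge> 2" using A by (simp add: q_def)
  have "A \<noteq> {}" using A by auto
  \<comment> \<open>The \<open>q\<close> reciprocal terms contribute \<open>2 * \<delta> * T\<close>
    each and the logarithm of the fourth power \<open>8 * \<delta> * T\<close>; together
    \<open>2 * \<delta> * (q + 4) * T\<close>, which is to be
    \<open>2 * \<epsilon> * T\<close>.\<close>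
  define \<delta> where "\<delta> = \<epsilon> / (real q + 4)"
  have \<delta>: "\<delta> > 0" using \<epsilon> by (simp add: \<delta>_def)
  define b where "b = 2 powr (\<delta> / 4)"
  have b: "b > 1" using \<delta> by (simp add: b_def)
  obtain E C0 s0 where E: "E \<in> sets lborel" "emeasure lborel E < \<infinity>" and s0: "s0 \<ge> 0"
    and X1: "\<And>s. s \<ge> s0 \<Longrightarrow> s \<notin> E \<Longrightarrow> regular_radius f (exp s) \<Longrightarrow> 2 * nevanlinna_char f (exp s) + C0 \<ge> 1"
    and curv: "\<And>s a k. s \<ge> s0 \<Longrightarrow> s \<notin> E \<Longrightarrow> regular_radius f (exp s) \<Longrightarrow> a \<in> A \<Longrightarrow>
       curv f a ((1/2) ^ k) (exp s) \<le> b ^ (3 * k) * (2 * nevanlinna_char f (exp s) + C0) ^ 4"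
    using curvature_bound_uniform[OF nonconst b A(1)] by blast
  obtain C1 where C1: "C1 > 0" "\<And>w. w \<notin> A \<Longrightarrow> (1 + norm w ^ 2) ^ (card A - 2) / (\<Prod>a\<in>A. norm (w - a) ^ 2)
     \<le> C1 * (\<Sum>a\<in>A. 1 / (norm (w - a) ^ 2 * (1 + norm (w - a) ^ 2)))"
    using partial_fraction_bound[OF A] by blast
  obtain Cf where Cf: "\<And>a r. r \<ge> 1 \<Longrightarrow> regular_radius f r \<Longrightarrow> regular_radius (f - mero_const a) r \<Longrightarrow>
     circ_mean (\<lambda>z. log_plus (norm (2 / (mero_eval f z - a) ^ 2))) r \<le> 2 * nevanlinna_char f r + Cf a"
    using log_plus_reciprocal_mean[OF nonconst] by metis
  obtain c' where c': "\<And>r. r > 0 \<Longrightarrow> regular_radius (mero_deriv f) r \<Longrightarrow>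
      circ_mean (\<lambda>z. ln (norm (mero_eval (mero_deriv f) z))) r = log_sum (mero_deriv f) r + c'"
    using jensen_log_sum[OF df0] by blast
  obtain ch where ch: "\<And>a r. r > 0 \<Longrightarrow> regular_radius (f - mero_const a) r \<Longrightarrow>
      circ_mean (\<lambda>z. ln (norm (mero_eval (f - mero_const a) z))) r = log_sum (f - mero_const a) r + ch a"
    using jensen_log_sum[OF h0] by metis
  \<comment> \<open>The number of values times the sum of the geometric series with ratio
    \<open>1 / b\<close>.\<close>
  define G where "G = real q * (b / (b - 1))"
  have G: "G > 0" using q b by (simp add: G_def)
  define Ctot where "Ctot = ln (8 * C1) + \<delta> * (\<Sum>a\<in>A. Cf a) + ln G + 4 * (\<delta> * C0 - 1 - ln \<delta>) - 2 * c' + 2 * (\<Sum>a\<in>A. ch a)"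
  have main: "(real (card A) - 2 - \<epsilon>) * nevanlinna_char f (exp s) \<le> (\<Sum>a\<in>A. reduced_counting f a (exp s)) + Ctot / 2"
    if s: "s \<ge> s0" "s \<notin> E" and rf: "regular_radius f (exp s)" and rd: "regular_radius (mero_deriv f) (exp s)"
      and rh: "\<And>a. a \<in> A \<Longrightarrow> regular_radius (f - mero_const a) (exp s)" for s
  proof -
    define r where "r = exp s"
    define T where "T = nevanlinna_char f r"
    have r: "r \<ge> 1" "r > 0" "r \<ge> 0" using s s0 by (auto simp: r_def)
    note reg = rf[folded r_def] rd[folded r_def] rh[folded r_def]
    have evh: "mero_eval (f - mero_const a) z = mero_eval f z - a" if "norm z = r" for a z
      using regular_radiusD(1)[OF reg(1) f0 that] by (simp add: mero_eval_diff)
    have notA: "mero_eval f z \<notin> A" if "norm z = r" for z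
      using regular_radiusD(2)[OF reg(3) h0 that] evh[OF that] by fastforce
    have Dpos: "norm (mero_eval (mero_deriv f) z) > 0" if "norm z = r" for z
      using regular_radiusD(2)[OF reg(2) df0 that] by simp
    \<comment> \<open>On the compact circle \<open>f\<close> stays away from \<open>a\<close>, so
      finitely many dyadic scales suffice. \<open>K\<close> depends on the radius, but the bounds
      for the sums over \<open>k \<le> K\<close> do not.\<close>
    have "\<exists>K. \<forall>z. norm z = r \<longrightarrow> (1/2) ^ K \<le> norm (mero_eval f z - a) ^ 2" if a: "a \<in> A" for a
    proof -
      have "continuous_on (sphere 0 r) (\<lambda>z. norm (mero_eval f z - a) ^ 2)"
        by (intro continuous_on_power continuous_on_norm continuous_on_diff continuous_on_const regular_radius_continuous[OF reg(1) f0])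
      moreover have "complex_of_real r \<in> sphere 0 r" using r by simp
      ultimately obtain z0 where z0: "z0 \<in> sphere 0 r" "\<And>z. z \<in> sphere 0 r \<Longrightarrow> norm (mero_eval f z0 - a) ^ 2 \<le> norm (mero_eval f z - a) ^ 2"
        using continuous_attains_inf[OF compact_sphere, of 0 r "\<lambda>z. norm (mero_eval f z - a) ^ 2"] by blast
      have "norm (mero_eval f z0 - a) ^ 2 > 0" using notA[of z0] z0(1) a by auto
      then obtain K where "(1/2) ^ K < norm (mero_eval f z0 - a) ^ 2"
        using real_arch_pow_inv[of "norm (mero_eval f z0 - a) ^ 2" "1/2"] by auto
      thus ?thesis using z0(2) by (intro exI[of _ K]) (auto intro: order.trans less_imp_le)
    qed
    then obtain Ka where Ka: "\<And>a z. a \<in> A \<Longrightarrow> norm z = r \<Longrightarrow> (1/2) ^ Ka a \<le> norm (mero_eval f z - a) ^ 2"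
      by metis
    define K where "K = (\<Sum>a\<in>A. Ka a)"
    have K: "(1/2) ^ K \<le> norm (mero_eval f z - a) ^ 2" if "a \<in> A" "norm z = r" for a z
    proof -
      have "Ka a \<le> K" unfolding K_def using A that by (intro member_le_sum) auto
      hence "(1/2 :: real) ^ K \<le> (1/2) ^ Ka a" by (intro power_decreasing) auto
      thus ?thesis using Ka[OF that] by linarith
    qed
    define \<phi> where "\<phi> = (\<lambda>a k z. 1 / b ^ (4 * k) * ((1/2) ^ k * norm (mero_eval (mero_deriv f) z) ^ 2 / (norm (mero_eval f z - a) ^ 2 + (1/2) ^ k) ^ 2))"
    define \<Phi> where "\<Phi> = (\<lambda>z. \<Sum>a\<in>A. \<Sum>k\<le>K. \<phi> a k z)"
    have c\<phi>: "continuous_on (sphere 0 r) (\<phi> a k)" for a k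
      unfolding \<phi>_def by (intro continuous_on_mult continuous_on_const curv_continuous reg(1) f0) simp
    have c\<Phi>: "continuous_on (sphere 0 r) \<Phi>"
      unfolding \<Phi>_def by (intro continuous_on_sum c\<phi>)
    have \<phi>pos: "\<phi> a k z > 0" if "norm z = r" for a k z
    proof -
      have "norm (mero_eval f z - a) ^ 2 + (1/2) ^ k > 0" by (intro add_nonneg_pos) auto
      thus ?thesis unfolding \<phi>_def using Dpos[OF that] b by (intro mult_pos_pos divide_pos_pos zero_less_power) auto
    qed
    have \<Phi>pos: "\<Phi> z > 0" if "norm z = r" for z
      unfolding \<Phi>_def using \<phi>pos[OF that] A \<open>A \<noteq> {}\<close> by (intro sum_pos) auto
    have mean\<Phi>: "circ_mean \<Phi> r \<le> G * (2 * T + C0) ^ 4"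
    proof -
      have tm: "circ_mean (\<phi> a k) r \<le> (1 / b) ^ k * (2 * T + C0) ^ 4" if "a \<in> A" for a k
      proof -
        have "circ_mean (\<phi> a k) r = 1 / b ^ (4 * k) * curv f a ((1/2) ^ k) r"
          unfolding \<phi>_def curv_def circ_mean_cmult ..
        also have "\<dots> \<le> 1 / b ^ (4 * k) * (b ^ (3 * k) * (2 * T + C0) ^ 4)"
          unfolding T_def r_def using b s rf that by (intro mult_left_mono curv) auto
        also have "b ^ (4 * k) = b ^ (3 * k) * b ^ k" by (simp flip: power_add)
        finally show ?thesis using b by (simp add: power_divide)
      qed
      have "circ_mean \<Phi> r = (\<Sum>a\<in>A. \<Sum>k\<le>K. circ_mean (\<phi> a k) r)"
        unfolding \<Phi>_def using A r c\<phi> by (simp add: circ_mean_sum continuous_on_sum)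
      also have "\<dots> \<le> (\<Sum>a\<in>A. \<Sum>k\<le>K. (1 / b) ^ k * (2 * T + C0) ^ 4)"
        by (intro sum_mono tm)
      also have "\<dots> = real q * ((\<Sum>k\<le>K. (1 / b) ^ k) * (2 * T + C0) ^ 4)"
        by (simp add: q_def sum_distrib_right)
      also have "\<dots> \<le> real q * ((b / (b - 1)) * (2 * T + C0) ^ 4)"
      proof (intro mult_left_mono mult_right_mono)
        have "(\<Sum>k\<le>K. (1 / b) ^ k) \<le> suminf (\<lambda>k. (1 / b) ^ k)"
          using b by (intro sum_le_suminf summable_geometric) auto
        also have "\<dots> = b / (b - 1)" using b by (subst suminf_geometric) (auto simp: field_simps)
        finally show "(\<Sum>k\<le>K. (1 / b) ^ k) \<le> b / (b - 1)" .
      qed auto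
      finally show ?thesis by (simp add: G_def)
    qed
    define L1 where "L1 = (\<lambda>z. 2 * ln (norm (mero_eval (mero_deriv f) z)))"
    define L2 where "L2 = (\<lambda>z. \<Sum>a\<in>A. (-2) * ln (norm (mero_eval (f - mero_const a) z)))"
    define L3 where "L3 = (\<lambda>z. 2 * real (card A - 2) * log_plus (norm (mero_eval f z)))"
    define R1 where "R1 = (\<lambda>z. \<Sum>a\<in>A. \<delta> * log_plus (norm (2 / (mero_eval f z - a) ^ 2)))"
    have cL1: "continuous_on (sphere 0 r) L1"
      unfolding L1_def by (intro continuous_on_mult continuous_on_const regular_radius_continuous_log reg df0)
    have cL2': "continuous_on (sphere 0 r) (\<lambda>z. (-2) * ln (norm (mero_eval (f - mero_const a) z)))" if "a \<in> A" for a
      by (intro continuous_on_mult continuous_on_const regular_radius_continuous_log reg(3)[OF that] h0)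
    have cL2: "continuous_on (sphere 0 r) L2"
      unfolding L2_def by (intro continuous_on_sum cL2')
    have cL3: "continuous_on (sphere 0 r) L3"
      unfolding L3_def by (intro continuous_on_mult continuous_on_const continuous_on_log_plus regular_radius_continuous reg(1) f0)
    have cR1': "continuous_on (sphere 0 r) (\<lambda>z. \<delta> * log_plus (norm (2 / (mero_eval f z - a) ^ 2)))" if "a \<in> A" for a
      by (intro continuous_on_mult continuous_on_const continuous_on_log_plus continuous_on_divide continuous_on_power
          continuous_on_diff regular_radius_continuous reg(1) f0) (use notA that in auto)
    have cR1: "continuous_on (sphere 0 r) R1"
      unfolding R1_def by (intro continuous_on_sum cR1')
    have cR2: "continuous_on (sphere 0 r) (\<lambda>z. ln (\<Phi> z))"
      by (intro continuous_on_ln c\<Phi>) (use \<Phi>pos in force)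
    have "circ_mean (\<lambda>z. (L1 z + L2 z) + L3 z) r \<le> circ_mean (\<lambda>z. (ln (8 * C1) + R1 z) + ln (\<Phi> z)) r"
    proof (rule circ_mean_mono)
      show "continuous_on (sphere 0 r) (\<lambda>z. (L1 z + L2 z) + L3 z)"
        by (intro continuous_on_add cL1 cL2 cL3)
      show "continuous_on (sphere 0 r) (\<lambda>z. (ln (8 * C1) + R1 z) + ln (\<Phi> z))"
        by (intro continuous_on_add cR1 cR2 continuous_on_const)
      fix z :: complex assume z: "norm z = r"
      have "L2 z = - (\<Sum>a\<in>A. 2 * ln (norm (mero_eval f z - a)))"
        by (simp add: L2_def sum_negf evh[OF z])
      thus "(L1 z + L2 z) + L3 z \<le> (ln (8 * C1) + R1 z) + ln (\<Phi> z)"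
        using log_derivative_pointwise[OF A notA[OF z] Dpos[OF z] \<delta> K[OF _ z] C1(1) C1(2)[OF notA[OF z]]]
        by (simp add: L1_def L3_def R1_def \<Phi>_def \<phi>_def b_def)
    qed (use r in auto)
    also have "\<dots> = (ln (8 * C1) + circ_mean R1 r) + circ_mean (\<lambda>z. ln (\<Phi> z)) r"
      by (simp only: circ_mean_add[OF continuous_on_add[OF continuous_on_const cR1] cR2 r(3)]
          circ_mean_add[OF continuous_on_const cR1 r(3)] circ_mean_const)
    also have "circ_mean R1 r \<le> (\<Sum>a\<in>A. \<delta> * (2 * T + Cf a))"
    proof -
      have "circ_mean R1 r = (\<Sum>a\<in>A. \<delta> * circ_mean (\<lambda>z. log_plus (norm (2 / (mero_eval f z - a) ^ 2))) r)"
        unfolding R1_def by (subst circ_mean_sum[OF A(1) cR1' r(3)]) (auto simp: circ_mean_cmult)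
      also have "\<dots> \<le> (\<Sum>a\<in>A. \<delta> * (2 * T + Cf a))"
        unfolding T_def using \<delta> reg r by (intro sum_mono mult_left_mono Cf) auto
      finally show ?thesis .
    qed
    also have "circ_mean (\<lambda>z. ln (\<Phi> z)) r \<le> ln (G * (2 * T + C0) ^ 4)"
    proof -
      have "circ_mean (\<lambda>z. ln (\<Phi> z)) r \<le> ln (circ_mean \<Phi> r)"
        by (rule circ_mean_ln_le[OF c\<Phi> r(3) \<Phi>pos])
      also have "\<dots> \<le> ln (G * (2 * T + C0) ^ 4)"
        using mean\<Phi> circ_mean_pos[OF c\<Phi> r(3) \<Phi>pos] by (intro ln_mono)
      finally show ?thesis .
    qed
    finally have ineq: "circ_mean (\<lambda>z. (L1 z + L2 z) + L3 z) r \<le> ln (8 * C1) + (\<Sum>a\<in>A. \<delta> * (2 * T + Cf a)) + ln (G * (2 * T + C0) ^ 4)"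
      by simp
    have lhs: "circ_mean (\<lambda>z. (L1 z + L2 z) + L3 z) r =
       2 * (log_sum (mero_deriv f) r + c') + (-2) * ((\<Sum>a\<in>A. log_sum (f - mero_const a) r) + (\<Sum>a\<in>A. ch a)) + 2 * real (card A - 2) * proximity_fun f r"
    proof -
      have "circ_mean L2 r = (\<Sum>a\<in>A. (-2) * circ_mean (\<lambda>z. ln (norm (mero_eval (f - mero_const a) z))) r)"
        unfolding L2_def by (subst circ_mean_sum[OF A(1) cL2' r(3)]) (assumption | simp only: circ_mean_cmult)+
      also have "\<dots> = (\<Sum>a\<in>A. (-2) * (log_sum (f - mero_const a) r + ch a))"
        using ch reg r by (intro sum.cong) auto
      finally have l2: "circ_mean L2 r = (-2) * ((\<Sum>a\<in>A. log_sum (f - mero_const a) r) + (\<Sum>a\<in>A. ch a))"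
        by (simp only: sum_distrib_left[symmetric] sum.distrib)
      have l1: "circ_mean L1 r = 2 * (log_sum (mero_deriv f) r + c')"
        unfolding L1_def circ_mean_cmult using c' reg r by simp
      have l3: "circ_mean L3 r = 2 * real (card A - 2) * proximity_fun f r"
        unfolding L3_def circ_mean_cmult proximity_fun_circ_mean ..
      show ?thesis
        by (simp only: circ_mean_add[OF continuous_on_add[OF cL1 cL2] cL3 r(3)] circ_mean_add[OF cL1 cL2 r(3)] l1 l2 l3)
    qed
    have X: "2 * T + C0 \<ge> 1" unfolding T_def r_def by (rule X1[OF s rf])
    have "ln (G * (2 * T + C0) ^ 4) = ln G + 4 * ln (2 * T + C0)"
      using G X by (simp add: ln_mult ln_realpow)
    \<comment> \<open>\<open>ln x \<le> x - 1\<close> at \<open>x = \<delta> * (2 * T + C0)\<close>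
      trades the logarithm for a small multiple of \<open>T\<close>.\<close>
    also have "ln (2 * T + C0) \<le> \<delta> * (2 * T + C0) - 1 - ln \<delta>"
      using ln_le_minus_one[of "\<delta> * (2 * T + C0)"] \<delta> X by (simp add: ln_mult)
    finally have lnX: "ln (G * (2 * T + C0) ^ 4) \<le> ln G + 4 * (\<delta> * (2 * T + C0) - 1 - ln \<delta>)"
      by simp
    have sumC: "(\<Sum>a\<in>A. \<delta> * (2 * T + Cf a)) = 2 * \<delta> * real q * T + \<delta> * (\<Sum>a\<in>A. Cf a)"
      by (simp add: sum_distrib_left[symmetric] sum.distrib q_def algebra_simps)
    note ls = log_sum_derivative_ge[OF nonconst A r(1)]
    have qe: "real (card A - 2) = real q - 2" using q by (simp add: q_def)
    have "2 * ((real q - 2) * counting_fun f r - (\<Sum>a\<in>A. reduced_counting f a r)) + 2 * (real q - 2) * proximity_fun f r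
       \<le> 2 * \<delta> * (real q + 4) * T + Ctot"
      using ineq lhs lnX sumC ls unfolding qe Ctot_def by (simp add: algebra_simps)
    also have "2 * \<delta> * (real q + 4) = 2 * \<epsilon>" using q by (simp add: \<delta>_def)
    finally have "(real q - 2 - \<epsilon>) * T \<le> (\<Sum>a\<in>A. reduced_counting f a r) + Ctot / 2"
      by (simp add: T_def nevanlinna_char_def algebra_simps)
    thus ?thesis by (simp add: T_def r_def q_def)
  qed
  have "\<exists>C s0. s0 \<ge> 0 \<and> (\<forall>s\<ge>s0. s \<notin> E \<longrightarrow>
      regular_radius f (exp s) \<longrightarrow> regular_radius (mero_deriv f) (exp s) \<longrightarrow>
      (\<forall>a\<in>A. regular_radius (f - mero_const a) (exp s)) \<longrightarrow>
      (real (card A) - 2 - \<epsilon>) * nevanlinna_char f (exp s) \<le> (\<Sum>a\<in>A. reduced_counting f a (exp s)) + C)"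
    by (rule exI[of _ "Ctot / 2"], rule exI[of _ s0]) (use main s0 in auto)
  thus ?thesis using E by blast
qed

section \<open>Small target functions\<close>

text \<open>Under \<open>r = exp s\<close> one has \<open>dr = exp s ds\<close>, so for
  \<open>s \<ge> 0\<close> the measure in \<open>s\<close> is at most that in \<open>r\<close>.
  \<open>E\<close> is only Lebesgue measurable and is first enclosed in an open set of finite
  measure, to which the substitution for Borel functions applies.\<close>

lemma log_preimage_finite_measure:
  fixes E :: "real set"
  assumes "E \<in> lmeasurable"
  shows "\<exists>E'\<in>sets lborel. emeasure lborel E' < \<infinity> \<and> (\<forall>s\<ge>0. exp s \<in> E \<longrightarrow> s \<in> E')"
proof -
  obtain U where U: "open U" "E \<subseteq> U" "U - E \<in> lmeasurable"
    using sets_lebesgue_outer_open[of E 1] fmeasurableD[OF assms] by auto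
  have "U = E \<union> (U - E)" using U by auto
  hence "U \<in> lmeasurable" using assms U(3) by (metis fmeasurable.Un)
  hence fin: "emeasure lborel U < \<infinity>"
    using U(1) by (simp add: fmeasurable_def emeasure_completion)
  have [measurable]: "U \<in> sets borel" using U(1) by simp
  define E' where "E' = {s. s \<ge> 0 \<and> exp s \<in> U}"
  have "open (exp -` U)" by (intro open_vimage U(1) continuous_on_exp continuous_on_id)
  moreover have "E' = {0..} \<inter> exp -` U" by (auto simp: E'_def)
  ultimately have [measurable]: "E' \<in> sets borel" by auto
  have le: "emeasure lborel (E' \<inter> {0..real n}) \<le> emeasure lborel U" for n
  proof (cases "n = 0")
    case True
    have "emeasure lborel (E' \<inter> {0..real n}) \<le> emeasure lborel {0 :: real}"
      using True by (intro emeasure_mono) auto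
    thus ?thesis by simp
  next
    case False
    have "emeasure lborel (E' \<inter> {0..real n}) = (\<integral>\<^sup>+ x. indicator (E' \<inter> {0..real n}) x \<partial>lborel)"
      by simp
    also have "\<dots> \<le> (\<integral>\<^sup>+ x. indicator U (exp x) * ennreal (exp x) * indicator {0..real n} x \<partial>lborel)"
    proof (rule nn_integral_mono)
      fix x :: real
      show "indicator (E' \<inter> {0..real n}) x \<le> indicator U (exp x) * ennreal (exp x) * indicator {0..real n} x"
      proof (cases "x \<in> E' \<inter> {0..real n}")
        case True
        hence "1 \<le> exp x" by simp
        hence "1 \<le> ennreal (exp x)" by (simp flip: ennreal_1 add: ennreal_leI del: ennreal_1)
        thus ?thesis using True by (simp add: E'_def indicator_def)
      qed simp
    qed
    also have "\<dots> = (\<integral>\<^sup>+ x. indicator U x * indicator {exp 0..exp (real n)} x \<partial>lborel)"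
      using False
      by (intro nn_integral_substitution_aux[symmetric]) (auto intro!: derivative_eq_intros continuous_intros)
    also have "\<dots> \<le> (\<integral>\<^sup>+ x. indicator U x \<partial>lborel)"
      by (intro nn_integral_mono) (auto simp: indicator_def)
    finally show ?thesis by simp
  qed
  have "E' = (\<Union>n. E' \<inter> {0..real n})"
    using real_arch_simple by (auto simp: E'_def)
  hence "emeasure lborel E' = emeasure lborel (\<Union>n. E' \<inter> {0..real n})" by simp
  also have "\<dots> = (SUP n. emeasure lborel (E' \<inter> {0..real n}))"
    by (intro SUP_emeasure_incseq[symmetric]) (auto simp: incseq_def)
  also have "\<dots> \<le> emeasure lborel U" by (intro SUP_least le)
  finally have "emeasure lborel E' < \<infinity>" using fin by (rule le_less_trans)
  thus ?thesis using U(2) by (intro bexI[of _ E']) (auto simp: E'_def)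
qed

text \<open>The exceptional set is chosen before \<open>\<eta>\<close>; only the threshold
  \<open>s1\<close> depends on \<open>\<eta>\<close>. Positivity of the characteristic permits
  clearing the denominator.\<close>

lemma small_error_bound:
  assumes "is_small_error f h"
  shows "\<exists>E\<in>sets lborel. emeasure lborel E < \<infinity> \<and>
    (\<forall>\<eta>>0. \<exists>s1. \<forall>s\<ge>s1. s \<notin> E \<longrightarrow> nevanlinna_char f (exp s) > 0 \<longrightarrow> h (exp s) \<le> \<eta> * nevanlinna_char f (exp s))"
proof -
  obtain E where E: "E \<in> lmeasurable"
    and lim: "((\<lambda>r. h r / nevanlinna_char f r) \<longlongrightarrow> 0) (inf at_top (principal (- E)))"
    using assms by (auto simp: is_small_error_def)
  obtain E' where E': "E' \<in> sets lborel" "emeasure lborel E' < \<infinity>" "\<And>s. s \<ge> 0 \<Longrightarrow> exp s \<in> E \<Longrightarrow> s \<in> E'"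
    using log_preimage_finite_measure[OF E] by blast
  have "\<exists>s1. \<forall>s\<ge>s1. s \<notin> E' \<longrightarrow> nevanlinna_char f (exp s) > 0 \<longrightarrow> h (exp s) \<le> \<eta> * nevanlinna_char f (exp s)"
    if \<eta>: "\<eta> > 0" for \<eta>
  proof -
    have "eventually (\<lambda>r. dist (h r / nevanlinna_char f r) 0 < \<eta>) (inf at_top (principal (- E)))"
      using lim \<eta> by (rule tendstoD)
    then obtain R where R: "\<And>r. r \<ge> R \<Longrightarrow> r \<notin> E \<Longrightarrow> dist (h r / nevanlinna_char f r) 0 < \<eta>"
      by (auto simp: eventually_inf_principal eventually_at_top_linorder)
    have "h (exp s) \<le> \<eta> * nevanlinna_char f (exp s)"
      if s: "s \<ge> max 0 R" "s \<notin> E'" "nevanlinna_char f (exp s) > 0" for s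
    proof -
      have "exp s \<ge> R" using exp_ge_add_one_self[of s] s by linarith
      moreover have "exp s \<notin> E" using E'(3)[of s] s by auto
      ultimately have "\<bar>h (exp s) / nevanlinna_char f (exp s)\<bar> < \<eta>" using R by simp
      hence "h (exp s) / nevanlinna_char f (exp s) \<le> \<eta>" by linarith
      thus ?thesis using s(3) by (simp add: field_simps)
    qed
    thus ?thesis by blast
  qed
  thus ?thesis using E' by blast
qed

section \<open>Linear combinations of the coefficient functions\<close>

lemma proximity_fun_nonneg: "proximity_fun f r \<ge> 0"
  unfolding proximity_fun_circ_mean by (rule circ_mean_nonneg) simp

lemma nevanlinna_char_nonneg: "r \<ge> 1 \<Longrightarrow> nevanlinna_char f r \<ge> 0"
  unfolding nevanlinna_char_def by (intro add_nonneg_nonneg proximity_fun_nonneg counting_fun_nonneg)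

lemma mord_linear_combination_ge:
  assumes "finite I" "\<And>i. i \<in> I \<Longrightarrow> ord_minus (lam i) z \<le> B"
    and "(\<Sum>i\<in>I. lam i * mero_const (c i)) \<noteq> 0"
  shows "mord (\<Sum>i\<in>I. lam i * mero_const (c i)) z \<ge> - B"
proof -
  \<comment> \<open>Partial sums may vanish, where \<open>mord\<close> says nothing, so the
    induction carries the zero case as an alternative.\<close>
  have "(\<Sum>i\<in>I. lam i * mero_const (c i)) = 0 \<or> mord (\<Sum>i\<in>I. lam i * mero_const (c i)) z \<ge> - B"
    using assms(1,2)
  proof (induction I rule: finite_induct)
    case (insert i I)
    let ?t = "lam i * mero_const (c i)" and ?S = "\<Sum>i\<in>I. lam i * mero_const (c i)"
    have S: "?S = 0 \<or> mord ?S z \<ge> - B" using insert by simp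
    have t: "?t = 0 \<or> mord ?t z \<ge> - B"
    proof (cases "lam i = 0 \<or> c i = 0")
      case False
      hence "mord ?t z = mord (lam i) z" by (simp add: mord_mult)
      moreover have "- ord_minus (lam i) z \<le> mord (lam i) z"
        using False by (simp add: ord_minus_def)
      ultimately show ?thesis using insert.prems[of i] by simp
    qed auto
    have "?t + ?S = 0 \<or> mord (?t + ?S) z \<ge> - B"
    proof (cases "?t = 0 \<or> ?S = 0 \<or> ?t + ?S = 0")
      case True
      thus ?thesis using S t by auto
    next
      case False
      hence "mord (?t + ?S) z \<ge> - B" using S t by (intro mord_add_ge) auto
      thus ?thesis by blast
    qed
    thus ?case using insert by simp
  qed simp
  thus ?thesis using assms(3) by blast
qed

text \<open>The product \<open>P\<close> of all \<open>max 1 (norm (x i))\<close> bounds every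
  \<open>norm (x i)\<close>, and its logarithm is the sum of the \<open>log_plus\<close> terms; the
  coefficients only add a constant.\<close>

lemma log_plus_linear_combination:
  assumes "finite I"
  shows "log_plus (norm (\<Sum>i\<in>I. x i * c i :: complex)) \<le> ln (max 1 (\<Sum>i\<in>I. norm (c i))) + (\<Sum>i\<in>I. log_plus (norm (x i)))"
proof -
  define P where "P = (\<Prod>i\<in>I. max 1 (norm (x i)))"
  have P1: "P \<ge> 1" unfolding P_def by (intro prod_ge_1) auto
  have xP: "norm (x i) \<le> P" if "i \<in> I" for i
  proof -
    have "1 \<le> (\<Prod>j\<in>I - {i}. max 1 (norm (x j)))" by (intro prod_ge_1) auto
    hence "max 1 (norm (x i)) * 1 \<le> max 1 (norm (x i)) * (\<Prod>j\<in>I - {i}. max 1 (norm (x j)))"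
      by (intro mult_left_mono) auto
    thus ?thesis using that assms by (simp add: P_def prod.remove)
  qed
  have "norm (\<Sum>i\<in>I. x i * c i) \<le> (\<Sum>i\<in>I. norm (x i * c i))" by (rule norm_sum)
  also have "\<dots> \<le> (\<Sum>i\<in>I. P * norm (c i))"
    by (intro sum_mono) (auto simp: norm_mult xP intro!: mult_right_mono)
  also have "\<dots> = (\<Sum>i\<in>I. norm (c i)) * P" by (simp add: sum_distrib_left[symmetric] mult.commute)
  also have "\<dots> \<le> max 1 (\<Sum>i\<in>I. norm (c i)) * P" using P1 by (intro mult_right_mono) auto
  finally have 1: "norm (\<Sum>i\<in>I. x i * c i) \<le> max 1 (\<Sum>i\<in>I. norm (c i)) * P" .
  have 2: "1 \<le> max 1 (\<Sum>i\<in>I. norm (c i)) * P"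
    using mult_mono[of 1 "max 1 (\<Sum>i\<in>I. norm (c i))" 1 P] P1 by simp
  have "max 1 (norm (\<Sum>i\<in>I. x i * c i)) \<le> max 1 (\<Sum>i\<in>I. norm (c i)) * P"
    using 1 2 by simp
  hence "log_plus (norm (\<Sum>i\<in>I. x i * c i)) \<le> ln (max 1 (\<Sum>i\<in>I. norm (c i)) * P)"
    by (simp add: log_plus_alt)
  also have "\<dots> = ln (max 1 (\<Sum>i\<in>I. norm (c i))) + ln P"
    using P1 by (simp add: ln_mult)
  also have "ln P = (\<Sum>i\<in>I. ln (max 1 (norm (x i))))"
    unfolding P_def using assms by (intro ln_prod) (auto simp: max_def)
  also have "\<dots> = (\<Sum>i\<in>I. log_plus (norm (x i)))" by (simp add: log_plus_alt)
  finally show ?thesis .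
qed

text \<open>
  A point where \<open>f\<close> takes the value \<open>\<zeta>\<close> is a zero of the linear combination unless some \<open>lam i\<close> has
  a pole there; the poles of the non-entire \<open>lam i\<close> account for the second sum.
\<close>

lemma reduced_counting_le:
  fixes lam :: "nat \<Rightarrow> mero"
  assumes nonconst: "f \<notin> range mero_const" and I: "finite I"
    and P0: "(\<Sum>i\<in>I. lam i * mero_const (c i)) \<noteq> 0"
    and van: "\<And>z. \<not> mpole f z \<Longrightarrow> mero_eval f z = \<zeta> \<Longrightarrow> (\<And>i. i \<in> I \<Longrightarrow> \<not> mpole (lam i) z) \<Longrightarrow>
        mero_eval (\<Sum>i\<in>I. lam i * mero_const (c i)) z = 0"
  shows "\<exists>C. \<forall>r\<ge>1. regular_radius (\<Sum>i\<in>I. lam i * mero_const (c i)) r \<longrightarrow>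
     (\<forall>i\<in>I. lam i \<noteq> 0 \<longrightarrow> regular_radius (lam i) r) \<longrightarrow>
     reduced_counting f \<zeta> r \<le> (\<Sum>i\<in>I. nevanlinna_char (lam i) r)
        + (\<Sum>i\<in>{i\<in>I. \<not> is_entire (lam i)}. nevanlinna_char (lam i) r) + C"
proof -
  define P where "P = (\<Sum>i\<in>I. lam i * mero_const (c i))"
  have P0': "P \<noteq> 0" using P0 by (simp add: P_def)
  have f0: "f \<noteq> 0" using nonconst by (metis mero_const_0 rangeI)
  have h0: "f - mero_const \<zeta> \<noteq> 0" using nonconst by auto
  obtain c0 where c0: "\<And>r. r > 0 \<Longrightarrow> regular_radius P r \<Longrightarrow> circ_mean (\<lambda>z. ln (norm (mero_eval P z))) r = log_sum P r + c0"
    using jensen_log_sum[OF P0'] by blast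
  define L where "L = ln (max 1 (\<Sum>i\<in>I. norm (c i)))"
  define Ne where "Ne = {i\<in>I. \<not> is_entire (lam i)}"
  have Ne: "finite Ne" "Ne \<subseteq> I" using I by (auto simp: Ne_def)
  have pole_Ne: "i \<in> Ne" if "i \<in> I" "mpole (lam i) z" for i z
  proof -
    have "\<not> is_entire (lam i)"
    proof
      assume "is_entire (lam i)"
      hence "mero_eval (lam i) analytic_on {z}"
        using analytic_on_open[of UNIV "mero_eval (lam i)"] analytic_on_subset[of _ UNIV "{z}"]
        by (simp add: is_entire_def)
      thus False using that(2) analytic_at_imp_no_pole by blast
    qed
    thus ?thesis using that by (simp add: Ne_def)
  qed
  have om: "ord_minus g z \<ge> 0" for g z by (simp add: ord_minus_def)
  \<comment> \<open>The sum over \<open>I\<close> makes the right side nonnegative, by the lower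
    bound for \<open>mord P\<close>. Where \<open>f\<close> takes the value \<open>\<zeta>\<close>
    an extra 1 is needed: it comes from the zero of \<open>P\<close> if no \<open>lam i\<close> has
    a pole there, and otherwise from the sum over \<open>Ne\<close>.\<close>
  have key: "of_bool (mord (f - mero_const \<zeta>) z > 0) \<le> mord P z + ((\<Sum>i\<in>I. ord_minus (lam i) z) + (\<Sum>i\<in>Ne. ord_minus (lam i) z))" for z
  proof -
    have ge: "mord P z \<ge> - (\<Sum>i\<in>I. ord_minus (lam i) z)"
      unfolding P_def by (rule mord_linear_combination_ge[OF I _ P0]) (auto intro!: member_le_sum I om)
    have nn: "(\<Sum>i\<in>I. ord_minus (lam i) z) \<ge> 0" "(\<Sum>i\<in>Ne. ord_minus (lam i) z) \<ge> 0"
      by (intro sum_nonneg om)+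
    show ?thesis
    proof (cases "mord (f - mero_const \<zeta>) z > 0")
      case True
      show ?thesis
      proof (cases "\<exists>i\<in>I. mpole (lam i) z")
        case pole: True
        then obtain i where i: "i \<in> I" "mpole (lam i) z" by blast
        hence "ord_minus (lam i) z \<ge> 1" using mpole_iff[of "lam i" z] by (simp add: ord_minus_def)
        moreover have "ord_minus (lam i) z \<le> (\<Sum>i\<in>Ne. ord_minus (lam i) z)"
          using pole_Ne[OF i] Ne om by (intro member_le_sum) auto
        ultimately show ?thesis using ge by (simp add: True)
      next
        case nopole: False
        have npf: "\<not> mpole f z"
          using True mord_minus_const_pole[of f z \<zeta>] h0 f0 mpole_iff[of f z] by auto
        have "mero_eval (f - mero_const \<zeta>) z = 0"
          using mero_zero_iff[of "f - mero_const \<zeta>" z] mpole_iff[of "f - mero_const \<zeta>" z] True by auto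
        hence "mero_eval f z = \<zeta>" using mero_eval_diff[of f z "mero_const \<zeta>"] npf by simp
        hence "mero_eval P z = 0" using van[OF npf] nopole by (auto simp: P_def)
        moreover have "\<not> mpole P z"
        proof -
          have "\<not> mpole (lam i * mero_const (c i)) z" if "i \<in> I" for i
            using mero_eval_mult(1)[of "lam i" z "mero_const (c i)"] nopole that by auto
          thus ?thesis using mero_eval_sum[OF I, of "\<lambda>i. lam i * mero_const (c i)" z] by (simp add: P_def)
        qed
        ultimately have "mord P z > 0" using mero_zero_iff[of P z] P0' by simp
        thus ?thesis using nn by (simp add: True)
      qed
    next
      case False
      thus ?thesis using ge nn by simp
    qed
  qed
  have main: "reduced_counting f \<zeta> r \<le> (\<Sum>i\<in>I. nevanlinna_char (lam i) r) + (\<Sum>i\<in>Ne. nevanlinna_char (lam i) r) + (L - c0)"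
    if r: "r \<ge> 1" and regP: "regular_radius P r" and regl: "\<And>i. i \<in> I \<Longrightarrow> lam i \<noteq> 0 \<Longrightarrow> regular_radius (lam i) r" for r
  proof -
    have s1: "disc_finite (\<lambda>z. \<Sum>i\<in>I. ord_minus (lam i) z)" "wsum (\<lambda>z. \<Sum>i\<in>I. ord_minus (lam i) z) r = (\<Sum>i\<in>I. counting_fun (lam i) r)"
      using wsum_sum[OF I, of "\<lambda>i z. ord_minus (lam i) z" r] disc_finite_ord_minus r by (auto simp: counting_fun_wsum)
    have s2: "disc_finite (\<lambda>z. \<Sum>i\<in>Ne. ord_minus (lam i) z)" "wsum (\<lambda>z. \<Sum>i\<in>Ne. ord_minus (lam i) z) r = (\<Sum>i\<in>Ne. counting_fun (lam i) r)"
      using wsum_sum[OF Ne(1), of "\<lambda>i z. ord_minus (lam i) z" r] disc_finite_ord_minus r by (auto simp: counting_fun_wsum)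
    have "reduced_counting f \<zeta> r \<le> wsum (\<lambda>z. mord P z + ((\<Sum>i\<in>I. ord_minus (lam i) z) + (\<Sum>i\<in>Ne. ord_minus (lam i) z))) r"
      unfolding reduced_counting_def
      by (intro wsum_mono disc_finite_reduced h0 disc_finite_add s1 s2 disc_finite_mord P0' key r)
    also have "\<dots> = log_sum P r + ((\<Sum>i\<in>I. counting_fun (lam i) r) + (\<Sum>i\<in>Ne. counting_fun (lam i) r))"
      by (simp only: wsum_add[OF disc_finite_mord[OF P0'] disc_finite_add[OF s1(1) s2(1)]] wsum_add[OF s1(1) s2(1)] s1(2) s2(2) log_sum_wsum)
    finally have 1: "reduced_counting f \<zeta> r \<le> log_sum P r + ((\<Sum>i\<in>I. counting_fun (lam i) r) + (\<Sum>i\<in>Ne. counting_fun (lam i) r))" .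
    have clam: "continuous_on (sphere 0 r) (mero_eval (lam i))" if "i \<in> I" for i
    proof (cases "lam i = 0")
      case True
      thus ?thesis by (simp add: mero_eval_0[abs_def])
    qed (use regular_radius_continuous regl that in blast)
    have clog: "continuous_on (sphere 0 r) (\<lambda>z. log_plus (norm (mero_eval (lam i) z)))" if "i \<in> I" for i
      by (intro continuous_on_log_plus clam that)
    have npl: "\<not> mpole (lam i) z" if "i \<in> I" "norm z = r" for i z
    proof (cases "lam i = 0")
      case True
      thus ?thesis by (simp add: mpole_iff)
    qed (use regular_radiusD regl that in blast)
    have evP: "mero_eval P z = (\<Sum>i\<in>I. mero_eval (lam i) z * c i)" if z: "norm z = r" for z
    proof -
      have "\<not> mpole (lam i * mero_const (c i)) z" "mero_eval (lam i * mero_const (c i)) z = mero_eval (lam i) z * c i" if "i \<in> I" for i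
        using mero_eval_mult[of "lam i" z "mero_const (c i)"] npl[OF that z] by auto
      thus ?thesis using mero_eval_sum[OF I, of "\<lambda>i. lam i * mero_const (c i)" z] by (simp add: P_def)
    qed
    have "log_sum P r + c0 = circ_mean (\<lambda>z. ln (norm (mero_eval P z))) r"
      using c0[OF _ regP] r by simp
    also have "\<dots> \<le> circ_mean (\<lambda>z. L + (\<Sum>i\<in>I. log_plus (norm (mero_eval (lam i) z)))) r"
    proof (rule circ_mean_mono)
      show "continuous_on (sphere 0 r) (\<lambda>z. ln (norm (mero_eval P z)))"
        by (rule regular_radius_continuous_log[OF regP P0'])
      show "continuous_on (sphere 0 r) (\<lambda>z. L + (\<Sum>i\<in>I. log_plus (norm (mero_eval (lam i) z))))"
        by (intro continuous_on_add continuous_on_const continuous_on_sum clog)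
      fix z :: complex assume z: "norm z = r"
      have "ln (norm (mero_eval P z)) \<le> log_plus (norm (mero_eval P z))" by (simp add: log_plus_def)
      also have "\<dots> \<le> L + (\<Sum>i\<in>I. log_plus (norm (mero_eval (lam i) z)))"
        unfolding evP[OF z] L_def by (rule log_plus_linear_combination[OF I])
      finally show "ln (norm (mero_eval P z)) \<le> L + (\<Sum>i\<in>I. log_plus (norm (mero_eval (lam i) z)))" .
    qed (use r in auto)
    also have "\<dots> = L + (\<Sum>i\<in>I. proximity_fun (lam i) r)"
    proof -
      have r0: "r \<ge> 0" using r by simp
      have "continuous_on (sphere 0 r) (\<lambda>z. \<Sum>i\<in>I. log_plus (norm (mero_eval (lam i) z)))"
        by (intro continuous_on_sum clog)
      from circ_mean_add[OF continuous_on_const this r0] show ?thesis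
        using circ_mean_sum[OF I clog r0] by (simp add: proximity_fun_circ_mean)
    qed
    finally have 2: "log_sum P r + c0 \<le> L + (\<Sum>i\<in>I. proximity_fun (lam i) r)" .
    \<comment> \<open>The extra polar terms are bounded by full characteristics; they are the reason
      for adding the number of non-entire coefficients to \<open>m\<close>.\<close>
    have 3: "(\<Sum>i\<in>Ne. counting_fun (lam i) r) \<le> (\<Sum>i\<in>Ne. nevanlinna_char (lam i) r)"
      by (intro sum_mono) (simp add: nevanlinna_char_def proximity_fun_nonneg)
    have 4: "(\<Sum>i\<in>I. nevanlinna_char (lam i) r) = (\<Sum>i\<in>I. proximity_fun (lam i) r) + (\<Sum>i\<in>I. counting_fun (lam i) r)"
      by (simp add: nevanlinna_char_def sum.distrib)
    show ?thesis using 1 2 3 4 by linarith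
  qed
  show ?thesis by (rule exI[of _ "L - c0"]) (use main in \<open>auto simp: P_def Ne_def\<close>)
qed

section \<open>Bounds outside a common exceptional set\<close>

lemma union_finite_measure:
  assumes "finite I" "\<And>i. i \<in> I \<Longrightarrow> E i \<in> sets lborel" "\<And>i. i \<in> I \<Longrightarrow> emeasure lborel (E i) < \<infinity>"
  shows "(\<Union>i\<in>I. E i) \<in> sets lborel" "emeasure lborel (\<Union>i\<in>I. E i) < \<infinity>"
proof -
  show "(\<Union>i\<in>I. E i) \<in> sets lborel" using assms by (intro sets.finite_UN) auto
  have "emeasure lborel (\<Union>i\<in>I. E i) \<le> (\<Sum>i\<in>I. emeasure lborel (E i))"
    using assms by (intro emeasure_subadditive_finite) auto
  also have "\<dots> < \<infinity>" using assms by simp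
  finally show "emeasure lborel (\<Union>i\<in>I. E i) < \<infinity>" .
qed

lemma small_errors_bound:
  assumes "finite I" "\<And>i. i \<in> I \<Longrightarrow> is_small_error f (h i)"
  shows "\<exists>E\<in>sets lborel. emeasure lborel E < \<infinity> \<and>
    (\<forall>\<eta>>0. \<exists>s1. \<forall>s\<ge>s1. s \<notin> E \<longrightarrow> nevanlinna_char f (exp s) > 0 \<longrightarrow>
      (\<forall>i\<in>I. h i (exp s) \<le> \<eta> * nevanlinna_char f (exp s)))"
proof -
  have "\<forall>i\<in>I. \<exists>E\<in>sets lborel. emeasure lborel E < \<infinity> \<and>
    (\<forall>\<eta>>0. \<exists>s1. \<forall>s\<ge>s1. s \<notin> E \<longrightarrow> nevanlinna_char f (exp s) > 0 \<longrightarrow> h i (exp s) \<le> \<eta> * nevanlinna_char f (exp s))"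
    using small_error_bound assms(2) by blast
  then obtain E where E: "\<And>i. i \<in> I \<Longrightarrow> E i \<in> sets lborel" "\<And>i. i \<in> I \<Longrightarrow> emeasure lborel (E i) < \<infinity>"
    "\<And>i \<eta>. i \<in> I \<Longrightarrow> \<eta> > 0 \<Longrightarrow> \<exists>s1. \<forall>s\<ge>s1. s \<notin> E i \<longrightarrow> nevanlinna_char f (exp s) > 0 \<longrightarrow> h i (exp s) \<le> \<eta> * nevanlinna_char f (exp s)"
    by metis
  have "\<exists>s1. \<forall>s\<ge>s1. s \<notin> (\<Union>i\<in>I. E i) \<longrightarrow> nevanlinna_char f (exp s) > 0 \<longrightarrow>
      (\<forall>i\<in>I. h i (exp s) \<le> \<eta> * nevanlinna_char f (exp s))" if \<eta>: "\<eta> > 0" for \<eta>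
  proof -
    have "\<forall>i\<in>I. \<exists>s1. \<forall>s\<ge>s1. s \<notin> E i \<longrightarrow> nevanlinna_char f (exp s) > 0 \<longrightarrow> h i (exp s) \<le> \<eta> * nevanlinna_char f (exp s)"
      using E(3)[OF _ \<eta>] by blast
    then obtain s1 where s1: "\<And>i s. i \<in> I \<Longrightarrow> s \<ge> s1 i \<Longrightarrow> s \<notin> E i \<Longrightarrow> nevanlinna_char f (exp s) > 0 \<Longrightarrow> h i (exp s) \<le> \<eta> * nevanlinna_char f (exp s)"
      by metis
    have "s1 i \<le> Max (insert 0 (s1 ` I))" if "i \<in> I" for i
      using assms(1) that by (intro Max_ge) auto
    thus ?thesis using s1 by (intro exI[of _ "Max (insert 0 (s1 ` I))"]) fastforce
  qed
  thus ?thesis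
    using union_finite_measure[OF assms(1) E(1,2)] by (intro bexI[of _ "\<Union>i\<in>I. E i"]) auto
qed

text \<open>The growth hypotheses are kept apart from exponents and roots of unity: the value
  distribution argument depends only on these and, in \<open>few_values\<close>, on
  \<open>\<rho> < 1\<close>.\<close>

locale small_coefficients =
  fixes m :: nat and f :: mero and lam :: "nat \<Rightarrow> mero" and \<rho> :: real
  assumes m: "m \<ge> 1"
    and nonconst: "f \<notin> range mero_const"
    and growth: "\<And>i. i \<in> {1..m} \<Longrightarrow>
      \<exists>h. is_small_error f h \<and>
          (\<forall>r>0. nevanlinna_char (lam i) r \<le>
             \<rho> / real (m + card {j \<in> {1..m}. \<not> is_entire (lam j)}) * nevanlinna_char f r + h r)"
begin

abbreviation mtot :: real where "mtot \<equiv> real (m + card {j \<in> {1..m}. \<not> is_entire (lam j)})"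

lemma mtot_pos: "mtot > 0" using m by simp

text \<open>The error functions are absorbed into an arbitrarily small \<open>\<eta>\<close>, taken
  as \<open>\<eta> / mtot\<close> for each coefficient.\<close>

lemma growth_bound:
  "\<exists>E\<in>sets lborel. emeasure lborel E < \<infinity> \<and>
    (\<forall>\<eta>>0. \<exists>s1. \<forall>s\<ge>s1. s \<notin> E \<longrightarrow> nevanlinna_char f (exp s) > 0 \<longrightarrow>
      (\<forall>i\<in>{1..m}. nevanlinna_char (lam i) (exp s) \<le> (\<rho> + \<eta>) / mtot * nevanlinna_char f (exp s)))"
proof -
  obtain h where h: "\<And>i. i \<in> {1..m} \<Longrightarrow> is_small_error f (h i)"
     "\<And>i r. i \<in> {1..m} \<Longrightarrow> r > 0 \<Longrightarrow> nevanlinna_char (lam i) r \<le> \<rho> / mtot * nevanlinna_char f r + h i r"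
    using growth by metis
  obtain E where E: "E \<in> sets lborel" "emeasure lborel E < \<infinity>"
    and hE: "\<And>\<eta>. \<eta> > 0 \<Longrightarrow> \<exists>s1. \<forall>s\<ge>s1. s \<notin> E \<longrightarrow> nevanlinna_char f (exp s) > 0 \<longrightarrow>
      (\<forall>i\<in>{1..m}. h i (exp s) \<le> \<eta> * nevanlinna_char f (exp s))"
    using small_errors_bound[of "{1..m}" f h] h(1) by auto
  have "\<exists>s1. \<forall>s\<ge>s1. s \<notin> E \<longrightarrow> nevanlinna_char f (exp s) > 0 \<longrightarrow>
      (\<forall>i\<in>{1..m}. nevanlinna_char (lam i) (exp s) \<le> (\<rho> + \<eta>) / mtot * nevanlinna_char f (exp s))"
    if \<eta>: "\<eta> > 0" for \<eta>
  proof -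
    obtain s1 where s1: "\<And>s i. s \<ge> s1 \<Longrightarrow> s \<notin> E \<Longrightarrow> nevanlinna_char f (exp s) > 0 \<Longrightarrow> i \<in> {1..m} \<Longrightarrow>
       h i (exp s) \<le> \<eta> / mtot * nevanlinna_char f (exp s)"
      using hE[OF divide_pos_pos[OF \<eta> mtot_pos]] by blast
    have "nevanlinna_char (lam i) (exp s) \<le> (\<rho> + \<eta>) / mtot * nevanlinna_char f (exp s)"
      if "s \<ge> s1" "s \<notin> E" "nevanlinna_char f (exp s) > 0" "i \<in> {1..m}" for s i
      using h(2)[OF that(4), of "exp s"] s1[OF that]
      by (simp add: add_divide_distrib distrib_right)
    thus ?thesis by blast
  qed
  thus ?thesis using E by blast
qed

text \<open>Characteristics are nonnegative for radii at least 1, and that of \<open>f\<close> is at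
  least 1 on large regular circles; with \<open>\<eta> = - \<rho> / 2\<close> a negative
  \<open>\<rho>\<close> would force a negative characteristic of \<open>lam 1\<close>.\<close>

lemma rho_nonneg: "\<rho> \<ge> 0"
proof (rule ccontr)
  assume "\<not> \<rho> \<ge> 0"
  hence \<eta>: "- \<rho> / 2 > 0" by simp
  have f0: "f \<noteq> 0" using nonconst by (metis mero_const_0 rangeI)
  obtain E where E: "E \<in> sets lborel" "emeasure lborel E < \<infinity>"
    and gr: "\<forall>\<eta>>0. \<exists>s1. \<forall>s\<ge>s1. s \<notin> E \<longrightarrow> nevanlinna_char f (exp s) > 0 \<longrightarrow>
      (\<forall>i\<in>{1..m}. nevanlinna_char (lam i) (exp s) \<le> (\<rho> + \<eta>) / mtot * nevanlinna_char f (exp s))"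
    using growth_bound by blast
  have "1 \<in> {1..m}" using m by simp
  obtain s1 where s1: "\<And>s. s \<ge> s1 \<Longrightarrow> s \<notin> E \<Longrightarrow> nevanlinna_char f (exp s) > 0 \<Longrightarrow>
     nevanlinna_char (lam 1) (exp s) \<le> (\<rho> + (- \<rho> / 2)) / mtot * nevanlinna_char f (exp s)"
    using gr[rule_format, OF \<eta>] \<open>1 \<in> {1..m}\<close> by blast
  obtain s2 where s2: "\<And>s. s \<ge> s2 \<Longrightarrow> regular_radius f (exp s) \<Longrightarrow> nevanlinna_char f (exp s) \<ge> 1"
    using nevanlinna_char_unbounded[OF nonconst, of 1] by blast
  obtain s where s: "s \<ge> max 0 (max s1 s2)" "s \<notin> E" "regular_radius f (exp s)"
    using exists_regular_radius[of "{f}" E "max 0 (max s1 s2)"] E f0 by auto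
  have T: "nevanlinna_char f (exp s) \<ge> 1" using s2 s by simp
  have "0 \<le> nevanlinna_char (lam 1) (exp s)" using s by (intro nevanlinna_char_nonneg) auto
  also have "\<dots> \<le> (\<rho> + (- \<rho> / 2)) / mtot * nevanlinna_char f (exp s)"
    using s1[of s] s T by simp
  also have "\<dots> < 0" using \<eta> mtot_pos T by (intro mult_neg_pos divide_neg_pos) auto
  finally show False by simp
qed

text \<open>For each value in \<open>S\<close> the truncated count is at most
  \<open>(\<rho> + \<epsilon> / q) * T\<close> plus a constant, whereas the second main theorem
  demands \<open>(q - 2 - \<epsilon>) * T\<close> minus a constant in total. As \<open>T\<close> is
  unbounded, this is impossible when \<open>q * (1 - \<rho>) > 2\<close>.\<close>

lemma few_values:
  assumes S: "finite S" "real (card S) * (1 - \<rho>) > 2" and rho: "\<rho> < 1"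
    and P0: "\<And>\<zeta>. \<zeta> \<in> S \<Longrightarrow> (\<Sum>i = 1..m. lam i * mero_const (c \<zeta> i)) \<noteq> 0"
    and van: "\<And>\<zeta> z. \<zeta> \<in> S \<Longrightarrow> \<not> mpole f z \<Longrightarrow> mero_eval f z = \<zeta> \<Longrightarrow> (\<And>i. i \<in> {1..m} \<Longrightarrow> \<not> mpole (lam i) z) \<Longrightarrow>
        mero_eval (\<Sum>i = 1..m. lam i * mero_const (c \<zeta> i)) z = 0"
  shows False
proof -
  define q where "q = card S"
  have q2: "real q > 2"
  proof -
    have "real q * (1 - \<rho>) \<le> real q * 1" using rho_nonneg by (intro mult_left_mono) auto
    thus ?thesis using S(2) by (simp add: q_def)
  qed
  have f0: "f \<noteq> 0" using nonconst by (metis mero_const_0 rangeI)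
  have h0: "f - mero_const a \<noteq> 0" for a using nonconst by auto
  \<comment> \<open>A third of the gap: the second main theorem and the growth bounds each use up
    one \<open>\<epsilon>\<close>, and one remains.\<close>
  define \<epsilon> where "\<epsilon> = (real q * (1 - \<rho>) - 2) / 3"
  have \<epsilon>: "\<epsilon> > 0" using S(2) by (simp add: \<epsilon>_def q_def)
  define P where "P = (\<lambda>\<zeta>. \<Sum>i = 1..m. lam i * mero_const (c \<zeta> i))"
  obtain E1 C1 s1 where E1: "E1 \<in> sets lborel" "emeasure lborel E1 < \<infinity>" and s1: "s1 \<ge> 0"
    and smt: "\<And>s. s \<ge> s1 \<Longrightarrow> s \<notin> E1 \<Longrightarrow> regular_radius f (exp s) \<Longrightarrow> regular_radius (mero_deriv f) (exp s) \<Longrightarrow>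
      (\<forall>a\<in>S. regular_radius (f - mero_const a) (exp s)) \<Longrightarrow>
      (real (card S) - 2 - \<epsilon>) * nevanlinna_char f (exp s) \<le> (\<Sum>a\<in>S. reduced_counting f a (exp s)) + C1"
    using second_main_theorem[OF nonconst S(1) _ \<epsilon>] q2 by (auto simp: q_def)
  obtain E2 where E2: "E2 \<in> sets lborel" "emeasure lborel E2 < \<infinity>"
    and gr: "\<forall>\<eta>>0. \<exists>s1. \<forall>s\<ge>s1. s \<notin> E2 \<longrightarrow> nevanlinna_char f (exp s) > 0 \<longrightarrow>
      (\<forall>i\<in>{1..m}. nevanlinna_char (lam i) (exp s) \<le> (\<rho> + \<eta>) / mtot * nevanlinna_char f (exp s))"
    using growth_bound by blast
  have "\<epsilon> / real q > 0" using \<epsilon> q2 by simp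
  then obtain s2 where s2: "\<And>s i. s \<ge> s2 \<Longrightarrow> s \<notin> E2 \<Longrightarrow> nevanlinna_char f (exp s) > 0 \<Longrightarrow> i \<in> {1..m} \<Longrightarrow>
      nevanlinna_char (lam i) (exp s) \<le> (\<rho> + \<epsilon> / real q) / mtot * nevanlinna_char f (exp s)"
    using gr by blast
  define Q where "Q = (\<lambda>\<zeta> C. \<forall>r\<ge>1. regular_radius (P \<zeta>) r \<longrightarrow>
     (\<forall>i\<in>{1..m}. lam i \<noteq> 0 \<longrightarrow> regular_radius (lam i) r) \<longrightarrow>
     reduced_counting f \<zeta> r \<le> (\<Sum>i = 1..m. nevanlinna_char (lam i) r)
        + (\<Sum>i\<in>{i\<in>{1..m}. \<not> is_entire (lam i)}. nevanlinna_char (lam i) r) + C)"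
  have "\<exists>C. Q \<zeta> C" if "\<zeta> \<in> S" for \<zeta>
    unfolding Q_def P_def by (rule reduced_counting_le[OF nonconst finite_atLeastAtMost P0[OF that] van[OF that]])
  then obtain C where C: "\<And>\<zeta>. \<zeta> \<in> S \<Longrightarrow> Q \<zeta> (C \<zeta>)"
    by metis
  define Ct where "Ct = (\<Sum>\<zeta>\<in>S. C \<zeta>) + C1"
  obtain s3 where s3: "\<And>s. s \<ge> s3 \<Longrightarrow> regular_radius f (exp s) \<Longrightarrow> nevanlinna_char f (exp s) \<ge> (\<bar>Ct\<bar> + 1) / \<epsilon>"
    using nevanlinna_char_unbounded[OF nonconst] by blast
  \<comment> \<open>All functions for which the common circle has to be regular; zero coefficients
    are removed, since regularity is meaningful only for nonzero functions.\<close>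
  define Fs where "Fs = {f, mero_deriv f} \<union> (\<lambda>a. f - mero_const a) ` S \<union> P ` S \<union> (lam ` {1..m} - {0})"
  have Fs: "finite Fs" "0 \<notin> Fs"
    using S(1) f0 mero_deriv_nonzero[OF nonconst] h0 P0 by (auto simp: Fs_def P_def)
  have E: "E1 \<union> E2 \<in> sets lborel" "emeasure lborel (E1 \<union> E2) < \<infinity>"
    using emeasure_subadditive[OF E1(1) E2(1)] E1 E2
    by (auto simp: less_top[symmetric] top_unique)
  obtain s where s: "s \<ge> max s1 (max s2 s3)" "s \<notin> E1 \<union> E2" and reg: "\<And>g. g \<in> Fs \<Longrightarrow> regular_radius g (exp s)"
    using exists_regular_radius[OF Fs E] by blast
  define T where "T = nevanlinna_char f (exp s)"
  have T: "T \<ge> (\<bar>Ct\<bar> + 1) / \<epsilon>" unfolding T_def using s reg by (intro s3) (auto simp: Fs_def)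
  have "(\<bar>Ct\<bar> + 1) / \<epsilon> > 0" using \<epsilon> by (intro divide_pos_pos) auto
  with T have Tpos: "T > 0" by linarith
  have r1: "exp s \<ge> 1" using s s1 by simp
  have lamT: "nevanlinna_char (lam i) (exp s) \<le> (\<rho> + \<epsilon> / real q) / mtot * T" if "i \<in> {1..m}" for i
    unfolding T_def using s Tpos that by (intro s2) (auto simp: T_def)
  have red: "reduced_counting f \<zeta> (exp s) \<le> (\<rho> + \<epsilon> / real q) * T + C \<zeta>" if \<zeta>: "\<zeta> \<in> S" for \<zeta>
  proof -
    let ?Ne = "{i\<in>{1..m}. \<not> is_entire (lam i)}"
    have "reduced_counting f \<zeta> (exp s) \<le> (\<Sum>i = 1..m. nevanlinna_char (lam i) (exp s))
        + (\<Sum>i\<in>?Ne. nevanlinna_char (lam i) (exp s)) + C \<zeta>"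
      using C[OF \<zeta>] reg \<zeta> r1 by (simp add: Q_def Fs_def)
    also have "(\<Sum>i = 1..m. nevanlinna_char (lam i) (exp s)) \<le> (\<Sum>i = 1..m. (\<rho> + \<epsilon> / real q) / mtot * T)"
      by (intro sum_mono lamT)
    also have "(\<Sum>i\<in>?Ne. nevanlinna_char (lam i) (exp s)) \<le> (\<Sum>i\<in>?Ne. (\<rho> + \<epsilon> / real q) / mtot * T)"
      by (intro sum_mono lamT) auto
    \<comment> \<open>All \<open>m\<close> coefficients plus the non-entire ones make up exactly the
      denominator \<open>mtot\<close> of the growth hypothesis.\<close>
    also have "(\<Sum>i = 1..m. (\<rho> + \<epsilon> / real q) / mtot * T) + (\<Sum>i\<in>?Ne. (\<rho> + \<epsilon> / real q) / mtot * T)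
        = mtot * ((\<rho> + \<epsilon> / real q) / mtot * T)"
    proof -
      have "(\<Sum>i = 1..m. x) + (\<Sum>i\<in>?Ne. x) = mtot * x" for x :: real
        by (simp add: distrib_right)
      thus ?thesis .
    qed
    also have "\<dots> = (\<rho> + \<epsilon> / real q) * T" using mtot_pos by simp
    finally show ?thesis by simp
  qed
  have "(real q - 2 - \<epsilon>) * T \<le> (\<Sum>a\<in>S. reduced_counting f a (exp s)) + C1"
    unfolding q_def T_def using s reg by (intro smt) (auto simp: Fs_def)
  also have "(\<Sum>a\<in>S. reduced_counting f a (exp s)) \<le> (\<Sum>a\<in>S. (\<rho> + \<epsilon> / real q) * T + C a)"
    by (intro sum_mono red)
  also have "\<dots> = real q * (\<rho> + \<epsilon> / real q) * T + (\<Sum>a\<in>S. C a)"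
    by (simp add: sum.distrib q_def)
  also have "real q * (\<rho> + \<epsilon> / real q) = real q * \<rho> + \<epsilon>" using q2 by (simp add: field_simps)
  finally have "(real q * (1 - \<rho>) - 2 - 2 * \<epsilon>) * T \<le> Ct"
    by (simp add: Ct_def algebra_simps)
  also have "real q * (1 - \<rho>) - 2 - 2 * \<epsilon> = \<epsilon>"
  proof -
    have "3 * \<epsilon> = real q * (1 - \<rho>) - 2" by (simp add: \<epsilon>_def)
    thus ?thesis by linarith
  qed
  finally have "\<epsilon> * T \<le> Ct" .
  moreover have "\<epsilon> * T \<ge> \<bar>Ct\<bar> + 1" using T \<epsilon> by (simp add: field_simps)
  ultimately show False by linarith
qed

end

section \<open>Roots of unity and the theorem\<close>

text \<open>The powers of \<open>f\<close> are replaced by numbers at a single point, so that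
  \<open>few_values\<close> applies to a combination with constant coefficients.\<close>

lemma exp_poly_eval:
  assumes np: "\<not> mpole f z" and ev: "mero_eval f z = \<zeta>" "\<zeta> \<noteq> 0"
    and lam: "\<And>i. i \<in> {1..m} \<Longrightarrow> \<not> mpole (lam i) z" and eps: "\<And>i. i \<in> {1..m} \<Longrightarrow> eps i \<noteq> 0"
  shows "mero_eval (exp_poly m lam eps R f k) z =
    mero_eval (\<Sum>i = 1..m. lam i * mero_const ((eps i * \<zeta> powi R i) powi k)) z"
proof -
  have t: "\<not> mpole (lam i * (mero_const (eps i) * f powi R i) powi k) z"
      "mero_eval (lam i * (mero_const (eps i) * f powi R i) powi k) z = mero_eval (lam i) z * (eps i * \<zeta> powi R i) powi k"
    if i: "i \<in> {1..m}" for i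
  proof -
    have fp: "\<not> mpole (f powi R i) z" "mero_eval (f powi R i) z = \<zeta> powi R i"
      using mero_eval_powi[OF np, of "R i"] ev by auto
    have g: "\<not> mpole (mero_const (eps i) * f powi R i) z" "mero_eval (mero_const (eps i) * f powi R i) z = eps i * \<zeta> powi R i"
      using mero_eval_mult[of "mero_const (eps i)" z "f powi R i"] fp by auto
    have gk: "\<not> mpole ((mero_const (eps i) * f powi R i) powi k) z"
      "mero_eval ((mero_const (eps i) * f powi R i) powi k) z = (eps i * \<zeta> powi R i) powi k"
      using mero_eval_powi[OF g(1), of k] g(2) eps[OF i] ev(2) by auto
    show "\<not> mpole (lam i * (mero_const (eps i) * f powi R i) powi k) z"
      "mero_eval (lam i * (mero_const (eps i) * f powi R i) powi k) z = mero_eval (lam i) z * (eps i * \<zeta> powi R i) powi k"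
      using mero_eval_mult[OF lam[OF i] gk(1)] gk(2) by auto
  qed
  have u: "\<not> mpole (lam i * mero_const x) z" "mero_eval (lam i * mero_const x) z = mero_eval (lam i) z * x" if "i \<in> {1..m}" for i x
    using mero_eval_mult[OF lam[OF that], of "mero_const x"] by auto
  show ?thesis
    unfolding exp_poly_def using mero_eval_sum[of "{1..m}" _ z] t u by simp
qed

text \<open>The difference of the two products is divisible by \<open>p ^ \<alpha>\<close>, and
  \<open>K\<close> accounts for only \<open>multiplicity p K\<close> of these factors, so
  \<open>p ^ (\<alpha> - multiplicity p K)\<close> divides \<open>u - t\<close>, which is smaller.
  This will show that certain roots of unity have distinct \<open>K\<close>-th powers.\<close>

lemma root_exponent_inj:
  fixes p K t u \<alpha> :: nat
  assumes p: "prime p" and K: "K > 0" and le: "multiplicity p K \<le> \<alpha>"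
    and tu: "t < p ^ (\<alpha> - multiplicity p K)" "u < p ^ (\<alpha> - multiplicity p K)"
    and eq: "(t * K) mod p ^ \<alpha> = (u * K) mod p ^ \<alpha>"
  shows "t = u"
proof -
  have aux: "t = u" if "t \<le> u" and u: "u < p ^ (\<alpha> - multiplicity p K)"
    and eq: "(u * K) mod p ^ \<alpha> = (t * K) mod p ^ \<alpha>" for t u
  proof (rule ccontr)
    assume "t \<noteq> u"
    hence pos: "u - t > 0" using \<open>t \<le> u\<close> by simp
    have "p ^ \<alpha> dvd u * K - t * K"
      using eq \<open>t \<le> u\<close> by (subst mod_eq_dvd_iff_nat[symmetric]) (auto intro: mult_right_mono)
    hence "p ^ \<alpha> dvd (u - t) * K" by (simp add: diff_mult_distrib)
    hence "\<alpha> \<le> multiplicity p ((u - t) * K)"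
      using pos K p by (intro multiplicity_geI) auto
    also have "\<dots> = multiplicity p (u - t) + multiplicity p K"
      using pos K p by (intro prime_elem_multiplicity_mult_distrib) auto
    finally have "p ^ (\<alpha> - multiplicity p K) dvd u - t"
      by (intro multiplicity_dvd') simp
    hence "p ^ (\<alpha> - multiplicity p K) \<le> u - t" using pos by (rule dvd_imp_le)
    thus False using u by simp
  qed
  show ?thesis
    using aux[of t u] aux[of u t] tu eq by (cases "t \<le> u") auto
qed

text \<open>
  Multiplying by \<open>X powi - lo\<close> turns the Laurent polynomial into an ordinary one whose degree is
  the spread of its exponents.
\<close>

lemma laurent_to_poly:
  fixes c :: "nat \<Rightarrow> mero" and R :: "nat \<Rightarrow> int"
  assumes m: "m \<ge> 1"
  defines "lo \<equiv> Min (R ` {1..m})"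
  defines "Q \<equiv> (\<Sum>i = 1..m. monom (c i) (nat (R i - lo)))"
  shows "X \<noteq> 0 \<Longrightarrow> (\<Sum>i = 1..m. c i * X powi R i) = X powi lo * poly Q X"
    and "degree Q \<le> nat (Max (R ` {1..m}) - Min (R ` {1..m}))"
    and "Q = 0 \<Longrightarrow> (\<Sum>i = 1..m. Poly_Mapping.single (R i) (c i)) = 0"
proof -
  have lo: "lo \<le> R i" "R i \<le> Max (R ` {1..m})" if "i \<in> {1..m}" for i
    using that by (auto simp: lo_def)
  show "(\<Sum>i = 1..m. c i * X powi R i) = X powi lo * poly Q X" if X: "X \<noteq> 0"
  proof -
    have "c i * X powi R i = X powi lo * (c i * X ^ nat (R i - lo))" if "i \<in> {1..m}" for i
    proof -
      have "X powi R i = X powi (lo + int (nat (R i - lo)))" using lo[OF that] by simp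
      also have "\<dots> = X powi lo * X ^ nat (R i - lo)"
        by (simp only: power_int_add[OF disjI1[OF X]] power_int_of_nat)
      finally show ?thesis by simp
    qed
    hence "(\<Sum>i = 1..m. c i * X powi R i) = (\<Sum>i = 1..m. X powi lo * (c i * X ^ nat (R i - lo)))"
      by (rule sum.cong[OF refl])
    thus ?thesis by (simp add: Q_def poly_sum poly_monom sum_distrib_left)
  qed
  show "degree Q \<le> nat (Max (R ` {1..m}) - Min (R ` {1..m}))"
    unfolding Q_def
  proof (intro degree_sum_le)
    fix i assume i: "i \<in> {1..m}"
    have "degree (monom (c i) (nat (R i - lo))) \<le> nat (R i - lo)" by (rule degree_monom_le)
    also have "\<dots> \<le> nat (Max (R ` {1..m}) - Min (R ` {1..m}))"
      using lo[OF i] by (simp add: lo_def)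
    finally show "degree (monom (c i) (nat (R i - lo))) \<le> nat (Max (R ` {1..m}) - Min (R ` {1..m}))" .
  qed simp
  show "(\<Sum>i = 1..m. Poly_Mapping.single (R i) (c i)) = 0" if Q: "Q = 0"
  proof (rule poly_mapping_eqI)
    fix l
    have "Poly_Mapping.lookup (\<Sum>i = 1..m. Poly_Mapping.single (R i) (c i)) l = (\<Sum>i = 1..m. if R i = l then c i else 0)"
      by (simp add: lookup_sum lookup_single when_def)
    also have "\<dots> = 0"
    \<comment> \<open>Below \<open>lo\<close>, \<open>nat (l - lo)\<close> is truncated to 0 and
      would name the wrong coefficient, but no exponent lies there. From \<open>lo\<close> on the
      shift is faithful.\<close>
    proof (cases "l < lo")
      case True
      thus ?thesis using lo(1) by (intro sum.neutral) fastforce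
    next
      case False
      have "(\<Sum>i = 1..m. if R i = l then c i else 0) = (\<Sum>i = 1..m. coeff (monom (c i) (nat (R i - lo))) (nat (l - lo)))"
        using lo(1) False by (intro sum.cong refl) fastforce
      also have "\<dots> = coeff Q (nat (l - lo))" by (simp add: Q_def coeff_sum)
      finally show ?thesis using Q by simp
    qed
    finally show "Poly_Mapping.lookup (\<Sum>i = 1..m. Poly_Mapping.single (R i) (c i)) l = Poly_Mapping.lookup 0 l" by simp
  qed
qed

lemma mero_eval_root_unity_vanishes:
  assumes "\<not> mpole f z" "mero_eval f z = \<zeta>" "\<zeta> ^ a = 1"
  shows "vanishes_at (f ^ a - 1) z"
proof -
  have "\<not> mpole (f ^ a) z" "mero_eval (f ^ a) z = 1"
    using mero_eval_power[OF assms(1), of a] assms by auto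
  thus ?thesis
    using mero_eval_diff[of "f ^ a" z 1] mero_const_not_pole[of 1 z] by (simp add: vanishes_at_def)
qed

theorem theorem2:
  fixes m :: nat and f :: mero and lam :: "nat \<Rightarrow> mero" and \<rho> :: real
    and R :: "nat \<Rightarrow> int" and eps :: "nat \<Rightarrow> complex"
    and e a :: nat and k :: int
  assumes m: "m \<ge> 1"
    and nonconst: "f \<notin> range mero_const"
    and rho: "\<rho> < 1"
    and growth: "\<And>i. i \<in> {1..m} \<Longrightarrow>
      \<exists>h. is_small_error f h \<and>
          (\<forall>r>0. nevanlinna_char (lam i) r \<le>
             \<rho> / real (m + card {j \<in> {1..m}. \<not> is_entire (lam j)}) * nevanlinna_char f r + h r)"
    and roots: "\<And>i. i \<in> {1..m} \<Longrightarrow> \<exists>d>0. eps i ^ d = 1"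
    and e_gt: "real e > 2 / (1 - \<rho>)"
    and e_eps: "\<And>i. i \<in> {1..m} \<Longrightarrow> eps i ^ e = 1"
    and a_pos: "a > 0"
    and a_val: "\<And>p :: nat. prime p \<Longrightarrow> p dvd e \<Longrightarrow>
      real p powi (1 + int (multiplicity p a) - int (multiplicity p e)) >
        of_int (Max (R ` {1..m}) - Min (R ` {1..m})) + 2 / (1 - \<rho>)"
    and vanish: "\<And>z. vanishes_at (f ^ a - 1) z \<Longrightarrow> vanishes_at (exp_poly m lam eps R f k) z"
  shows "(int e dvd k \<longrightarrow> (\<Sum>i = 1..m. lam i) = 0 \<and> exp_poly m lam eps R f 0 = 0) \<and>
    (\<not> int e dvd k \<longrightarrow> laurent_poly m lam eps R k = 0 \<and> exp_poly m lam eps R f k = 0)"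
proof -
  interpret small_coefficients m f lam \<rho>
    by unfold_locales (use m nonconst growth in auto)
  note \<rho>0 = rho_nonneg
  \<comment> \<open>Here \<open>\<rho> \<ge> 0\<close> enters. The bound yields \<open>e > 0\<close>
    and keeps the right side of \<open>a_val\<close> above 1.\<close>
  have two: "2 / (1 - \<rho>) \<ge> 2" using \<rho>0 rho by (simp add: field_simps)
  have "real e > 0" using e_gt two by linarith
  hence e0: "e > 0" by simp
  have f0: "f \<noteq> 0" using nonconst by (metis mero_const_0 rangeI)
  have eps0: "eps i \<noteq> 0" if "i \<in> {1..m}" for i
    using e_eps[OF that] e0 by (auto simp: power_0_left)
  define N where "N = Max (R ` {1..m}) - Min (R ` {1..m})"
  have N0: "N \<ge> 0"
  proof -
    have "R 1 \<in> R ` {1..m}" using m by simp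
    hence "Min (R ` {1..m}) \<le> R 1" "R 1 \<le> Max (R ` {1..m})" by (intro Min_le Max_ge; simp)+
    thus ?thesis by (simp add: N_def)
  qed
  \<comment> \<open>Otherwise the exponent in \<open>a_val\<close> is at most 0 and the power at
    most 1, while the right side is at least 2.\<close>
  have val: "multiplicity p e \<le> multiplicity p a" if p: "prime p" "p dvd e" for p :: nat
  proof (rule ccontr)
    assume "\<not> multiplicity p e \<le> multiplicity p a"
    hence "1 + int (multiplicity p a) - int (multiplicity p e) \<le> 0" by simp
    hence "real p powi (1 + int (multiplicity p a) - int (multiplicity p e)) \<le> real p powi 0"
      using prime_gt_0_nat[OF p(1)] by (intro power_int_increasing) auto
    thus False using a_val[OF p] two N0 unfolding N_def[symmetric] by simp
  qed
  have e_dvd_a: "e dvd a"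
  proof (rule multiplicity_le_imp_dvd)
    fix p :: nat assume p: "prime p"
    show "multiplicity p e \<le> multiplicity p a"
      using val[OF p] by (cases "p dvd e") (auto simp: not_dvd_imp_multiplicity_0)
  qed (use e0 in simp)
  have van: "mero_eval (\<Sum>i = 1..m. lam i * mero_const ((eps i * \<zeta> powi R i) powi k)) z = 0"
    if "\<zeta> ^ a = 1" "\<not> mpole f z" "mero_eval f z = \<zeta>" "\<And>i. i \<in> {1..m} \<Longrightarrow> \<not> mpole (lam i) z" for \<zeta> z
  proof -
    have "\<zeta> \<noteq> 0" using that(1) a_pos by (auto simp: power_0_left)
    have "vanishes_at (exp_poly m lam eps R f k) z"
      by (rule vanish[OF mero_eval_root_unity_vanishes[OF that(2,3,1)]])
    thus ?thesis
      using exp_poly_eval[OF that(2,3) \<open>\<zeta> \<noteq> 0\<close> that(4) eps0] by (simp add: vanishes_at_def)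
  qed
  show ?thesis
  proof (intro conjI impI)
    assume ek: "int e dvd k"
    show sum0: "(\<Sum>i = 1..m. lam i) = 0"
    proof (rule ccontr)
      assume nz: "(\<Sum>i = 1..m. lam i) \<noteq> 0"
      \<comment> \<open>As \<open>e\<close> divides \<open>a\<close>, these are \<open>a\<close>-th
        roots of unity; as it divides \<open>k\<close>, each coefficient
        \<open>(eps i * \<zeta> powi R i) powi k\<close> is 1. All \<open>e\<close> values thus give
        the same combination, the sum of the \<open>lam i\<close>.\<close>
      define S where "S = {\<zeta> :: complex. \<zeta> ^ e = 1}"
      have S: "finite S" "card S = e"
        using card_nth_roots[of 1 e] finite_nth_roots[of e 1] e0 by (auto simp: S_def)
      have one: "(eps i * \<zeta> powi R i) powi k = 1" if "\<zeta> \<in> S" "i \<in> {1..m}" for \<zeta> i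
      proof -
        obtain j where j: "k = int e * j" using ek by (auto elim: dvdE)
        have "(\<zeta> powi R i) ^ e = (\<zeta> ^ e) powi R i"
          by (metis mult.commute power_int_mult power_int_of_nat)
        hence "(eps i * \<zeta> powi R i) ^ e = 1"
          using that e_eps by (simp add: S_def power_mult_distrib)
        thus ?thesis by (simp add: j power_int_mult power_int_of_nat)
      qed
      have root: "\<zeta> ^ a = 1" if "\<zeta> \<in> S" for \<zeta>
      proof -
        obtain j where "a = e * j" using e_dvd_a by (auto elim: dvdE)
        thus ?thesis using that by (simp add: S_def power_mult)
      qed
      show False
      proof (rule few_values[OF S(1), of "\<lambda>\<zeta> i. (eps i * \<zeta> powi R i) powi k"])
        show "real (card S) * (1 - \<rho>) > 2" using e_gt rho by (simp add: S field_simps)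
        show "(\<Sum>i = 1..m. lam i * mero_const ((eps i * \<zeta> powi R i) powi k)) \<noteq> 0" if "\<zeta> \<in> S" for \<zeta>
          using nz one[OF that] by simp
      qed (use rho van root in auto)
    qed
    show "exp_poly m lam eps R f 0 = 0"
      using sum0 by (simp add: exp_poly_def)
  next
    assume nek: "\<not> int e dvd k"
    \<comment> \<open>Multiplicities and the injectivity lemma are used for natural numbers; the
      sign of \<open>k\<close> is dealt with in \<open>\<eta>_inj\<close>.\<close>
    define K where "K = nat \<bar>k\<bar>"
    have "k \<noteq> 0" using nek by auto
    hence K: "K > 0" by (simp add: K_def)
    have "\<not> e dvd K"
      using nek unfolding K_def by (metis dvd_abs_iff int_dvd_int_iff int_nat_eq abs_ge_zero)
    then obtain p where p: "prime p" "multiplicity p K < multiplicity p e"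
      using multiplicity_le_imp_dvd[of e K] e0 by (metis not_less less_numeral_extra(3))
    have pe: "p dvd e" using p(2) by (metis not_dvd_imp_multiplicity_0 not_less_zero)
    define \<alpha> where "\<alpha> = multiplicity p a"
    define \<kappa> where "\<kappa> = multiplicity p K"
    have \<kappa>: "\<kappa> < multiplicity p e" "multiplicity p e \<le> \<alpha>"
      using p val[OF p(1) pe] by (auto simp: \<alpha>_def \<kappa>_def)
    define n where "n = p ^ \<alpha>"
    \<comment> \<open>The \<open>K\<close>-th powers of the \<open>p ^ \<alpha>\<close>-th roots of
      unity form a group of order \<open>d\<close>. Since
      \<open>\<kappa> < multiplicity p e\<close>, \<open>d\<close> is at least the power in
      \<open>a_val\<close>.\<close>
    define d where "d = p ^ (\<alpha> - \<kappa>)"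
    have n1: "1 \<le> n" using prime_gt_0_nat[OF p(1)] by (simp add: n_def)
    have d_gt: "real d > of_int N + 2 / (1 - \<rho>)"
    proof -
      have "real p powi (1 + int \<alpha> - int (multiplicity p e)) \<le> real p powi (int (\<alpha> - \<kappa>))"
        using \<kappa> prime_gt_0_nat[OF p(1)] by (intro power_int_increasing) auto
      also have "\<dots> = real d" by (simp add: d_def power_int_of_nat)
      finally show ?thesis using a_val[OF p(1) pe] by (simp add: N_def \<alpha>_def)
    qed
    \<comment> \<open>Roots of unity of order dividing \<open>n = p ^ \<alpha>\<close>; they are
      \<open>a\<close>-th roots because \<open>n\<close> divides \<open>a\<close>.\<close>
    define \<omega> where "\<omega> = (\<lambda>t::nat. exp (2 * of_real pi * \<i> * of_nat t / of_nat n))"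
    have \<omega>_pow: "\<omega> t ^ j = \<omega> (t * j)" for t j
      by (simp add: \<omega>_def exp_of_nat_mult[symmetric] algebra_simps)
    have \<omega>0: "\<omega> t \<noteq> 0" for t by (simp add: \<omega>_def)
    have \<omega>_root: "\<omega> t ^ a = 1" for t
    proof -
      have "n dvd t * a" unfolding n_def \<alpha>_def by (intro dvd_mult multiplicity_dvd)
      thus ?thesis using complex_root_unity_eq_1[OF n1, of "t * a"] unfolding \<omega>_pow by (simp add: \<omega>_def)
    qed
    have \<eta>_inj: "t = u" if "t < d" "u < d" "\<omega> t powi k = \<omega> u powi k" for t u
    proof -
      have "\<omega> t ^ K = \<omega> u ^ K"
        using that(3) by (cases "k \<ge> 0") (auto simp: power_int_def K_def power_inverse)
      hence "(t * K) mod n = (u * K) mod n"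
        unfolding \<omega>_pow using complex_root_unity_eq[OF n1, of "t * K" "u * K"] by (simp add: \<omega>_def)
      thus ?thesis
        using root_exponent_inj[OF p(1) K, of \<alpha> t u] that(1,2) \<kappa> by (simp add: n_def d_def \<kappa>_def)
    qed
    define c where "c = (\<lambda>i. lam i * mero_const (eps i) powi k)"
    define Q where "Q = (\<Sum>i = 1..m. monom (c i) (nat (R i - Min (R ` {1..m}))))"
    note Q = laurent_to_poly(1)[OF m, where c = c and R = R, folded Q_def]
      laurent_to_poly(2)[OF m, where c = c and R = R, folded Q_def]
      laurent_to_poly(3)[OF m, where c = c and R = R, folded Q_def]
    \<comment> \<open>Used with constant \<open>X\<close> to test whether a root of unity leads to a
      root of \<open>Q\<close>, and with \<open>X = f\<close> to read off \<open>exp_poly\<close>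
      once \<open>Q = 0\<close>.\<close>
    have comb: "(\<Sum>i = 1..m. lam i * (mero_const (eps i) * X powi R i) powi k) = (X powi k) powi Min (R ` {1..m}) * poly Q (X powi k)"
      if "X \<noteq> 0" for X
    proof -
      have "lam i * (mero_const (eps i) * X powi R i) powi k = c i * (X powi k) powi R i" for i
        by (simp add: c_def power_int_mult_distrib power_int_mult[symmetric] mult.commute[of k] mult.assoc)
      thus ?thesis using Q(1)[of "X powi k"] that by simp
    qed
    have Pval: "(\<Sum>i = 1..m. lam i * mero_const ((eps i * \<zeta> powi R i) powi k)) = 0 \<longleftrightarrow> poly Q (mero_const (\<zeta> powi k)) = 0"
      if "\<zeta> \<noteq> 0" for \<zeta>
      using comb[of "mero_const \<zeta>"] that by (simp add: mero_const_powi mero_const_mult)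
    have "Q = 0"
    proof (rule ccontr)
      assume Qnz: "Q \<noteq> 0"
      \<comment> \<open>At most \<open>N\<close> exponents are bad, since the powers
        \<open>\<omega> t powi k\<close> are distinct for \<open>t < d\<close> and
        \<open>degree Q \<le> N\<close>. The remaining ones number more than
        \<open>2 / (1 - \<rho>)\<close>.\<close>
      define B where "B = {t \<in> {..<d}. poly Q (mero_const (\<omega> t powi k)) = 0}"
      have "card B = card ((\<lambda>t. mero_const (\<omega> t powi k)) ` B)"
        by (intro card_image[symmetric] inj_onI) (auto simp: B_def intro: \<eta>_inj)
      also have "\<dots> \<le> card {x. poly Q x = 0}"
        by (intro card_mono poly_roots_finite Qnz) (auto simp: B_def)
      also have "\<dots> \<le> degree Q" by (rule card_poly_roots_bound[OF Qnz])
      also have "\<dots> \<le> nat N" using Q(2) by (simp add: N_def)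
      finally have B: "real (card B) \<le> of_int N" using N0 by linarith
      define S where "S = \<omega> ` ({..<d} - B)"
      have "inj_on \<omega> ({..<d} - B)" by (intro inj_onI) (auto intro: \<eta>_inj)
      hence "card S = card ({..<d} - B)" unfolding S_def by (rule card_image)
      also have "\<dots> = d - card B" by (subst card_Diff_subset) (auto simp: B_def)
      finally have "real (card S) > 2 / (1 - \<rho>)" using B d_gt by linarith
      hence cS: "real (card S) * (1 - \<rho>) > 2" using rho by (simp add: field_simps)
      show False
      proof (rule few_values[OF _ cS rho, of "\<lambda>\<zeta> i. (eps i * \<zeta> powi R i) powi k"])
        show "finite S" by (simp add: S_def)
        show "(\<Sum>i = 1..m. lam i * mero_const ((eps i * \<zeta> powi R i) powi k)) \<noteq> 0" if "\<zeta> \<in> S" for \<zeta>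
          using that Pval[of \<zeta>] \<omega>0 by (auto simp: S_def B_def)
        show "mero_eval (\<Sum>i = 1..m. lam i * mero_const ((eps i * \<zeta> powi R i) powi k)) z = 0"
          if "\<zeta> \<in> S" "\<not> mpole f z" "mero_eval f z = \<zeta>" "\<And>i. i \<in> {1..m} \<Longrightarrow> \<not> mpole (lam i) z" for \<zeta> z
          using that \<omega>_root by (intro van) (auto simp: S_def)
      qed
    qed
    show "laurent_poly m lam eps R k = 0"
      using Q(3)[OF \<open>Q = 0\<close>] by (simp add: laurent_poly_def c_def)
    show "exp_poly m lam eps R f k = 0"
      using comb[OF f0] \<open>Q = 0\<close> by (simp add: exp_poly_def)
  qed
qed

end
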